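(* Let $n\ge 2$, $q=2^n$, and let $H(T)=(T^n-1)/(T-1)=1+T+\dots+T^{n-1}\in\mathbb{F}_2[T]$. Let $m$ be a positive integer with $m\mid (q+1)$ and let $p(T)\in\mathbb{F}_2[T]$ be a divisor of $H(T)$ of degree $d$. Let $F=\mathbb{F}_{q^2}(w,z)$ be the function field over $\mathbb{F}_{q^2}$ defined by $$w^{(q+1)/m}=z^{H(T)/p(T)}.$$ Then $F$ is a maximal function field over $\mathbb{F}_{q^2}$ with genus $$g(F)=\frac{q+1-m}{2m}\left(2^{n-1-d}-1\right).$$
   Context: For $f(T)=\sum_i a_iT^i\in\mathbb{F}_2[T]$ and an element $u$ of a field of characteristic $2$, $u^{f(T)}:=\sum_i a_iu^{2^i}$ (so $z^{H(T)/p(T)}$ is an additive polynomial in $z$ of degree $2^{n-1-d}$). A function field $F/\mathbb{F}_{q^2}$ of genus $g$ is maximal if its number of rational places equals $q^2+1+2gq$. *)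

theory Defs
  imports
    Complex_Main
    "HOL-Library.Z2"
    "HOL-Computational_Algebra.Polynomial"
    "Berlekamp_Zassenhaus.Finite_Field"
begin

text \<open>
  An extension \<open>F/K\<close> of fields is given by types \<open>'k\<close> (for \<open>K\<close>) and \<open>'a\<close> (for \<open>F\<close>) and an
  embedding \<open>\<iota> :: 'k \<Rightarrow> 'a\<close> with \<open>field_hom \<iota>\<close>. The notions below follow Stichtenoth, Algebraic
  Function Fields and Codes, Chapter 1.
\<close>

section \<open>Function fields\<close>

definition is_subfield :: "'a::field set \<Rightarrow> bool" where
  "is_subfield S \<longleftrightarrow> 0 \<in> S \<and> 1 \<in> S \<and> (\<forall>x\<in>S. \<forall>y\<in>S. x + y \<in> S \<and> x * y \<in> S) \<and>
     (\<forall>x\<in>S. - x \<in> S \<and> inverse x \<in> S)"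

definition generated_subfield :: "'a::field set \<Rightarrow> 'a set" where
  "generated_subfield X = \<Inter> {S. is_subfield S \<and> X \<subseteq> S}"

definition algebraic_over :: "('k::field \<Rightarrow> 'a::field) \<Rightarrow> 'a \<Rightarrow> bool" where
  "algebraic_over \<iota> x \<longleftrightarrow> (\<exists>f::'k poly. f \<noteq> 0 \<and> poly (map_poly \<iota> f) x = 0)"

definition finite_extension_of :: "'a::field set \<Rightarrow> bool" where
  "finite_extension_of L \<longleftrightarrow>
     (\<exists>B. finite B \<and> (\<forall>x. \<exists>c. (\<forall>b\<in>B. c b \<in> L) \<and> x = (\<Sum>b\<in>B. c b * b)))"

text \<open>The last conjunct is the usual convention that \<open>K\<close> is the full constant field of \<open>F\<close>.\<close>

definition function_field :: "('k::field \<Rightarrow> 'a::field) \<Rightarrow> bool" where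
  "function_field \<iota> \<longleftrightarrow> field_hom \<iota> \<and>
     (\<exists>x. \<not> algebraic_over \<iota> x \<and> finite_extension_of (generated_subfield (insert x (range \<iota>)))) \<and>
     {x. algebraic_over \<iota> x} = range \<iota>"

section \<open>Places and valuations\<close>

definition valuation_ring :: "('k::field \<Rightarrow> 'a::field) \<Rightarrow> 'a set \<Rightarrow> bool" where
  "valuation_ring \<iota> R \<longleftrightarrow> range \<iota> \<subset> R \<and> R \<subset> UNIV \<and>
     (\<forall>x\<in>R. \<forall>y\<in>R. x + y \<in> R \<and> x - y \<in> R \<and> x * y \<in> R) \<and>
     (\<forall>x. x \<noteq> 0 \<longrightarrow> x \<in> R \<or> inverse x \<in> R)"

definition ring_units :: "'a::field set \<Rightarrow> 'a set" where
  "ring_units R = {x \<in> R. \<exists>y\<in>R. x * y = 1}"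

text \<open>A place is the maximal ideal, i.e. the set of non-units, of a valuation ring.\<close>

definition places :: "('k::field \<Rightarrow> 'a::field) \<Rightarrow> 'a set set" where
  "places \<iota> = {R - ring_units R | R. valuation_ring \<iota> R}"

text \<open>The valuation ring is recovered from its place \<open>P\<close> as the set of all \<open>x\<close> with
  \<open>x\<^sup>-\<^sup>1 \<notin> P\<close>, together with \<open>0\<close> (for which \<open>inverse 0 = 0 \<in> P\<close>).\<close>

definition place_ring :: "'a::field set \<Rightarrow> 'a set" where
  "place_ring P = {x. x = 0 \<or> inverse x \<notin> P}"

definition prime_element :: "'a::field set \<Rightarrow> 'a \<Rightarrow> bool" where
  "prime_element P t \<longleftrightarrow> P = {t * x | x. x \<in> place_ring P}"

text \<open>The normalised discrete valuation; only meaningful for \<open>x \<noteq> 0\<close>.\<close>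

definition place_val :: "'a::field set \<Rightarrow> 'a \<Rightarrow> int" where
  "place_val P x = (THE k. \<exists>t u. prime_element P t \<and> u \<in> ring_units (place_ring P) \<and>
     x = t powi k * u)"

text \<open>The residue classes of \<open>B\<close> form a \<open>K\<close>-basis of the residue class field; the unique
  coefficient function is normalised to vanish outside \<open>B\<close>.\<close>

definition residue_basis :: "('k::field \<Rightarrow> 'a::field) \<Rightarrow> 'a set \<Rightarrow> 'a set \<Rightarrow> bool" where
  "residue_basis \<iota> P B \<longleftrightarrow> finite B \<and> B \<subseteq> place_ring P \<and>
     (\<forall>x\<in>place_ring P. \<exists>!c::'a \<Rightarrow> 'k. (\<forall>b. b \<notin> B \<longrightarrow> c b = 0) \<and> x - (\<Sum>b\<in>B. \<iota> (c b) * b) \<in> P)"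

definition place_degree :: "('k::field \<Rightarrow> 'a::field) \<Rightarrow> 'a set \<Rightarrow> nat" where
  "place_degree \<iota> P = (THE d. \<exists>B. residue_basis \<iota> P B \<and> card B = d)"

definition rational_places :: "('k::field \<Rightarrow> 'a::field) \<Rightarrow> 'a set set" where
  "rational_places \<iota> = {P \<in> places \<iota>. place_degree \<iota> P = 1}"

section \<open>Divisors and the genus\<close>

definition divisors :: "('k::field \<Rightarrow> 'a::field) \<Rightarrow> ('a set \<Rightarrow> int) set" where
  "divisors \<iota> = {A. finite {P. A P \<noteq> 0} \<and> {P. A P \<noteq> 0} \<subseteq> places \<iota>}"

definition divisor_degree :: "('k::field \<Rightarrow> 'a::field) \<Rightarrow> ('a set \<Rightarrow> int) \<Rightarrow> int" where
  "divisor_degree \<iota> A = (\<Sum>P | A P \<noteq> 0. A P * int (place_degree \<iota> P))"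

definition riemann_roch_space :: "('k::field \<Rightarrow> 'a::field) \<Rightarrow> ('a set \<Rightarrow> int) \<Rightarrow> 'a set" where
  "riemann_roch_space \<iota> A = {x. x = 0 \<or> (\<forall>P\<in>places \<iota>. place_val P x \<ge> - A P)}"

lemma vector_space_field_hom:
  assumes "field_hom \<iota>"
  shows "vector_space (\<lambda>c x. \<iota> c * x)"
proof -
  interpret field_hom \<iota> by fact
  show ?thesis by unfold_locales (simp_all add: algebra_simps hom_distribs)
qed

definition divisor_dim :: "('k::field \<Rightarrow> 'a::field) \<Rightarrow> ('a set \<Rightarrow> int) \<Rightarrow> nat" where
  "divisor_dim \<iota> A = vector_space.dim (\<lambda>c x. \<iota> c * x) (riemann_roch_space \<iota> A)"

definition genus :: "('k::field \<Rightarrow> 'a::field) \<Rightarrow> int" where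
  "genus \<iota> = Sup {divisor_degree \<iota> A - int (divisor_dim \<iota> A) + 1 | A. A \<in> divisors \<iota>}"

definition maximal_function_field :: "nat \<Rightarrow> ('k::field \<Rightarrow> 'a::field) \<Rightarrow> bool" where
  "maximal_function_field q \<iota> \<longleftrightarrow> function_field \<iota> \<and> CARD('k) = q\<^sup>2 \<and>
     finite (rational_places \<iota>) \<and>
     int (card (rational_places \<iota>)) = int q ^ 2 + 1 + 2 * genus \<iota> * int q"

section \<open>Additive polynomials\<close>

text \<open>\<open>additive_power u f\<close> is the element written \<open>u\<^bsup>f(T)\<^esup>\<close>, for \<open>f\<close> over the field with two elements.\<close>

definition additive_power :: "'a::field \<Rightarrow> bit poly \<Rightarrow> 'a" where
  "additive_power u f = (\<Sum>i\<le>degree f. of_bool (coeff f i = 1) * u ^ (2 ^ i))"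

definition H_poly :: "nat \<Rightarrow> bit poly" where
  "H_poly n = (\<Sum>i<n. monom 1 i)"

lemma H_poly_eq: "H_poly n = (monom 1 n - 1) div (monom 1 1 - 1)"
proof -
  have "(monom 1 1 - 1) * H_poly n = monom 1 n - 1"
    using power_diff_1_eq[of "monom (1::bit) 1" n] by (simp add: H_poly_def monom_power)
  moreover have "coeff (monom 1 1 - 1 :: bit poly) 1 \<noteq> 0"
    by simp
  then have "(monom 1 1 - 1 :: bit poly) \<noteq> 0"
    by (metis coeff_0)
  ultimately show ?thesis
    by (metis nonzero_mult_div_cancel_left)
qed

end

theory Submission
  imports Defs
begin

text \<open>
  Write \<open>N = (q + 1) / m\<close>, \<open>A(z) = z\<^bsup>H/p\<^esup>\<close> and \<open>D = deg A = 2\<^bsup>n-1-d\<^esup>\<close>, so that the curve is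
  \<open>w\<^sup>N = A(z)\<close> with \<open>N\<close> and \<open>D\<close> coprime and \<open>A' = 1\<close>. At a place with a pole of \<open>z\<close> the monomials
  \<open>z\<^sup>i w\<^sup>j\<close> with \<open>j < N\<close> have the distinct pole orders \<open>Ni + Dj\<close>; hence there is exactly one such
  place, it is rational, and the functions regular elsewhere, which form the ring \<open>R = K[z, w]\<close>,
  have the numerical semigroup generated by \<open>N\<close> and \<open>D\<close> as pole orders. The \<open>(N-1)(D-1)/2\<close> gaps of
  this semigroup give the genus.

  At all other places some \<open>w\<^sup>Q - w\<close>, with \<open>Q\<close> a power of \<open>|K|\<close>, is a uniformizer. The Riemann
  inequality with the constant above follows by comparing an arbitrary divisor with a multiple of
  the zero divisor of such an element, whose degree is bounded by the Chinese remainder theorem and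
  a count in the finite spaces of functions of bounded pole order.

  Rational places other than the one at infinity correspond to the solutions of \<open>b\<^sup>N = A(a)\<close> in \<open>K\<close>.
  Additive polynomials over the field with two elements commute, so the image of \<open>A\<close> on \<open>K\<close> is the
  kernel of \<open>(T\<^sup>n - 1)(T - 1)p\<close>; writing \<open>b\<close> as a product of an element of the field with \<open>q\<close>
  elements and a \<open>(q+1)\<close>-st root of unity then yields \<open>q\<^sup>2 + (N-1)(D-1)q\<close> solutions.
\<close>

section \<open>Valuation rings\<close>

text \<open>The field is known only through two generators and one equation, while the definitions
  speak about all of its valuation rings. Chevalley's extension argument
  (\<open>valuation_ring_exists\<close>) produces places, and leading terms identify them. The
  obstacle at infinity is that no place is available to begin with: \<open>\<tau>\<close>, a
  monomial in \<open>z\<close> and \<open>w\<close> with integer exponents, is therefore chosen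
  before any place, and leading terms with respect to it are the same at every pole of
  \<open>z\<close>. This gives the uniqueness of that place and the irreducibility of the equation
  together. Away from infinity everything rests on the finiteness of \<open>R\<close> modulo a
  nonzero element: pigeonhole then gives finite residue fields and stops the extraction of factors.
  Since \<open>K\<close> is finite, degrees and dimensions are compared as exponents of
  cardinalities. The genus is defined as a supremum, so the Riemann inequality together with one
  divisor that attains its constant, a multiple of the place at infinity, determines it.\<close>

definition place_of :: "'a::field set \<Rightarrow> 'a set" where
  "place_of V = V - ring_units V"

lemma places_eq: "places \<iota> = place_of ` {V. valuation_ring \<iota> V}"
  by (auto simp: places_def place_of_def)

locale valued_extension = field_hom \<iota> for \<iota> :: "'k::field \<Rightarrow> 'a::field" +
  fixes V :: "'a set"
  assumes valuation_ring: "valuation_ring \<iota> V"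
begin

lemma const_mem: "\<iota> c \<in> V"
  using valuation_ring by (auto simp: valuation_ring_def)

lemma zero_mem: "0 \<in> V" and one_mem: "1 \<in> V"
  using const_mem[of 0] const_mem[of 1] by simp_all

lemma add_mem: "x \<in> V \<Longrightarrow> y \<in> V \<Longrightarrow> x + y \<in> V"
  and diff_mem: "x \<in> V \<Longrightarrow> y \<in> V \<Longrightarrow> x - y \<in> V"
  and mult_mem: "x \<in> V \<Longrightarrow> y \<in> V \<Longrightarrow> x * y \<in> V"
  using valuation_ring by (auto simp: valuation_ring_def)

lemma minus_mem: "x \<in> V \<Longrightarrow> - x \<in> V"
  using diff_mem[OF zero_mem] by simp

lemma inverse_mem: "x \<notin> V \<Longrightarrow> inverse x \<in> V"
  using valuation_ring zero_mem by (cases "x = 0") (auto simp: valuation_ring_def)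

lemma power_mem: "x \<in> V \<Longrightarrow> x ^ n \<in> V"
  by (induction n) (auto intro: one_mem mult_mem)

lemma sum_mem: "(\<And>i. i \<in> I \<Longrightarrow> f i \<in> V) \<Longrightarrow> sum f I \<in> V"
  by (induction I rule: infinite_finite_induct) (auto intro: zero_mem add_mem)

lemma not_UNIV: "V \<noteq> UNIV"
  using valuation_ring by (auto simp: valuation_ring_def)

lemma unit_iff: "x \<in> ring_units V \<longleftrightarrow> x \<noteq> 0 \<and> x \<in> V \<and> inverse x \<in> V"
proof
  assume "x \<in> ring_units V"
  then obtain y where "x \<in> V" "y \<in> V" "x * y = 1" by (auto simp: ring_units_def)
  then show "x \<noteq> 0 \<and> x \<in> V \<and> inverse x \<in> V" using inverse_unique[of x y] by auto
next
  assume "x \<noteq> 0 \<and> x \<in> V \<and> inverse x \<in> V"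
  then show "x \<in> ring_units V" by (auto simp: ring_units_def intro: bexI[of _ "inverse x"])
qed

lemma place_iff: "x \<in> place_of V \<longleftrightarrow> x = 0 \<or> x \<in> V \<and> inverse x \<notin> V"
  using zero_mem by (auto simp: place_of_def unit_iff)

lemma place_mem: "x \<in> place_of V \<Longrightarrow> x \<in> V"
  by (simp add: place_of_def)

lemma zero_place: "0 \<in> place_of V"
  by (simp add: place_iff)

lemma one_not_place: "1 \<notin> place_of V"
  by (simp add: place_iff one_mem)

lemma inverse_place: "x \<notin> V \<Longrightarrow> inverse x \<in> place_of V"
  by (simp add: place_iff inverse_mem)

lemma not_place_unit: "x \<in> V \<Longrightarrow> x \<notin> place_of V \<Longrightarrow> x \<in> ring_units V"
  by (simp add: place_of_def)

lemma unit_not_place: "x \<in> ring_units V \<Longrightarrow> x \<notin> place_of V"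
  by (simp add: place_of_def)

lemma unit_mem: "x \<in> ring_units V \<Longrightarrow> x \<in> V"
  by (simp add: unit_iff)

lemma place_mult: "x \<in> place_of V \<Longrightarrow> y \<in> V \<Longrightarrow> x * y \<in> place_of V"
proof -
  assume x: "x \<in> place_of V" and y: "y \<in> V"
  show ?thesis
  proof (cases "x * y = 0")
    case False
    then have "inverse x = y * inverse (x * y)" by (simp add: field_simps)
    then show ?thesis
      using x y False mult_mem place_mem by (metis mult_eq_0_iff place_iff)
  qed (use zero_place in auto)
qed

lemma place_mult': "x \<in> V \<Longrightarrow> y \<in> place_of V \<Longrightarrow> x * y \<in> place_of V"
  using place_mult[of y x] by (simp add: mult.commute)

lemma place_minus: "x \<in> place_of V \<Longrightarrow> - x \<in> place_of V"
  using place_mult[of x "-1"] minus_mem[OF one_mem] by simp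

text \<open>One of \<open>x / y\<close> and \<open>y / x\<close> lies in \<open>V\<close>; the sum
  is then the denominator times an element of \<open>V\<close>.\<close>

lemma place_add:
  assumes "x \<in> place_of V" "y \<in> place_of V"
  shows "x + y \<in> place_of V"
proof -
  have *: "x + y \<in> place_of V" if "x \<in> place_of V" "y \<in> place_of V" "y \<noteq> 0" "x / y \<in> V" for x y
  proof -
    have "x + y = y * (x / y + 1)" using that by (simp add: field_simps)
    then show ?thesis using that by (auto intro: place_mult add_mem one_mem)
  qed
  show ?thesis
  proof (cases "x = 0 \<or> y = 0")
    case False
    show ?thesis
    proof (cases "x / y \<in> V")
      case False
      then have "y / x \<in> V" using inverse_mem[of "x / y"] by simp
      then show ?thesis using *[of y x] assms \<open>\<not> (x = 0 \<or> y = 0)\<close> by (simp add: add.commute)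
    qed (use * assms False in auto)
  qed (use assms in auto)
qed

lemma place_diff: "x \<in> place_of V \<Longrightarrow> y \<in> place_of V \<Longrightarrow> x - y \<in> place_of V"
  using place_add[of x "- y"] place_minus by simp

lemma place_sum: "(\<And>i. i \<in> I \<Longrightarrow> f i \<in> place_of V) \<Longrightarrow> sum f I \<in> place_of V"
  by (induction I rule: infinite_finite_induct) (auto intro: zero_place place_add)

lemma place_power: "x \<in> place_of V \<Longrightarrow> 0 < n \<Longrightarrow> x ^ n \<in> place_of V"
  by (cases n) (auto intro: place_mult power_mem place_mem)

lemma place_diff_trans: "x - y \<in> place_of V \<Longrightarrow> y - u \<in> place_of V \<Longrightarrow> x - u \<in> place_of V"
  using place_add[of "x - y" "y - u"] by simp

lemma place_diff_sym: "x - y \<in> place_of V \<Longrightarrow> y - x \<in> place_of V"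
  using place_minus[of "x - y"] by simp

lemma place_diff_mult:
  assumes "x - x' \<in> place_of V" "y - y' \<in> place_of V" "x' \<in> V" "y \<in> V"
  shows "x * y - x' * y' \<in> place_of V"
proof -
  have "x * y - x' * y' = (x - x') * y + x' * (y - y')" by (simp add: algebra_simps)
  then show ?thesis using assms by (auto intro: place_add place_mult place_mult')
qed

lemma const_place_iff: "\<iota> c \<in> place_of V \<longleftrightarrow> c = 0"
proof (cases "c = 0")
  case False
  then have "inverse (\<iota> c) \<in> V" using const_mem[of "inverse c"] by (simp add: hom_distribs)
  then show ?thesis using False by (simp add: place_iff)
qed (simp add: zero_place)

lemma const_unit: "c \<noteq> 0 \<Longrightarrow> \<iota> c \<in> ring_units V"
  using const_place_iff const_mem not_place_unit by blast

lemma unit_mult: "x \<in> ring_units V \<Longrightarrow> y \<in> ring_units V \<Longrightarrow> x * y \<in> ring_units V"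
  by (auto simp: unit_iff mult_mem)

lemma unit_inverse: "x \<in> ring_units V \<Longrightarrow> inverse x \<in> ring_units V"
  by (auto simp: unit_iff)

lemma unit_power: "x \<in> ring_units V \<Longrightarrow> x ^ n \<in> ring_units V"
  by (induction n) (auto simp: unit_mult const_unit[of 1, simplified])

lemma place_prime: "x \<in> V \<Longrightarrow> y \<in> V \<Longrightarrow> x * y \<in> place_of V \<Longrightarrow> x \<in> place_of V \<or> y \<in> place_of V"
  using unit_mult not_place_unit unit_not_place by blast

text \<open>That \<open>x\<close> lies in \<open>V\<close> is part of the claim: otherwise
  \<open>x ^ n\<close> and its inverse would both be in the maximal ideal.\<close>

lemma place_powerD:
  assumes "x ^ n \<in> place_of V" "0 < n"
  shows "x \<in> place_of V"
proof -
  have "x \<in> V"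
  proof (rule ccontr)
    assume "x \<notin> V"
    then have "inverse x ^ n \<in> place_of V" using inverse_place place_power assms by blast
    then have "x ^ n * inverse x ^ n \<in> place_of V" using place_mult[OF assms(1)] place_mem by blast
    moreover have "x \<noteq> 0" using \<open>x \<notin> V\<close> zero_mem by auto
    ultimately show False using one_not_place by (simp flip: power_mult_distrib)
  qed
  then show ?thesis using not_place_unit unit_power unit_not_place assms by blast
qed

lemma unit_of_congruent: "x - u \<in> place_of V \<Longrightarrow> u \<in> ring_units V \<Longrightarrow> x \<in> ring_units V"
proof -
  assume a: "x - u \<in> place_of V" "u \<in> ring_units V"
  have "x = (x - u) + u" by simp
  then have "x \<in> V" using a add_mem place_mem unit_mem by metis
  moreover have "x \<notin> place_of V" using a place_diff[of x "x - u"] unit_not_place by auto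
  ultimately show ?thesis by (rule not_place_unit)
qed

lemma congruent_inverse:
  assumes "x - u \<in> place_of V" "u \<in> ring_units V"
  shows "inverse x - inverse u \<in> place_of V"
proof -
  have x: "x \<in> ring_units V" using unit_of_congruent assms .
  have "inverse x - inverse u = (x - u) * (- (inverse x * inverse u))"
    using x assms(2) by (auto simp: unit_iff field_simps)
  moreover have "- (inverse x * inverse u) \<in> V"
    using x assms(2) by (auto simp: unit_iff minus_mem mult_mem)
  ultimately show ?thesis using assms(1) place_mult by metis
qed

lemma one_unit_mult: "x - 1 \<in> place_of V \<Longrightarrow> y - 1 \<in> place_of V \<Longrightarrow> x * y - 1 \<in> place_of V"
proof -
  assume a: "x - 1 \<in> place_of V" "y - 1 \<in> place_of V"
  then have "y \<in> V" using add_mem[OF place_mem[OF a(2)] one_mem] by simp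
  then show ?thesis using place_diff_mult[of x 1 y 1] a one_mem by simp
qed

lemma one_unit_power: "x - 1 \<in> place_of V \<Longrightarrow> x ^ n - 1 \<in> place_of V"
  by (induction n) (auto simp: zero_place one_unit_mult)

lemma one_unit_unit: "x - 1 \<in> place_of V \<Longrightarrow> x \<in> ring_units V"
  using unit_of_congruent const_unit[of 1] by simp

lemma one_unit_powi: "x - 1 \<in> place_of V \<Longrightarrow> x powi k - 1 \<in> place_of V"
  using one_unit_power[of x "nat k"] one_unit_power[of "inverse x" "nat (- k)"]
    congruent_inverse[of x 1] const_unit[of 1]
  by (simp add: power_int_def)

lemma place_ring_place_of: "place_ring (place_of V) = V"
  using zero_mem inverse_mem by (auto simp: place_ring_def place_iff)

text \<open>If \<open>x\<close> had a pole, dividing its relation by \<open>x ^ n\<close> would put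
  the nonzero leading coefficient into the maximal ideal. This is one half of the determination of
  the constant field.\<close>

lemma algebraic_mem:
  assumes "algebraic_over \<iota> x"
  shows "x \<in> V"
proof (rule ccontr)
  assume x: "x \<notin> V"
  then have x0: "x \<noteq> 0" using zero_mem by auto
  have u: "inverse x \<in> place_of V" using x by (rule inverse_place)
  obtain f where f: "f \<noteq> 0" "poly (map_poly \<iota> f) x = 0"
    using assms by (auto simp: algebraic_over_def)
  let ?n = "degree f"
  have "0 = inverse x ^ ?n * (\<Sum>i\<le>?n. \<iota> (coeff f i) * x ^ i)"
    using f(2) by (simp add: poly_altdef)
  also have "\<dots> = (\<Sum>i\<le>?n. \<iota> (coeff f i) * inverse x ^ (?n - i))"
    unfolding sum_distrib_left
  proof (rule sum.cong)
    fix i assume i: "i \<in> {..?n}"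
    then have "inverse x ^ ?n = inverse x ^ (?n - i) * inverse x ^ i"
      by (simp flip: power_add)
    then show "inverse x ^ ?n * (\<iota> (coeff f i) * x ^ i) = \<iota> (coeff f i) * inverse x ^ (?n - i)"
      using x0 by (simp add: field_simps)
  qed simp
  also have "\<dots> = \<iota> (lead_coeff f) + (\<Sum>i<?n. \<iota> (coeff f i) * inverse x ^ (?n - i))"
    by (simp flip: lessThan_Suc_atMost)
  finally have "\<iota> (lead_coeff f) = - (\<Sum>i<?n. \<iota> (coeff f i) * inverse x ^ (?n - i))"
    by (simp add: eq_neg_iff_add_eq_0)
  moreover have "(\<Sum>i<?n. \<iota> (coeff f i) * inverse x ^ (?n - i)) \<in> place_of V"
    using u by (intro place_sum place_mult' const_mem place_power) auto
  ultimately show False using place_minus const_place_iff f(1) by (metis leading_coeff_0_iff)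
qed

end

section \<open>Discrete valuation rings, given by a uniformizer\<close>

definition uniformizer :: "'a::field set \<Rightarrow> 'a \<Rightarrow> bool" where
  "uniformizer V t \<longleftrightarrow> t \<in> place_of V \<and> t \<noteq> 0 \<and>
     (\<forall>x. x \<noteq> 0 \<longrightarrow> (\<exists>k u. u \<in> ring_units V \<and> x = t powi k * u))"

locale discretely_valued_extension = valued_extension \<iota> V
    for \<iota> :: "'k::field \<Rightarrow> 'a::field" and V :: "'a set" +
  fixes t :: 'a
  assumes uniformizer: "uniformizer V t"
begin

abbreviation val :: "'a \<Rightarrow> int" where
  "val \<equiv> place_val (place_of V)"

lemma t_place: "t \<in> place_of V" and t_nonzero: "t \<noteq> 0"
  using uniformizer by (auto simp: uniformizer_def)

lemma powi_mem_iff: "t powi k \<in> V \<longleftrightarrow> 0 \<le> k"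
proof
  show "0 \<le> k" if "t powi k \<in> V"
  proof (rule ccontr)
    assume "\<not> 0 \<le> k"
    then have "t powi (- k) \<in> place_of V"
      using place_power[OF t_place, of "nat (- k)"] by (simp add: power_int_def)
    then have "t powi k * t powi (- k) \<in> place_of V" using that place_mult' by blast
    then show False using one_not_place t_nonzero by (simp flip: power_int_add)
  qed
qed (simp add: power_int_def power_mem place_mem t_place)

lemma unit_powi_iff: "t powi k \<in> ring_units V \<longleftrightarrow> k = 0"
  using powi_mem_iff[of k] powi_mem_iff[of "- k"] t_nonzero
  by (auto simp: unit_iff power_int_minus)

lemma powi_unit_unique:
  assumes "t powi k * u = t powi l * u'" "u \<in> ring_units V" "u' \<in> ring_units V"
  shows "k = l"
proof -
  have "t powi (k - l) = u' * inverse u"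
    using assms t_nonzero by (auto simp: unit_iff power_int_diff field_simps)
  then have "t powi (k - l) \<in> ring_units V" using assms by (simp add: unit_mult unit_inverse)
  then show ?thesis by (simp add: unit_powi_iff)
qed

lemma powi_mult_unit_mem_iff: "u \<in> ring_units V \<Longrightarrow> t powi k * u \<in> V \<longleftrightarrow> 0 \<le> k"
proof -
  assume u: "u \<in> ring_units V"
  have "t powi k = (t powi k * u) * inverse u" using u by (auto simp: unit_iff)
  then show ?thesis
    using powi_mem_iff u by (metis mult_mem unit_iff)
qed

lemma decompose:
  assumes "x \<noteq> 0"
  obtains k u where "u \<in> ring_units V" "x = t powi k * u"
  using assms uniformizer by (auto simp: uniformizer_def)

lemma prime_element_uniformizer: "prime_element (place_of V) t"
  unfolding prime_element_def place_ring_place_of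
proof (intro equalityI subsetI)
  fix x assume x: "x \<in> place_of V"
  show "x \<in> {t * y |y. y \<in> V}"
  proof (cases "x = 0")
    case False
    then obtain k u where u: "u \<in> ring_units V" and x': "x = t powi k * u" by (rule decompose)
    have "0 \<le> k" using x' u x powi_mult_unit_mem_iff place_mem by blast
    moreover have "k \<noteq> 0" using x' u x unit_not_place by auto
    ultimately have "t powi (k - 1) * u \<in> V" using u powi_mult_unit_mem_iff by simp
    moreover have "x = t * (t powi (k - 1) * u)"
      using x' t_nonzero by (simp add: power_int_diff)
    ultimately show ?thesis by blast
  qed (auto intro: exI[of _ 0] zero_mem)
qed (auto intro: place_mult t_place)

text \<open>The description in \<open>place_val\<close> ranges over all prime elements; they differ
  from \<open>t\<close> by units only, so the exponent is well defined.\<close>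

lemma prime_element_associated:
  assumes "prime_element (place_of V) s"
  obtains u where "u \<in> ring_units V" "s = t * u"
proof -
  have s: "s \<in> place_of V"
    using assms one_mem unfolding prime_element_def place_ring_place_of by force
  obtain y where y: "y \<in> V" "s = t * y"
    using prime_element_uniformizer s unfolding prime_element_def place_ring_place_of by blast
  obtain y' where y': "y' \<in> V" "t = s * y'"
    using assms t_place unfolding prime_element_def place_ring_place_of by blast
  have "y * y' = 1" using y y' t_nonzero by (metis mult.assoc mult_cancel_left1)
  then have "y \<in> ring_units V" using y y' by (auto simp: ring_units_def)
  with y that show thesis by blast
qed

lemma powi_unit: "u \<in> ring_units V \<Longrightarrow> u powi k \<in> ring_units V"
  by (auto simp: power_int_def unit_power unit_inverse)

lemma val_eqI:
  assumes "u \<in> ring_units V" "x = t powi k * u"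
  shows "val x = k"
  unfolding place_val_def place_ring_place_of
proof (rule the_equality)
  show "\<exists>s u. prime_element (place_of V) s \<and> u \<in> ring_units V \<and> x = s powi k * u"
    using prime_element_uniformizer assms by blast
next
  fix l assume "\<exists>s u. prime_element (place_of V) s \<and> u \<in> ring_units V \<and> x = s powi l * u"
  then obtain s u' where s: "prime_element (place_of V) s" and u': "u' \<in> ring_units V"
    and x: "x = s powi l * u'" by blast
  obtain u'' where u'': "u'' \<in> ring_units V" "s = t * u''" using s by (rule prime_element_associated)
  have "x = t powi l * (u'' powi l * u')" using x u'' by (simp add: power_int_mult_distrib)
  then show "l = k"
    using assms powi_unit_unique powi_unit u' u'' unit_mult by metis
qed

lemma val_decompose:
  assumes "x \<noteq> 0"
  obtains u where "u \<in> ring_units V" "x = t powi (val x) * u"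
  using assms decompose val_eqI by metis

lemma val_mult: "x \<noteq> 0 \<Longrightarrow> y \<noteq> 0 \<Longrightarrow> val (x * y) = val x + val y"
proof -
  assume x: "x \<noteq> 0" and y: "y \<noteq> 0"
  obtain k u where u: "u \<in> ring_units V" "x = t powi k * u" using x by (rule decompose)
  obtain l u' where u': "u' \<in> ring_units V" "y = t powi l * u'" using y by (rule decompose)
  have "x * y = t powi (k + l) * (u * u')"
    using u u' t_nonzero by (simp add: power_int_add mult_ac)
  then show ?thesis using u u' unit_mult val_eqI by metis
qed

lemma val_unit: "u \<in> ring_units V \<Longrightarrow> val u = 0"
  by (rule val_eqI[of u]) auto

lemma val_t: "val t = 1"
  using val_eqI[of 1 t 1] const_unit[of 1] by simp

lemma val_inverse: "x \<noteq> 0 \<Longrightarrow> val (inverse x) = - val x"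
  using val_mult[of x "inverse x"] val_unit[of 1] const_unit[of 1] by simp

lemma val_power: "x \<noteq> 0 \<Longrightarrow> val (x ^ n) = int n * val x"
  using val_unit[of 1] const_unit[of 1]
  by (induction n) (simp_all add: val_mult algebra_simps)

lemma val_powi: "x \<noteq> 0 \<Longrightarrow> val (x powi k) = k * val x"
  by (simp add: power_int_def val_power val_inverse)

lemma val_nonneg_iff: "x \<noteq> 0 \<Longrightarrow> 0 \<le> val x \<longleftrightarrow> x \<in> V"
  by (erule val_decompose) (metis powi_mult_unit_mem_iff)

lemma unit_iff_val: "x \<in> ring_units V \<longleftrightarrow> x \<noteq> 0 \<and> val x = 0"
  using val_nonneg_iff[of x] val_nonneg_iff[of "inverse x"] val_inverse[of x]
  by (auto simp: unit_iff)

lemma val_pos_iff: "x \<noteq> 0 \<Longrightarrow> 0 < val x \<longleftrightarrow> x \<in> place_of V"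
  using val_nonneg_iff[of x] unit_iff_val[of x] by (auto simp: place_of_def)

lemma val_ge_iff: "x \<noteq> 0 \<Longrightarrow> k \<le> val x \<longleftrightarrow> x * t powi (- k) \<in> V"
  using val_nonneg_iff[of "x * t powi (- k)"] t_nonzero
  by (simp add: val_mult val_powi val_t)

lemma val_minus: "x \<noteq> 0 \<Longrightarrow> val (- x) = val x"
  using val_mult[of "-1" x] val_unit[of "-1"] unit_iff[of "-1"] minus_mem[OF one_mem] by simp

end

section \<open>Existence of places\<close>

definition subring :: "'a::field set \<Rightarrow> bool" where
  "subring B \<longleftrightarrow> 1 \<in> B \<and> (\<forall>x\<in>B. \<forall>y\<in>B. x + y \<in> B \<and> x - y \<in> B \<and> x * y \<in> B)"

definition ideal_of :: "'a::field set \<Rightarrow> 'a set \<Rightarrow> bool" where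
  "ideal_of B J \<longleftrightarrow> 0 \<in> J \<and> J \<subseteq> B \<and> (\<forall>x\<in>J. \<forall>y\<in>J. x + y \<in> J) \<and> (\<forall>x\<in>B. \<forall>y\<in>J. x * y \<in> J)"

lemma ideal_sum: "ideal_of B J \<Longrightarrow> (\<And>i. i \<in> I \<Longrightarrow> f i \<in> J) \<Longrightarrow> sum f I \<in> J"
  by (induction I rule: infinite_finite_induct) (auto simp: ideal_of_def)

lemma subring_zero: "subring B \<Longrightarrow> 0 \<in> B"
  by (auto simp: subring_def) (metis diff_self)

lemma subring_sum: "subring B \<Longrightarrow> (\<And>i. i \<in> I \<Longrightarrow> f i \<in> B) \<Longrightarrow> sum f I \<in> B"
  by (induction I rule: infinite_finite_induct) (use subring_zero in \<open>auto simp: subring_def\<close>)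

text \<open>Used in two ways: for a ring \<open>B\<close> it is \<open>B[x]\<close>, for an ideal
  \<open>J\<close> of \<open>B\<close> it is the ideal that \<open>J\<close> generates in
  \<open>B[x]\<close>.\<close>

definition adjoin :: "'a::field set \<Rightarrow> 'a \<Rightarrow> 'a set" where
  "adjoin B x = {poly f x | f. \<forall>i. coeff f i \<in> B}"

lemma adjoinI: "(\<And>i. coeff f i \<in> B) \<Longrightarrow> poly f x = y \<Longrightarrow> y \<in> adjoin B x"
  unfolding adjoin_def by blast

lemma adjoinE:
  assumes "y \<in> adjoin B x"
  obtains f where "\<And>i. coeff f i \<in> B" "y = poly f x"
  using assms unfolding adjoin_def by blast

lemma adjoin_base: "0 \<in> B \<Longrightarrow> b \<in> B \<Longrightarrow> b \<in> adjoin B x"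
  by (rule adjoinI[of "[:b:]"]) (auto simp: coeff_pCons split: nat.splits)

lemma subring_adjoin:
  assumes "subring B"
  shows "subring (adjoin B x)"
proof -
  have "1 \<in> adjoin B x" using adjoin_base subring_zero assms by (auto simp: subring_def)
  moreover have "u + v \<in> adjoin B x \<and> u - v \<in> adjoin B x \<and> u * v \<in> adjoin B x"
    if uv: "u \<in> adjoin B x" "v \<in> adjoin B x" for u v
  proof -
    obtain f where f: "\<And>i. coeff f i \<in> B" "u = poly f x" by (rule adjoinE[OF uv(1)]) (rule that; simp)
    obtain g where g: "\<And>i. coeff g i \<in> B" "v = poly g x" by (rule adjoinE[OF uv(2)]) (rule that; simp)
    have B: "b + c \<in> B" "b - c \<in> B" "b * c \<in> B" if "b \<in> B" "c \<in> B" for b c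
      using assms that by (auto simp: subring_def)
    have "coeff (f * g) i \<in> B" for i
      unfolding coeff_mult by (intro subring_sum[OF assms] B f g)
    then show ?thesis
      using f g B adjoinI[of "f + g" B x] adjoinI[of "f - g" B x] adjoinI[of "f * g" B x] by auto
  qed
  ultimately show ?thesis by (auto simp: subring_def)
qed

lemma ideal_of_adjoin:
  assumes "subring B" "ideal_of B J"
  shows "ideal_of (adjoin B x) (adjoin J x)"
proof -
  have J: "0 \<in> J" "J \<subseteq> B" "\<And>b c. b \<in> J \<Longrightarrow> c \<in> J \<Longrightarrow> b + c \<in> J" "\<And>b c. b \<in> B \<Longrightarrow> c \<in> J \<Longrightarrow> b * c \<in> J"
    using assms(2) by (auto simp: ideal_of_def)
  have "0 \<in> adjoin J x" using adjoin_base J(1) by blast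
  moreover have "adjoin J x \<subseteq> adjoin B x" using J(2) by (auto simp: adjoin_def)
  moreover have "u + v \<in> adjoin J x" if uv: "u \<in> adjoin J x" "v \<in> adjoin J x" for u v
  proof -
    obtain f where f: "\<And>i. coeff f i \<in> J" "u = poly f x" by (rule adjoinE[OF uv(1)]) (rule that; simp)
    obtain g where g: "\<And>i. coeff g i \<in> J" "v = poly g x" by (rule adjoinE[OF uv(2)]) (rule that; simp)
    show ?thesis using f g J adjoinI[of "f + g" J x] by auto
  qed
  moreover have "u * v \<in> adjoin J x" if uv: "u \<in> adjoin B x" "v \<in> adjoin J x" for u v
  proof -
    obtain f where f: "\<And>i. coeff f i \<in> B" "u = poly f x" by (rule adjoinE[OF uv(1)]) (rule that; simp)
    obtain g where g: "\<And>i. coeff g i \<in> J" "v = poly g x" by (rule adjoinE[OF uv(2)]) (rule that; simp)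
    have "coeff (f * g) i \<in> J" for i
      unfolding coeff_mult by (intro ideal_sum[OF assms(2)] J f g)
    then show ?thesis using f g adjoinI[of "f * g" J x] by auto
  qed
  ultimately show ?thesis by (auto simp: ideal_of_def)
qed

text \<open>The leading term of a relation \<open>1 = f(x)\<close> is eliminated with the help of a relation
  \<open>1 = g(x\<^sup>-\<^sup>1)\<close> of at most the same degree.\<close>

lemma unit_relation_reduce:
  fixes x :: "'a::field"
  assumes B: "subring B" and J: "ideal_of B J" and J1: "1 \<notin> J" and x: "x \<noteq> 0"
    and f: "\<And>i. coeff f i \<in> J" "poly f x = 1"
    and g: "\<And>i. coeff g i \<in> J" "poly g (inverse x) = 1"
    and le: "degree g \<le> degree f"
  shows "\<exists>h. (\<forall>i. coeff h i \<in> J) \<and> poly h x = 1 \<and> degree h < degree f"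
proof -
  define m l a b where "m = degree f" and "l = degree g" and "a = coeff f m" and "b = coeff g 0"
  have JB: "c \<in> J \<Longrightarrow> c \<in> B" "c \<in> J \<Longrightarrow> d \<in> J \<Longrightarrow> c + d \<in> J" "c \<in> B \<Longrightarrow> d \<in> J \<Longrightarrow> c * d \<in> J" "0 \<in> J"
    for c d using J by (auto simp: ideal_of_def)
  have m: "0 < m"
  proof (rule ccontr)
    assume "\<not> 0 < m"
    then obtain c where "f = [:c:]" using m_def by (metis degree_eq_zeroE not_gr_zero)
    then show False using f(1)[of 0] f(2) J1 by simp
  qed
  \<comment> \<open>By the relation for \<open>f\<close>, also
    \<open>b + (1 - b) * f(x) = 1\<close>. Its top term \<open>(1 - b) * a * x ^ m\<close> is
    rewritten as \<open>g'(x)\<close>, because \<open>1 - b\<close> is the part of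
    \<open>g(1/x)\<close> in positive powers of \<open>1/x\<close>.\<close>
  define f' where "f' = (\<Sum>i<m. monom ((1 - b) * coeff f i) i)"
  define g' where "g' = (\<Sum>i\<in>{1..l}. monom (a * coeff g i) (m - i))"
  define h where "h = [:b:] + f' + g'"
  have lm: "l \<le> m" using le by (simp add: l_def m_def)
  have "1 - b \<in> B" using B g(1)[of 0] JB(1) by (auto simp: subring_def b_def)
  then have cf: "coeff f' i \<in> J" for i
    unfolding f'_def coeff_sum coeff_monom by (intro ideal_sum[OF J]) (auto intro: JB f)
  have cg: "coeff g' i \<in> J" for i
    unfolding g'_def coeff_sum coeff_monom a_def by (intro ideal_sum[OF J]) (auto intro: JB f g)
  have "\<forall>i. coeff h i \<in> J"
    using cf cg g(1)[of 0] JB by (auto simp: h_def coeff_pCons b_def split: nat.splits)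
  moreover have "degree h < m"
  proof -
    have "degree f' < m"
      unfolding f'_def using m by (intro degree_sum_less) (auto intro: le_less_trans[OF degree_monom_le])
    moreover have "degree g' < m"
      unfolding g'_def using m by (intro degree_sum_less) (auto intro: le_less_trans[OF degree_monom_le])
    ultimately show ?thesis using m unfolding h_def by (intro degree_add_less) auto
  qed
  moreover have "poly h x = 1"
  proof -
    have "1 = (\<Sum>i<m. coeff f i * x ^ i) + a * x ^ m"
      using f(2) by (simp add: poly_altdef m_def a_def flip: lessThan_Suc_atMost)
    then have "(\<Sum>i<m. coeff f i * x ^ i) = 1 - a * x ^ m" by (simp add: eq_diff_eq)
    moreover have "poly f' x = (1 - b) * (\<Sum>i<m. coeff f i * x ^ i)"
      by (simp add: f'_def poly_sum poly_monom sum_distrib_left mult.assoc)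
    ultimately have F: "poly f' x = (1 - b) * (1 - a * x ^ m)" by simp
    have "1 = b + (\<Sum>i\<in>{1..l}. coeff g i * inverse x ^ i)"
      using g(2) unfolding poly_altdef l_def b_def atMost_atLeast0
      by (simp add: sum.atLeast_Suc_atMost del: power_inverse)
    then have "a * x ^ m * (1 - b) = a * x ^ m * (\<Sum>i\<in>{1..l}. coeff g i * inverse x ^ i)"
      by (metis add_diff_cancel_left')
    also have "\<dots> = poly g' x"
      unfolding g'_def poly_sum poly_monom sum_distrib_left
    proof (rule sum.cong)
      fix i assume "i \<in> {1..l}"
      then have "x ^ m = x ^ (m - i) * x ^ i" using lm by (simp flip: power_add)
      then show "a * x ^ m * (coeff g i * inverse x ^ i) = a * coeff g i * x ^ (m - i)"
        using x by (simp add: field_simps)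
    qed simp
    finally have G: "poly g' x = a * x ^ m * (1 - b)" by simp
    show ?thesis unfolding h_def poly_add F G by (simp add: algebra_simps)
  qed
  ultimately show ?thesis using m_def by blast
qed

text \<open>Otherwise take relations of minimal degree for \<open>x\<close> and for
  \<open>inverse x\<close>; the one of larger degree can be shortened by the other, against
  minimality.\<close>

lemma adjoin_proper_or:
  assumes B: "subring B" and J: "ideal_of B J" and J1: "1 \<notin> J" and x: "x \<noteq> 0"
  shows "1 \<notin> adjoin J x \<or> 1 \<notin> adjoin J (inverse x)"
proof (rule ccontr)
  assume "\<not> ?thesis"
  then have "1 \<in> adjoin J x" and "1 \<in> adjoin J (inverse x)" by auto
  define F where "F y = {f. (\<forall>i. coeff f i \<in> J) \<and> poly f y = 1}" for y :: 'a
  have ne: "F y \<noteq> {}" if "1 \<in> adjoin J y" for y using that by (auto simp: F_def adjoin_def)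
  define mn where "mn y = (ARG_MIN degree f. f \<in> F y)" for y
  have mn: "mn y \<in> F y" "f \<in> F y \<Longrightarrow> degree (mn y) \<le> degree f" if "1 \<in> adjoin J y" for y f
    using arg_min_nat_lemma[of "\<lambda>f. f \<in> F y" _ degree] ne[OF that] by (auto simp: mn_def)
  have *: False if "1 \<in> adjoin J y" "1 \<in> adjoin J (inverse y)" "y \<noteq> 0"
      "degree (mn (inverse y)) \<le> degree (mn y)" for y
  proof -
    have "\<exists>h. (\<forall>i. coeff h i \<in> J) \<and> poly h y = 1 \<and> degree h < degree (mn y)"
      using mn(1)[OF that(1)] mn(1)[OF that(2)] that
      by (intro unit_relation_reduce[OF B J J1, of y "mn y" "mn (inverse y)"]) (auto simp: F_def)
    then show False using mn(2)[OF that(1)] by (fastforce simp: F_def)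
  qed
  show False
  proof (cases "degree (mn (inverse x)) \<le> degree (mn x)")
    case False
    then show False
      using *[of "inverse x"] x \<open>1 \<in> adjoin J x\<close> \<open>1 \<in> adjoin J (inverse x)\<close> by simp
  qed (use * x \<open>1 \<in> adjoin J x\<close> \<open>1 \<in> adjoin J (inverse x)\<close> in auto)
qed

text \<open>Pairs of a ring and an ideal are encoded as subsets of \<open>'a \<times> bool\<close>, so that Zorn's lemma for
  set inclusion applies.\<close>

theorem valuation_ring_exists:
  fixes \<iota> :: "'k::field \<Rightarrow> 'a::field"
  assumes hom: "field_hom \<iota>" and A: "subring A" "range \<iota> \<subseteq> A"
    and I: "ideal_of A I" "1 \<notin> I" "I \<noteq> {0}"
  shows "\<exists>V. valuation_ring \<iota> V \<and> A \<subseteq> V \<and> I \<subseteq> place_of V"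
proof -
  define rg where "rg E = {x. (x, False) \<in> E}" for E :: "('a \<times> bool) set"
  define id where "id E = {x. (x, True) \<in> E}" for E :: "('a \<times> bool) set"
  define \<A> where "\<A> = {E. subring (rg E) \<and> ideal_of (rg E) (id E) \<and> 1 \<notin> id E \<and> A \<subseteq> rg E \<and> I \<subseteq> id E}"
  define enc where "enc B J = B \<times> {False} \<union> J \<times> {True}" for B J :: "'a set"
  have enc: "rg (enc B J) = B" "id (enc B J) = J" for B J
    by (auto simp: rg_def id_def enc_def)
  have mono: "rg E \<subseteq> rg E'" "id E \<subseteq> id E'" if "E \<subseteq> E'" for E E'
    using that by (auto simp: rg_def id_def)
  have "enc A I \<in> \<A>" using A I by (simp add: \<A>_def enc)
  then have "\<A> \<noteq> {}" by blast
  moreover have "\<Union>\<C> \<in> \<A>" if "\<C> \<noteq> {}" and C: "subset.chain \<A> \<C>" for \<C>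
  proof -
    have CA: "E \<in> \<A>" if "E \<in> \<C>" for E using that C by (auto simp: subset.chain_def)
    have U: "rg (\<Union>\<C>) = (\<Union>E\<in>\<C>. rg E)" "id (\<Union>\<C>) = (\<Union>E\<in>\<C>. id E)" by (auto simp: rg_def id_def)
    \<comment> \<open>Ring and ideal axioms involve two elements at a time, and these already lie in
      a common member of the chain.\<close>
    have two: "\<exists>E\<in>\<C>. E1 \<subseteq> E \<and> E2 \<subseteq> E" if "E1 \<in> \<C>" "E2 \<in> \<C>" for E1 E2
      using that C unfolding subset_chain_def by (metis order_refl)
    obtain E0 where E0: "E0 \<in> \<C>" using \<open>\<C> \<noteq> {}\<close> by blast
    have "subring (rg (\<Union>\<C>))"
    proof -
      have "x + y \<in> rg (\<Union>\<C>) \<and> x - y \<in> rg (\<Union>\<C>) \<and> x * y \<in> rg (\<Union>\<C>)"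
        if xy: "x \<in> rg (\<Union>\<C>)" "y \<in> rg (\<Union>\<C>)" for x y
      proof -
        obtain E1 E2 where E12: "E1 \<in> \<C>" "E2 \<in> \<C>" "x \<in> rg E1" "y \<in> rg E2"
          using xy by (auto simp: U)
        then obtain E where E: "E \<in> \<C>" "E1 \<subseteq> E" "E2 \<subseteq> E" using two by blast
        then have "x \<in> rg E" "y \<in> rg E" using E12 mono by blast+
        moreover have "subring (rg E)" using CA E by (auto simp: \<A>_def)
        ultimately show ?thesis using E(1) unfolding U subring_def by blast
      qed
      moreover have "1 \<in> rg (\<Union>\<C>)" using CA[OF E0] E0 by (auto simp: U \<A>_def subring_def)
      ultimately show ?thesis by (auto simp: subring_def)
    qed
    moreover have "ideal_of (rg (\<Union>\<C>)) (id (\<Union>\<C>))"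
    proof -
      have "x + y \<in> id (\<Union>\<C>)" if xy: "x \<in> id (\<Union>\<C>)" "y \<in> id (\<Union>\<C>)" for x y
      proof -
        obtain E1 E2 where E12: "E1 \<in> \<C>" "E2 \<in> \<C>" "x \<in> id E1" "y \<in> id E2"
          using xy by (auto simp: U)
        then obtain E where E: "E \<in> \<C>" "E1 \<subseteq> E" "E2 \<subseteq> E" using two by blast
        then have "x \<in> id E" "y \<in> id E" using E12 mono by blast+
        moreover have "ideal_of (rg E) (id E)" using CA E by (auto simp: \<A>_def)
        ultimately show ?thesis using E(1) unfolding U ideal_of_def by blast
      qed
      moreover have "x * y \<in> id (\<Union>\<C>)" if xy: "x \<in> rg (\<Union>\<C>)" "y \<in> id (\<Union>\<C>)" for x y
      proof -
        obtain E1 E2 where E12: "E1 \<in> \<C>" "E2 \<in> \<C>" "x \<in> rg E1" "y \<in> id E2"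
          using xy by (auto simp: U)
        then obtain E where E: "E \<in> \<C>" "E1 \<subseteq> E" "E2 \<subseteq> E" using two by blast
        then have "x \<in> rg E" "y \<in> id E" using E12 mono by blast+
        moreover have "ideal_of (rg E) (id E)" using CA E by (auto simp: \<A>_def)
        ultimately show ?thesis using E(1) unfolding U ideal_of_def by blast
      qed
      moreover have "0 \<in> id (\<Union>\<C>)" using CA[OF E0] E0 by (auto simp: U \<A>_def ideal_of_def)
      moreover have "id (\<Union>\<C>) \<subseteq> rg (\<Union>\<C>)"
        unfolding U using CA by (intro UN_mono) (auto simp: \<A>_def ideal_of_def)
      ultimately show ?thesis by (auto simp: ideal_of_def)
    qed
    moreover have "1 \<notin> id (\<Union>\<C>)" using CA by (auto simp: U \<A>_def)
    moreover have "A \<subseteq> rg (\<Union>\<C>)" "I \<subseteq> id (\<Union>\<C>)" using CA[OF E0] E0 by (auto simp: U \<A>_def)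
    ultimately show ?thesis by (simp add: \<A>_def)
  qed
  ultimately obtain M where M: "M \<in> \<A>" and max: "\<And>X. X \<in> \<A> \<Longrightarrow> M \<subseteq> X \<Longrightarrow> X = M"
    using subset_Zorn_nonempty[of \<A>] by metis
  define V J where "V = rg M" and "J = id M"
  have V: "subring V" and J: "ideal_of V J" and J1: "1 \<notin> J" and AV: "A \<subseteq> V" and IJ: "I \<subseteq> J"
    using M by (auto simp: \<A>_def V_def J_def)
  have V0: "0 \<in> V" "1 \<in> V" using V subring_zero by (auto simp: subring_def)
  have J0: "0 \<in> J" using J by (simp add: ideal_of_def)
  \<comment> \<open>If \<open>J\<close> generates a proper ideal of \<open>V[x]\<close>, then
    \<open>V[x]\<close> with this ideal extends the maximal pair, so \<open>x\<close> is already in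
    \<open>V\<close>.\<close>
  have adj: "x \<in> V" if "1 \<notin> adjoin J x" for x
  proof -
    have "A \<subseteq> adjoin V x" "I \<subseteq> adjoin J x" using AV IJ adjoin_base V0 J0 by blast+
    then have "enc (adjoin V x) (adjoin J x) \<in> \<A>"
      using that subring_adjoin[OF V] ideal_of_adjoin[OF V J] by (simp add: \<A>_def enc)
    moreover have "M \<subseteq> enc (adjoin V x) (adjoin J x)"
    proof
      fix e assume e: "e \<in> M"
      obtain y b where yb: "e = (y, b)" by fastforce
      show "e \<in> enc (adjoin V x) (adjoin J x)"
        using e adjoin_base[OF V0(1), of y x] adjoin_base[OF J0, of y x]
        by (cases b) (auto simp: yb enc_def V_def J_def rg_def id_def)
    qed
    ultimately have "adjoin V x = V" using max enc(1) V_def by metis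
    moreover have "x \<in> adjoin V x"
      using V0 by (intro adjoinI[of "[:0, 1:]"]) (auto simp: coeff_pCons split: nat.splits)
    ultimately show ?thesis by simp
  qed
  have nonunit: "J \<subseteq> place_of V"
    using J J1 by (auto simp: place_of_def ring_units_def ideal_of_def) (metis mult.commute)
  \<comment> \<open>A nonzero element of the ideal is a non-unit of \<open>V\<close>; its inverse
    shows that \<open>V\<close> is not the whole field, and \<open>i\<close> itself that
    \<open>V\<close> is more than the constants.\<close>
  obtain i where i: "i \<in> I" "i \<noteq> 0" using I by (auto simp: ideal_of_def)
  have iJ: "i \<in> J" "i \<in> V" using i IJ J by (auto simp: ideal_of_def)
  have inv: "inverse i \<notin> V"
    using iJ i J J1 by (auto simp: ideal_of_def) (metis left_inverse)
  have "range \<iota> \<noteq> V"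
  proof
    assume "range \<iota> = V"
    then obtain c where "i = \<iota> c" using iJ by blast
    moreover have "\<iota> (inverse c) = inverse (\<iota> c)"
      using field_hom.hom_inverse[OF hom] .
    ultimately show False using inv \<open>range \<iota> = V\<close> by (metis rangeI)
  qed
  moreover have "x \<in> V \<or> inverse x \<in> V" if "x \<noteq> 0" for x
    using that adj adjoin_proper_or[OF V J J1] by blast
  ultimately have "valuation_ring \<iota> V"
    unfolding valuation_ring_def using A AV V inv by (auto simp: subring_def)
  then show ?thesis using AV IJ nonunit by blast
qed

section \<open>Additive polynomials in characteristic two\<close>

text \<open>Characteristic two enters as the equation \<open>1 + 1 = 0\<close>, so that the same
  facts serve the constants and the function field.\<close>

lemma power_two_power_add:
  fixes x y :: "'a::field"
  assumes "(1::'a) + 1 = 0"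
  shows "(x + y) ^ 2 ^ i = x ^ 2 ^ i + y ^ 2 ^ i"
proof (induction i)
  case (Suc i)
  have two: "a + a = 0" for a :: 'a using assms by (metis distrib_left mult.right_neutral mult_zero_right)
  have sq: "(a + b) ^ 2 = a ^ 2 + b ^ 2" for a b :: 'a
  proof -
    have "(a + b) ^ 2 = a ^ 2 + b ^ 2 + (a * b + a * b)" by (simp add: power2_eq_square algebra_simps)
    then show ?thesis using two by simp
  qed
  have "(x + y) ^ 2 ^ Suc i = ((x + y) ^ 2 ^ i) ^ 2" by (simp add: mult.commute flip: power_mult)
  also have "\<dots> = x ^ 2 ^ Suc i + y ^ 2 ^ Suc i"
    unfolding Suc sq by (simp add: mult.commute flip: power_mult)
  finally show ?case .
qed simp

lemma additive_power_altdef: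
  assumes "degree f \<le> n"
  shows "additive_power u f = (\<Sum>i\<le>n. of_bool (coeff f i = 1) * u ^ 2 ^ i)"
  unfolding additive_power_def using assms
  by (intro sum.mono_neutral_left) (auto simp: coeff_eq_0)

lemma additive_power_diff_arg:
  fixes u v :: "'a::field"
  assumes "(1::'a) + 1 = 0"
  shows "additive_power (u - v) f = additive_power u f - additive_power v f"
proof -
  have "a + a = 0" for a :: 'a using assms by (metis distrib_left mult.right_neutral mult_zero_right)
  then have m: "a - b = a + b" for a b :: 'a by (simp add: diff_eq_eq add.assoc)
  show ?thesis
    unfolding m additive_power_def power_two_power_add[OF assms]
    by (simp add: sum.distrib distrib_left)
qed

text \<open>The monomial \<open>T^i\<close> becomes \<open>X^(2^i)\<close>. The ordinary polynomial
  is wanted for bounds on numbers of roots and for the equation of the curve.\<close>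

definition additive_poly :: "bit poly \<Rightarrow> 'a::field poly" where
  "additive_poly f = (\<Sum>i\<le>degree f. monom (of_bool (coeff f i = 1)) (2 ^ i))"

lemma poly_additive_poly: "poly (additive_poly f) x = additive_power x f"
  by (simp add: additive_poly_def additive_power_def poly_sum poly_monom)

text \<open>Translation by \<open>1\<close> permutes the field; comparing the sums of all elements
  gives \<open>CARD('k) = 0\<close> in the field.\<close>

lemma char_two_of_card:
  assumes "CARD('k::field) = 2 ^ s"
  shows "(1::'k) + 1 = 0"
proof -
  have "(\<Sum>x\<in>UNIV. x) = (\<Sum>x\<in>UNIV. x + (1::'k))"
    by (rule sum.reindex_bij_witness[of _ "\<lambda>x. x + 1" "\<lambda>x. x - 1"]) auto
  also have "\<dots> = (\<Sum>x\<in>UNIV. x) + of_nat CARD('k)" by (simp add: sum.distrib)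
  finally have "of_nat (2 ^ s) = (0::'k)" using assms by simp
  then have "(2::'k) = 0" by simp
  then show ?thesis by simp
qed

text \<open>Multiplication by a nonzero \<open>x\<close> permutes the nonzero elements; comparing
  their products gives \<open>x ^ (CARD('k) - 1) = 1\<close>.\<close>

lemma power_card_field:
  fixes x :: "'k::field"
  assumes "finite (UNIV :: 'k set)"
  shows "x ^ CARD('k) = x"
proof (cases "x = 0")
  case False
  let ?U = "UNIV - {0 :: 'k}"
  have fin: "finite ?U" using assms by simp
  have "(\<Prod>y\<in>?U. y) = (\<Prod>y\<in>?U. x * y)"
    using False by (intro prod.reindex_bij_witness[of _ "\<lambda>y. x * y" "\<lambda>y. y / x"]) auto
  also have "\<dots> = x ^ card ?U * (\<Prod>y\<in>?U. y)" by (simp add: prod.distrib)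
  finally have "x ^ card ?U = 1" using fin by simp
  moreover have "CARD('k) = Suc (card ?U)" using assms by (simp add: card_Diff_singleton card_gt_0_iff)
  ultimately show ?thesis by (metis power_Suc mult.right_neutral)
qed (use assms in \<open>simp add: card_gt_0_iff\<close>)

section \<open>The curve\<close>

text \<open>Odd \<open>N\<close> makes \<open>N\<close> coprime to the power of two
  \<open>D\<close>, and \<open>coeff_h_0\<close> says that the additive polynomial has derivative
  \<open>1\<close>. Irreducibility of the equation is a consequence, obtained in
  \<open>ev_nonzero\<close> from pole orders.\<close>

locale additive_kummer = field_hom \<iota> for \<iota> :: "'k::field \<Rightarrow> 'a::field" +
  fixes w z :: 'a and N s :: nat and h :: "bit poly"
  assumes card_const: "CARD('k) = 2 ^ s"
    and odd_N: "odd N"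
    and coeff_h_0: "coeff h 0 = 1"
    and generated: "generated_subfield (range \<iota> \<union> {w, z}) = UNIV"
    and z_transcendental: "\<not> algebraic_over \<iota> z"
    and equation: "w ^ N = additive_power z h"
begin

lemma finite_const: "finite (UNIV :: 'k set)"
  using card_const by (metis card_ge_0_finite zero_less_numeral zero_less_power)

lemma char_two_const: "(1::'k) + 1 = 0"
  using char_two_of_card card_const .

lemma char_two: "(1::'a) + 1 = 0"
proof -
  have "\<iota> (1 + 1) = 0" using char_two_const by simp
  then show ?thesis by (simp add: hom_distribs)
qed

lemma N_pos: "0 < N"
  using odd_N by (simp add: odd_pos)

lemma h_nonzero: "h \<noteq> 0"
  using coeff_h_0 by auto

lemma monic_h: "lead_coeff h = 1"
  using h_nonzero leading_coeff_0_iff[of h] by (cases "lead_coeff h") simp_all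

definition D :: nat where "D = 2 ^ degree h"

lemma D_pos: "0 < D"
  by (simp add: D_def)

lemma coprime_ND: "coprime N D"
  using odd_N by (simp add: D_def)

definition evz :: "'k poly \<Rightarrow> 'a" where "evz c = poly (map_poly \<iota> c) z"

lemma evz_hom: "comm_ring_hom evz"
proof -
  interpret m: map_poly_comm_ring_hom \<iota> ..
  show ?thesis by unfold_locales (simp_all add: evz_def hom_distribs)
qed

sublocale evz: comm_ring_hom evz by (rule evz_hom)

sublocale evz_poly: map_poly_comm_ring_hom evz ..

lemma evz_eq_0_iff: "evz c = 0 \<longleftrightarrow> c = 0"
  using z_transcendental by (auto simp: evz_def algebraic_over_def)

definition ev :: "'k poly poly \<Rightarrow> 'a" where "ev f = poly (map_poly evz f) w"

lemma ev_add: "ev (f + g) = ev f + ev g"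
  and ev_diff: "ev (f - g) = ev f - ev g"
  and ev_mult: "ev (f * g) = ev f * ev g"
  and ev_0: "ev 0 = 0" and ev_1: "ev 1 = 1"
  and ev_const: "ev [:[:c:]:] = \<iota> c"
  and ev_z: "ev [:[:0, 1:]:] = z"
  and ev_w: "ev [:0, 1:] = w"
  by (simp_all add: ev_def hom_distribs evz_def)

definition R :: "'a set" where "R = range ev"

lemma R_const: "\<iota> c \<in> R" and R_z: "z \<in> R" and R_w: "w \<in> R" and R_0: "0 \<in> R" and R_1: "1 \<in> R"
  unfolding R_def by (metis rangeI ev_const ev_z ev_w ev_0 ev_1)+

lemma R_add: "x \<in> R \<Longrightarrow> y \<in> R \<Longrightarrow> x + y \<in> R"
  and R_diff: "x \<in> R \<Longrightarrow> y \<in> R \<Longrightarrow> x - y \<in> R"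
  and R_mult: "x \<in> R \<Longrightarrow> y \<in> R \<Longrightarrow> x * y \<in> R"
  unfolding R_def by (auto simp flip: ev_add ev_diff ev_mult)

lemma subring_R: "subring R"
  by (auto simp: subring_def R_add R_diff R_mult R_1)

lemma R_minus: "x \<in> R \<Longrightarrow> - x \<in> R"
  using R_diff[of 0 x] R_0 by simp

lemma R_power: "x \<in> R \<Longrightarrow> x ^ n \<in> R"
  by (induction n) (auto simp: R_1 R_mult)

lemma R_sum: "(\<And>i. i \<in> I \<Longrightarrow> f i \<in> R) \<Longrightarrow> sum f I \<in> R"
  using subring_sum[OF subring_R] .

text \<open>The quotients of elements of \<open>R\<close> form a subfield that contains the
  generators.\<close>

lemma fraction: "\<exists>f\<in>R. \<exists>g\<in>R. g \<noteq> 0 \<and> x = f / g"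
proof -
  let ?S = "{f / g | f g. f \<in> R \<and> g \<in> R \<and> g \<noteq> 0}"
  have I: "f / g \<in> ?S" if "f \<in> R" "g \<in> R" "g \<noteq> 0" for f g using that by blast
  have "is_subfield ?S"
    unfolding is_subfield_def
  proof (intro conjI ballI)
    show "0 \<in> ?S" "1 \<in> ?S" using I[of 0 1] I[of 1 1] R_0 R_1 by auto
    fix x y assume "x \<in> ?S" "y \<in> ?S"
    then obtain f g f' g' where x: "x = f / g" "f \<in> R" "g \<in> R" "g \<noteq> 0"
      and y: "y = f' / g'" "f' \<in> R" "g' \<in> R" "g' \<noteq> 0" by blast
    have "x + y = (f * g' + f' * g) / (g * g')" using x y by (simp add: field_simps)
    moreover have "x * y = (f * f') / (g * g')" using x y by simp
    ultimately show "x + y \<in> ?S" "x * y \<in> ?S"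
      using I[of "f * g' + f' * g" "g * g'"] I[of "f * f'" "g * g'"] x y by (simp_all add: R_add R_mult)
  next
    fix x assume "x \<in> ?S"
    then obtain f g where x: "x = f / g" "f \<in> R" "g \<in> R" "g \<noteq> 0" by blast
    show "- x \<in> ?S" using I[of "- f" g] x by (simp add: R_minus)
    show "inverse x \<in> ?S"
      using I[of g f] I[of 0 1] x R_0 R_1 by (cases "f = 0") simp_all
  qed
  moreover have "range \<iota> \<union> {w, z} \<subseteq> ?S"
    using I[of _ 1] R_const R_w R_z R_1 by auto
  ultimately have "generated_subfield (range \<iota> \<union> {w, z}) \<subseteq> ?S"
    unfolding generated_subfield_def by blast
  then show ?thesis using generated by blast
qed

section \<open>Reduction modulo the equation of the curve\<close>

definition curve_poly :: "'k poly poly" where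
  "curve_poly = monom 1 N - [:additive_poly h:]"

lemma degree_curve_poly: "degree curve_poly = N" and lead_coeff_curve_poly: "coeff curve_poly N = 1"
proof -
  have "degree [:additive_poly h :: 'k poly:] < degree (monom (1::'k poly) N)"
    using N_pos by (simp add: degree_monom_eq)
  then show "degree curve_poly = N"
    unfolding curve_poly_def diff_conv_add_uminus using degree_add_eq_left[of "- [:additive_poly h:]" "monom (1::'k poly) N"]
    by (simp add: degree_monom_eq)
  show "coeff curve_poly N = 1"
    using N_pos by (simp add: curve_poly_def coeff_eq_0)
qed

lemma evz_additive_poly: "evz (additive_poly h) = additive_power z h"
proof -
  have "evz (monom (of_bool b) k) = of_bool b * z ^ k" for b k
    by (cases b) (simp_all add: evz_def poly_monom)
  then show ?thesis
    by (simp add: additive_poly_def additive_power_def evz.hom_sum)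
qed

lemma ev_curve_poly: "ev curve_poly = 0"
  by (simp add: ev_def curve_poly_def hom_distribs evz_additive_poly equation poly_monom)

text \<open>The coefficients are polynomials in \<open>z\<close>, so this is pseudo-division; it
  needs no scaling of \<open>f\<close> because \<open>curve_poly\<close> is monic in
  \<open>w\<close>.\<close>

lemma division: "\<exists>g r. f = curve_poly * g + r \<and> degree r < N"
proof -
  obtain g r where gr: "pseudo_divmod f curve_poly = (g, r)" by fastforce
  have "curve_poly \<noteq> 0" using lead_coeff_curve_poly by auto
  from pseudo_divmod[OF this gr] have "f = curve_poly * g + r" "r = 0 \<or> degree r < N"
    by (simp_all add: degree_curve_poly lead_coeff_curve_poly)
  moreover from this(2) have "degree r < N" using N_pos by auto
  ultimately show ?thesis by blast
qed

lemma R_reduced: "x \<in> R \<Longrightarrow> \<exists>r. degree r < N \<and> x = ev r"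
proof -
  assume "x \<in> R"
  then obtain f where f: "x = ev f" by (auto simp: R_def)
  obtain g r where "f = curve_poly * g + r" "degree r < N" using division by blast
  then show ?thesis using f by (auto simp: ev_add ev_mult ev_curve_poly)
qed

section \<open>The place at infinity\<close>

text \<open>One local parameter for all poles of \<open>z\<close>, with respect to which
  \<open>z\<close> and \<open>w\<close> have leading coefficient \<open>1\<close>. The quantifier
  over \<open>V\<close> stands inside because a common parameter is what later forces these places
  to coincide.\<close>

definition tau_spec :: "'a \<Rightarrow> bool" where
  "tau_spec \<tau> \<longleftrightarrow> \<tau> \<noteq> 0 \<and> (\<forall>V. valuation_ring \<iota> V \<longrightarrow> z \<notin> V \<longrightarrow>
     \<tau> \<in> place_of V \<and> z * \<tau> ^ N - 1 \<in> place_of V \<and> w * \<tau> ^ D - 1 \<in> place_of V)"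

lemma z_nonzero: "z \<noteq> 0"
  using evz_eq_0_iff[of "[:0, 1:]"] by (simp add: evz_def)

lemma w_nonzero: "w \<noteq> 0"
proof
  assume "w = 0"
  then have "evz (additive_poly h) = 0"
    using equation N_pos evz_additive_poly by (metis zero_power)
  then have "(additive_poly h :: 'k poly) = 0" by (simp add: evz_eq_0_iff)
  moreover have "coeff (additive_poly h :: 'k poly) 1 = (\<Sum>i\<le>degree h. of_bool (i = 0))"
    unfolding additive_poly_def coeff_sum coeff_monom using coeff_h_0 by (intro sum.cong) auto
  ultimately show False by simp
qed

lemma tau_exists: "\<exists>\<tau>. tau_spec \<tau>"
proof -
  obtain u v where "u * int N + v * int D = gcd (int N) (int D)" using bezout_int by blast
  then have "u * int N + v * int D = 1" using coprime_ND by simp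
  \<comment> \<open>As \<open>z\<close> is to have pole order \<open>N\<close> and \<open>w\<close>
    pole order \<open>D\<close>, exponents with this property give a product with a simple
    zero.\<close>
  then obtain \<alpha> \<beta> where ab: "\<alpha> * int N + \<beta> * int D = - 1"
    by (metis add.inverse_inverse add_uminus_conv_diff minus_add_distrib mult_minus_left)
  define \<tau> where "\<tau> = z powi \<alpha> * w powi \<beta>"
  have \<tau>0: "\<tau> \<noteq> 0" using z_nonzero w_nonzero by (simp add: \<tau>_def)
  \<comment> \<open>This is the additive polynomial in \<open>z\<close> divided by its leading term,
    hence congruent to \<open>1\<close> at a pole of \<open>z\<close>. Both
    \<open>z * \<tau> ^ N\<close> and \<open>w * \<tau> ^ D\<close> are integer powers of
    it.\<close>
  define \<eta> where "\<eta> = w ^ N * inverse z ^ D"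
  have zN: "z * \<tau> ^ N = \<eta> powi \<beta>"
  proof -
    have "z * \<tau> ^ N = z powi (1 + \<alpha> * int N) * w powi (\<beta> * int N)"
      unfolding \<tau>_def power_mult_distrib using z_nonzero
      by (simp add: power_int_add power_int_mult)
    also have "1 + \<alpha> * int N = - (int D * \<beta>)" using ab by (simp add: algebra_simps)
    also have "z powi (- (int D * \<beta>)) * w powi (\<beta> * int N) = \<eta> powi \<beta>"
      unfolding \<eta>_def power_int_mult_distrib
      by (simp add: power_int_minus power_int_mult power_int_inverse power_inverse mult.commute[of \<beta>])
    finally show ?thesis .
  qed
  have wD: "w * \<tau> ^ D = \<eta> powi (- \<alpha>)"
  proof -
    have "w * \<tau> ^ D = z powi (\<alpha> * int D) * w powi (1 + \<beta> * int D)"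
      unfolding \<tau>_def power_mult_distrib using w_nonzero
      by (simp add: power_int_add power_int_mult)
    also have "1 + \<beta> * int D = int N * (- \<alpha>)" using ab by (simp add: algebra_simps)
    also have "z powi (\<alpha> * int D) = (inverse z) powi (int D * (- \<alpha>))"
      by (simp add: power_int_minus power_int_inverse mult.commute)
    also have "inverse z powi (int D * (- \<alpha>)) * w powi (int N * (- \<alpha>)) = \<eta> powi (- \<alpha>)"
      unfolding \<eta>_def power_int_mult_distrib power_int_mult by (simp add: mult.commute)
    finally show ?thesis .
  qed
  have "\<tau> \<in> place_of V \<and> z * \<tau> ^ N - 1 \<in> place_of V \<and> w * \<tau> ^ D - 1 \<in> place_of V"
    if "valuation_ring \<iota> V" "z \<notin> V" for V
  proof -
    interpret V: valued_extension \<iota> V by unfold_locales (use that in auto)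
    have iz: "inverse z \<in> place_of V" using that V.inverse_place by blast
    have "\<eta> - 1 \<in> place_of V"
    proof -
      have "\<eta> = (\<Sum>i\<le>degree h. of_bool (coeff h i = 1) * (z ^ 2 ^ i * inverse z ^ D))"
        unfolding \<eta>_def equation additive_power_def sum_distrib_right by (simp only: mult.assoc)
      also have "\<dots> = (\<Sum>i\<le>degree h. of_bool (coeff h i = 1) * inverse z ^ (D - 2 ^ i))"
      proof (rule sum.cong)
        fix i assume i: "i \<in> {..degree h}"
        then have "(2::nat) ^ i \<le> D" by (simp add: D_def)
        then have "inverse z ^ D = inverse z ^ (D - 2 ^ i) * inverse z ^ 2 ^ i"
          by (simp flip: power_add)
        then show "of_bool (coeff h i = 1) * (z ^ 2 ^ i * inverse z ^ D) =
            of_bool (coeff h i = 1) * inverse z ^ (D - 2 ^ i)"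
          using z_nonzero by (simp add: field_simps)
      qed simp
      also have "\<dots> = 1 + (\<Sum>i<degree h. of_bool (coeff h i = 1) * inverse z ^ (D - 2 ^ i))"
        using monic_h by (simp add: D_def flip: lessThan_Suc_atMost)
      finally have "\<eta> - 1 = (\<Sum>i<degree h. of_bool (coeff h i = 1) * inverse z ^ (D - 2 ^ i))"
        by simp
      also have "\<dots> \<in> place_of V"
        using iz V.zero_place by (intro V.place_sum) (auto intro!: V.place_power simp: D_def)
      finally show ?thesis .
    qed
    then have 1: "z * \<tau> ^ N - 1 \<in> place_of V" "w * \<tau> ^ D - 1 \<in> place_of V"
      unfolding zN wD by (auto intro: V.one_unit_powi)
    have "\<tau> ^ N = inverse z * (z * \<tau> ^ N)" using z_nonzero by simp
    moreover have "z * \<tau> ^ N \<in> V" using 1(1) V.one_unit_unit V.unit_mem by blast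
    ultimately have "\<tau> ^ N \<in> place_of V" using V.place_mult[OF iz] by metis
    then show ?thesis using 1 V.place_powerD N_pos by blast
  qed
  then show ?thesis using \<tau>0 unfolding tau_spec_def by blast
qed

definition \<tau> :: 'a where "\<tau> = (SOME \<tau>. tau_spec \<tau>)"

lemma tau_nonzero: "\<tau> \<noteq> 0"
  and tau: "valuation_ring \<iota> V \<Longrightarrow> z \<notin> V \<Longrightarrow>
     \<tau> \<in> place_of V \<and> z * \<tau> ^ N - 1 \<in> place_of V \<and> w * \<tau> ^ D - 1 \<in> place_of V"
  using someI_ex[OF tau_exists, folded \<tau>_def] unfolding tau_spec_def by blast+

text \<open>The pole order at infinity of \<open>z ^ i * w ^ j\<close> for
  \<open>e = (i, j)\<close>.\<close>

definition weight :: "nat \<times> nat \<Rightarrow> nat" where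
  "weight e = N * fst e + D * snd e"

text \<open>If two weights agree, \<open>N\<close> divides \<open>D * (j' - j)\<close> and, by
  coprimality, \<open>j' - j\<close>, which is smaller than \<open>N\<close>.\<close>

lemma weight_inj: "inj_on weight (UNIV \<times> {..<N})"
proof -
  have *: "j = j'" if "N * i + D * j = N * i' + D * j'" "j < N" "j' < N" "j \<le> j'" for i j i' j'
  proof -
    have "D * (j' - j) = N * i - N * i'" using that by (simp add: diff_mult_distrib2)
    then have "N dvd D * (j' - j)" by simp
    then have "N dvd j' - j" using coprime_ND coprime_dvd_mult_right_iff by blast
    then show ?thesis using that by (auto dest: dvd_imp_le)
  qed
  show ?thesis
  proof (rule inj_onI, clarsimp simp: weight_def)
    fix i j i' j' assume "N * i + D * j = N * i' + D * j'" "j < N" "j' < N"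
    moreover from this have "j = j'" using *[of i j i' j'] *[of i' j' i j] by (metis nle_le)
    ultimately show "i = i' \<and> j = j'" using N_pos by simp
  qed
qed

lemma monomial_congruent:
  assumes "valuation_ring \<iota> V" "z \<notin> V"
  shows "z ^ i * w ^ j * \<tau> ^ weight (i, j) - 1 \<in> place_of V"
proof -
  interpret V: valued_extension \<iota> V by unfold_locales (use assms in auto)
  have "\<tau> ^ weight (i, j) = (\<tau> ^ N) ^ i * (\<tau> ^ D) ^ j"
    by (simp add: weight_def power_add power_mult)
  then have "z ^ i * w ^ j * \<tau> ^ weight (i, j) = (z * \<tau> ^ N) ^ i * (w * \<tau> ^ D) ^ j"
    unfolding power_mult_distrib by (simp add: mult_ac)
  then show ?thesis using tau[OF assms] by (simp add: V.one_unit_mult V.one_unit_power)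
qed

text \<open>Exactly one monomial of a reduced \<open>r\<close> has maximal weight; after scaling by
  the matching power of \<open>\<tau>\<close> all others fall into the place. The exponents and the
  coefficient are chosen before \<open>V\<close>.\<close>

lemma leading_term:
  assumes r: "r \<noteq> 0" "degree r < N"
  shows "\<exists>i j c. j < N \<and> c \<noteq> 0 \<and>
    (\<forall>V. valuation_ring \<iota> V \<longrightarrow> z \<notin> V \<longrightarrow> ev r * \<tau> ^ weight (i, j) - \<iota> c \<in> place_of V)"
proof -
  define cf where "cf e = coeff (coeff r (snd e)) (fst e)" for e
  define M where "M = Max ((\<lambda>j. degree (coeff r j)) ` {..degree r})"
  define T where "T = {e. cf e \<noteq> 0}"
  have M: "degree (coeff r j) \<le> M" for j
    by (cases "j \<le> degree r") (auto simp: M_def coeff_eq_0)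
  have sub: "T \<subseteq> {..M} \<times> {..degree r}"
  proof
    fix e assume e: "e \<in> T"
    then have "coeff r (snd e) \<noteq> 0" by (auto simp: T_def cf_def)
    then have "snd e \<le> degree r" by (rule le_degree)
    moreover have "fst e \<le> M" using e M[of "snd e"] le_degree order_trans by (fastforce simp: T_def cf_def)
    ultimately show "e \<in> {..M} \<times> {..degree r}" by (auto simp: mem_Times_iff)
  qed
  then have finT: "finite T" by (rule finite_subset) auto
  have T_ne: "T \<noteq> {}"
  proof -
    have "(degree (lead_coeff r), degree r) \<in> T" using r(1) by (simp add: T_def cf_def)
    then show ?thesis by blast
  qed
  have evr: "ev r = (\<Sum>e\<in>T. \<iota> (cf e) * (z ^ fst e * w ^ snd e))"
  proof -
    have pz: "evz c = (\<Sum>i\<le>M. \<iota> (coeff c i) * z ^ i)" if "degree c \<le> M" for c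
      unfolding evz_def poly_altdef using that
      by (intro sum.mono_neutral_cong_left) (auto simp: coeff_eq_0)
    have "ev r = (\<Sum>j\<le>degree r. evz (coeff r j) * w ^ j)"
      unfolding ev_def poly_altdef using degree_map_poly_le[of evz r]
      by (intro sum.mono_neutral_cong_left) (auto intro: coeff_eq_0 simp flip: evz.coeff_map_poly_hom)
    also have "\<dots> = (\<Sum>j\<le>degree r. \<Sum>i\<le>M. \<iota> (cf (i, j)) * (z ^ i * w ^ j))"
      by (simp add: pz M sum_distrib_right cf_def mult.assoc)
    also have "\<dots> = (\<Sum>e\<in>{..M} \<times> {..degree r}. \<iota> (cf e) * (z ^ fst e * w ^ snd e))"
      by (subst sum.swap) (simp add: sum.cartesian_product split_def)
    also have "\<dots> = (\<Sum>e\<in>T. \<iota> (cf e) * (z ^ fst e * w ^ snd e))"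
      using sub by (intro sum.mono_neutral_right) (auto simp: T_def)
    finally show ?thesis .
  qed
  define k where "k = Max (weight ` T)"
  have "k \<in> weight ` T" unfolding k_def using finT T_ne by (intro Max_in) auto
  then obtain e0 where e0: "e0 \<in> T" "weight e0 = k" by (metis imageE)
  have lt: "weight e < k" if "e \<in> T" "e \<noteq> e0" for e
  proof -
    have "e \<in> UNIV \<times> {..<N}" "e0 \<in> UNIV \<times> {..<N}" using that e0 sub r(2) by auto
    then have "weight e \<noteq> weight e0" using that(2) weight_inj by (meson inj_onD)
    moreover have "weight e \<le> k" using finT that by (simp add: k_def)
    ultimately show ?thesis using e0 by simp
  qed
  have "ev r * \<tau> ^ k - \<iota> (cf e0) \<in> place_of V" if V: "valuation_ring \<iota> V" "z \<notin> V" for V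
  proof -
    interpret V: valued_extension \<iota> V by unfold_locales (use V in auto)
    have mono: "z ^ fst e * w ^ snd e * \<tau> ^ weight e - 1 \<in> place_of V" for e
      using monomial_congruent[OF V, of "fst e" "snd e"] by simp
    have eq: "ev r * \<tau> ^ k - \<iota> (cf e0) =
      \<iota> (cf e0) * (z ^ fst e0 * w ^ snd e0 * \<tau> ^ weight e0 - 1) +
      (\<Sum>e\<in>T - {e0}. \<iota> (cf e) * (z ^ fst e * w ^ snd e) * \<tau> ^ k)"
      unfolding evr using finT e0
      by (simp add: sum.remove[OF finT e0(1)] algebra_simps sum_distrib_left)
    have terms: "\<iota> (cf e) * (z ^ fst e * w ^ snd e) * \<tau> ^ k \<in> place_of V" if "e \<in> T - {e0}" for e
    proof -
      have "\<tau> ^ k = \<tau> ^ weight e * \<tau> ^ (k - weight e)" using lt[of e] that by (simp flip: power_add)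
      then have "\<iota> (cf e) * (z ^ fst e * w ^ snd e) * \<tau> ^ k =
          \<iota> (cf e) * (z ^ fst e * w ^ snd e * \<tau> ^ weight e) * \<tau> ^ (k - weight e)" by (simp add: mult_ac)
      moreover have "\<tau> ^ (k - weight e) \<in> place_of V"
        using tau[OF V] lt[of e] that by (intro V.place_power) auto
      moreover have "z ^ fst e * w ^ snd e * \<tau> ^ weight e \<in> V"
        using mono V.one_unit_unit V.unit_mem by blast
      ultimately show ?thesis by (metis V.place_mult' V.mult_mem V.const_mem)
    qed
    show ?thesis
      unfolding eq by (rule V.place_add[OF V.place_mult'[OF V.const_mem mono] V.place_sum[OF terms]])
  qed
  moreover have "snd e0 < N" using e0 sub r(2) by auto
  ultimately show ?thesis
    using e0 by (intro exI[of _ "fst e0"] exI[of _ "snd e0"] exI[of _ "cf e0"]) (auto simp: T_def)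
qed

text \<open>The extension theorem is applied to \<open>K[1/z]\<close> and its ideal generated by
  \<open>1/z\<close>; a place that contains \<open>1/z\<close> is a pole of
  \<open>z\<close>.\<close>

lemma infinite_place_exists: "\<exists>V. valuation_ring \<iota> V \<and> z \<notin> V"
proof -
  define y where "y = inverse z"
  define A where "A = {poly (map_poly \<iota> f) y | f. True}"
  define I where "I = {poly (map_poly \<iota> f) y | f. coeff f 0 = 0}"
  interpret m: map_poly_comm_ring_hom \<iota> ..
  have y0: "y \<noteq> 0" using z_nonzero by (simp add: y_def)
  \<comment> \<open>Reversing the coefficients turns an algebraic relation for \<open>1/z\<close>
    into one for \<open>z\<close>.\<close>
  have y_trans: "f = 0" if "poly (map_poly \<iota> f) y = 0" for f
  proof (rule ccontr)
    assume "f \<noteq> 0"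
    have "poly (reflect_poly (map_poly \<iota> f)) z = 0"
      using that z_nonzero unfolding y_def by (simp add: poly_reflect_poly_nz)
    moreover have "reflect_poly (map_poly \<iota> f) = map_poly \<iota> (reflect_poly f)"
      by (intro poly_eqI) (simp add: coeff_reflect_poly)
    ultimately show False
      using z_transcendental \<open>f \<noteq> 0\<close> unfolding algebraic_over_def by (metis reflect_poly_eq_0_iff)
  qed
  have A: "subring A"
  proof -
    have "1 \<in> A" unfolding A_def by (auto intro!: exI[of _ 1])
    moreover have "u + v \<in> A \<and> u - v \<in> A \<and> u * v \<in> A" if "u \<in> A" "v \<in> A" for u v
      using that unfolding A_def by (auto simp flip: poly_add poly_diff poly_mult m.hom_add m.hom_minus m.hom_mult)
    ultimately show ?thesis by (auto simp: subring_def)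
  qed
  have "range \<iota> \<subseteq> A"
  proof
    fix x assume "x \<in> range \<iota>"
    then obtain c where "x = \<iota> c" by blast
    then have "x = poly (map_poly \<iota> [:c:]) y" by (simp add: hom_distribs)
    then show "x \<in> A" unfolding A_def by blast
  qed
  moreover have "ideal_of A I"
  proof -
    have "0 \<in> I" unfolding I_def by (auto intro!: exI[of _ 0])
    moreover have "u + v \<in> I" if uv: "u \<in> I" "v \<in> I" for u v
    proof -
      obtain f g where "u = poly (map_poly \<iota> f) y" "v = poly (map_poly \<iota> g) y" "coeff f 0 = 0" "coeff g 0 = 0"
        using uv unfolding I_def by blast
      then have "u + v = poly (map_poly \<iota> (f + g)) y \<and> coeff (f + g) 0 = 0" by (simp add: hom_distribs)
      then show ?thesis unfolding I_def by blast
    qed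
    moreover have "u * v \<in> I" if uv: "u \<in> A" "v \<in> I" for u v
    proof -
      obtain f g where "u = poly (map_poly \<iota> f) y" "v = poly (map_poly \<iota> g) y" "coeff g 0 = 0"
        using uv unfolding I_def A_def by blast
      then have "u * v = poly (map_poly \<iota> (f * g)) y \<and> coeff (f * g) 0 = 0"
        by (simp add: hom_distribs coeff_mult_0)
      then show ?thesis unfolding I_def by blast
    qed
    ultimately show ?thesis unfolding ideal_of_def by (auto simp: A_def I_def)
  qed
  moreover have "1 \<notin> I"
  proof
    assume "1 \<in> I"
    then obtain f where f: "poly (map_poly \<iota> f) y = 1" "coeff f 0 = 0" unfolding I_def by auto
    then have "poly (map_poly \<iota> (f - 1)) y = 0" by (simp add: hom_distribs)
    then have "f - 1 = 0" by (rule y_trans)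
    then show False using f(2) by simp
  qed
  moreover have y: "y \<in> I"
    unfolding I_def by (auto intro!: exI[of _ "[:0, 1:]"] simp: hom_distribs)
  ultimately obtain V where V: "valuation_ring \<iota> V" "A \<subseteq> V" "I \<subseteq> place_of V"
    using valuation_ring_exists[OF field_hom_axioms A] y0 by blast
  interpret V: valued_extension \<iota> V by unfold_locales (use V in auto)
  have "z \<notin> V" using y V y0 V.place_iff[of y] by (auto simp: y_def)
  then show ?thesis using V by blast
qed

text \<open>At a pole of \<open>z\<close> the element has a nonzero leading coefficient. Hence
  \<open>1, w, ..., w^(N-1)\<close> are independent over \<open>K[z]\<close>, that is, the defining
  equation is irreducible.\<close>

lemma ev_nonzero:
  assumes "r \<noteq> 0" "degree r < N"
  shows "ev r \<noteq> 0"
proof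
  assume 0: "ev r = 0"
  obtain V where V: "valuation_ring \<iota> V" "z \<notin> V" using infinite_place_exists by blast
  interpret V: valued_extension \<iota> V by unfold_locales (use V in auto)
  obtain i j c where "c \<noteq> 0" "ev r * \<tau> ^ weight (i, j) - \<iota> c \<in> place_of V"
    using leading_term[OF assms] V by blast
  then show False using 0 V.place_minus V.const_place_iff by fastforce
qed

lemma ev_eq_0_iff: "ev f = 0 \<longleftrightarrow> curve_poly dvd f"
proof
  assume 0: "ev f = 0"
  obtain g r where gr: "f = curve_poly * g + r" "degree r < N" using division by blast
  then have "ev r = 0" using 0 by (simp add: ev_add ev_mult ev_curve_poly)
  then have "r = 0" using gr(2) ev_nonzero by blast
  then show "curve_poly dvd f" using gr(1) by simp
qed (auto simp: ev_mult ev_curve_poly)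

text \<open>The numerical semigroup generated by \<open>N\<close> and \<open>D\<close>: a multiple
  of \<open>N\<close> in the second exponent can be moved to the first, so restricting it to values
  below \<open>N\<close> loses nothing and makes representations unique.\<close>

definition poles :: "nat set" where
  "poles = weight ` (UNIV \<times> {..<N})"

lemma R_leading_term:
  assumes "x \<in> R" "x \<noteq> 0"
  shows "\<exists>k\<in>poles. \<exists>c. c \<noteq> 0 \<and>
    (\<forall>V. valuation_ring \<iota> V \<longrightarrow> z \<notin> V \<longrightarrow> x * \<tau> ^ k - \<iota> c \<in> place_of V)"
proof -
  obtain r where r: "degree r < N" "x = ev r" using R_reduced assms by blast
  then have "r \<noteq> 0" using assms ev_0 by auto
  with leading_term[OF this r(1)] show ?thesis unfolding r(2) poles_def by blast
qed

text \<open>A general element is a quotient of elements of \<open>R\<close>, and leading terms can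
  be divided. Here \<open>k\<close> is the pole order and may be negative.\<close>

lemma leading_coefficient:
  assumes "x \<noteq> 0"
  shows "\<exists>k c. c \<noteq> 0 \<and>
    (\<forall>V. valuation_ring \<iota> V \<longrightarrow> z \<notin> V \<longrightarrow> x * \<tau> powi k - \<iota> c \<in> place_of V)"
proof -
  obtain f g where fg: "f \<in> R" "g \<in> R" "g \<noteq> 0" "x = f / g" using fraction by blast
  obtain k c where k: "c \<noteq> 0"
    "\<And>V. valuation_ring \<iota> V \<Longrightarrow> z \<notin> V \<Longrightarrow> f * \<tau> ^ k - \<iota> c \<in> place_of V"
    using R_leading_term[of f] fg assms by auto
  obtain l d where l: "d \<noteq> 0"
    "\<And>V. valuation_ring \<iota> V \<Longrightarrow> z \<notin> V \<Longrightarrow> g * \<tau> ^ l - \<iota> d \<in> place_of V"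
    using R_leading_term[of g] fg by auto
  have "x * \<tau> powi (int k - int l) - \<iota> (c / d) \<in> place_of V" if V: "valuation_ring \<iota> V" "z \<notin> V" for V
  proof -
    interpret V: valued_extension \<iota> V by unfold_locales (use V in auto)
    have "x * \<tau> powi (int k - int l) = f * \<tau> ^ k * inverse (g * \<tau> ^ l)"
      using fg tau_nonzero by (simp add: power_int_diff field_simps)
    moreover have "\<iota> (c / d) = \<iota> c * inverse (\<iota> d)" by (simp add: hom_distribs divide_inverse)
    moreover have "inverse (g * \<tau> ^ l) - inverse (\<iota> d) \<in> place_of V"
      using l V V.congruent_inverse V.const_unit by blast
    moreover have "inverse (g * \<tau> ^ l) \<in> V"
      using l V V.unit_of_congruent V.const_unit V.unit_iff by blast
    ultimately show ?thesis using V.place_diff_mult k V V.const_mem by metis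
  qed
  then show ?thesis using k(1) l(1) by (intro exI[of _ "int k - int l"] exI[of _ "c / d"]) auto
qed

lemma mem_infinite_iff:
  assumes V: "valuation_ring \<iota> V" "z \<notin> V" and k: "x * \<tau> powi k - \<iota> c \<in> place_of V" "c \<noteq> 0"
  shows "x \<in> V \<longleftrightarrow> k \<le> 0"
proof -
  interpret V: valued_extension \<iota> V by unfold_locales (use V in auto)
  have u: "x * \<tau> powi k \<in> ring_units V" using k V.unit_of_congruent V.const_unit by blast
  have \<tau>: "\<tau> \<in> place_of V" using tau V by blast
  show ?thesis
  proof
    assume x: "x \<in> V"
    show "k \<le> 0"
    proof (rule ccontr)
      assume "\<not> k \<le> 0"
      then have "\<tau> powi k \<in> place_of V" using V.place_power[OF \<tau>, of "nat k"] by (simp add: power_int_def)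
      then show False using x u V.place_mult' V.unit_not_place by blast
    qed
  next
    assume "k \<le> 0"
    then have "\<tau> powi (- k) \<in> V" using V.power_mem[OF V.place_mem[OF \<tau>], of "nat (- k)"] by (simp add: power_int_def)
    moreover have "x = x * \<tau> powi k * \<tau> powi (- k)" using tau_nonzero by (simp add: power_int_minus)
    ultimately show "x \<in> V" using V.mult_mem V.unit_mem u by metis
  qed
qed

text \<open>Membership in such a ring depends only on the sign of the exponent in
  \<open>leading_coefficient\<close>, which is the same for all of them.\<close>

lemma infinite_place_unique:
  assumes "valuation_ring \<iota> V" "z \<notin> V" "valuation_ring \<iota> V'" "z \<notin> V'"
  shows "V = V'"
proof -
  interpret V: valued_extension \<iota> V by unfold_locales (use assms in auto)
  interpret V': valued_extension \<iota> V' by unfold_locales (use assms in auto)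
  have "x \<in> V \<longleftrightarrow> x \<in> V'" for x
  proof (cases "x = 0")
    case False
    then show ?thesis using leading_coefficient[OF False] mem_infinite_iff assms by metis
  qed (simp add: V.zero_mem V'.zero_mem)
  then show ?thesis by blast
qed

definition Vinf :: "'a set" where
  "Vinf = (THE V. valuation_ring \<iota> V \<and> z \<notin> V)"

lemma valuation_ring_Vinf: "valuation_ring \<iota> Vinf" and z_not_Vinf: "z \<notin> Vinf"
  using theI'[of "\<lambda>V. valuation_ring \<iota> V \<and> z \<notin> V"] infinite_place_exists infinite_place_unique
  unfolding Vinf_def by blast+

lemma Vinf_eq: "valuation_ring \<iota> V \<Longrightarrow> z \<notin> V \<Longrightarrow> V = Vinf"
  using infinite_place_unique valuation_ring_Vinf z_not_Vinf by blast

lemma uniformizer_tau: "uniformizer Vinf \<tau>"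
proof -
  interpret V: valued_extension \<iota> Vinf by unfold_locales (rule valuation_ring_Vinf)
  have "\<exists>k u. u \<in> ring_units Vinf \<and> x = \<tau> powi k * u" if x: "x \<noteq> 0" for x
  proof -
    obtain k c where k: "c \<noteq> 0" "x * \<tau> powi k - \<iota> c \<in> place_of Vinf"
      using leading_coefficient[OF x] valuation_ring_Vinf z_not_Vinf by blast
    then have "x * \<tau> powi k \<in> ring_units Vinf" using V.unit_of_congruent V.const_unit by blast
    moreover have "x = \<tau> powi (- k) * (x * \<tau> powi k)" using tau_nonzero by (simp add: power_int_minus)
    ultimately show ?thesis by blast
  qed
  then show ?thesis
    unfolding uniformizer_def using tau tau_nonzero valuation_ring_Vinf z_not_Vinf by blast
qed

sublocale inf: discretely_valued_extension \<iota> Vinf \<tau>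
  by unfold_locales (rule valuation_ring_Vinf, rule uniformizer_tau)

text \<open>For pole order \<open>0\<close> the leading coefficient is the residue, for a zero the
  residue is \<open>0\<close>; so the residue field at infinity is \<open>K\<close>.\<close>

lemma residue_Vinf: "x \<in> Vinf \<Longrightarrow> \<exists>c. x - \<iota> c \<in> place_of Vinf"
proof (cases "x = 0")
  case False
  assume x: "x \<in> Vinf"
  obtain k c where k: "c \<noteq> 0" "x * \<tau> powi k - \<iota> c \<in> place_of Vinf"
    using leading_coefficient[OF False] valuation_ring_Vinf z_not_Vinf by blast
  have "k \<le> 0" using mem_infinite_iff[OF valuation_ring_Vinf z_not_Vinf k(2,1)] x by simp
  show ?thesis
  proof (cases "k = 0")
    case False
    have "x = \<tau> powi (- k) * (x * \<tau> powi k)" using tau_nonzero by (simp add: power_int_minus)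
    moreover have "\<tau> powi (- k) \<in> place_of Vinf"
      using inf.place_power[OF inf.t_place, of "nat (- k)"] \<open>k \<le> 0\<close> False by (simp add: power_int_def)
    moreover have "x * \<tau> powi k \<in> Vinf" using k inf.unit_of_congruent inf.const_unit inf.unit_mem by blast
    ultimately have "x \<in> place_of Vinf" using inf.place_mult by metis
    then show ?thesis by (intro exI[of _ 0]) simp
  qed (use k in auto)
qed (auto intro!: exI[of _ 0] simp: inf.zero_place)

lemma val_R: "x \<in> R \<Longrightarrow> x \<noteq> 0 \<Longrightarrow> \<exists>k\<in>poles. inf.val x = - int k"
proof -
  assume x: "x \<in> R" "x \<noteq> 0"
  obtain k c where k: "k \<in> poles" "c \<noteq> 0" "x * \<tau> ^ k - \<iota> c \<in> place_of Vinf"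
    using R_leading_term[OF x] valuation_ring_Vinf z_not_Vinf by blast
  then have "inf.val (x * \<tau> ^ k) = 0" using inf.unit_of_congruent inf.const_unit inf.val_unit by blast
  then have "inf.val x = - int k"
    using x tau_nonzero by (simp add: inf.val_mult inf.val_power inf.val_t eq_neg_iff_add_eq_0)
  then show ?thesis using k(1) by blast
qed

lemma val_monomial: "inf.val (z ^ i * w ^ j) = - int (weight (i, j))"
proof -
  have "inf.val (z ^ i * w ^ j * \<tau> ^ weight (i, j)) = 0"
    using monomial_congruent[OF valuation_ring_Vinf z_not_Vinf] inf.one_unit_unit inf.val_unit by blast
  then show ?thesis using z_nonzero w_nonzero tau_nonzero
    by (auto simp: inf.val_mult inf.val_power inf.val_t)
qed

lemma val_w: "inf.val w = - int D"
  using val_monomial[of 0 1] by (simp add: weight_def)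

end

section \<open>Frobenius on sums and on additive powers\<close>

lemma power_two_power_sum:
  fixes f :: "'b \<Rightarrow> 'a::field"
  assumes "(1::'a) + 1 = 0"
  shows "(\<Sum>x\<in>X. f x) ^ 2 ^ i = (\<Sum>x\<in>X. f x ^ 2 ^ i)"
  by (induction X rule: infinite_finite_induct) (auto simp: power_two_power_add[OF assms] zero_power)

lemma power_two_power_diff:
  fixes x y :: "'a::field"
  assumes "(1::'a) + 1 = 0"
  shows "(x - y) ^ 2 ^ i = x ^ 2 ^ i - y ^ 2 ^ i"
  using power_two_power_add[OF assms, of "x - y" y i] by (simp add: eq_diff_eq)

lemma additive_power_power:
  fixes u :: "'a::field"
  assumes "(1::'a) + 1 = 0"
  shows "additive_power (u ^ 2 ^ i) f = additive_power u f ^ 2 ^ i"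
proof -
  have "(u ^ 2 ^ i) ^ 2 ^ j = (u ^ 2 ^ j) ^ 2 ^ i" for j by (simp add: mult.commute flip: power_mult)
  then show ?thesis
    unfolding additive_power_def power_two_power_sum[OF assms] power_mult_distrib
    by (intro sum.cong) (auto simp: zero_power)
qed

context additive_kummer
begin

section \<open>Functions with poles only at infinity\<close>

text \<open>For each \<open>j < N\<close> there are \<open>(k - D * j) div N + 1\<close> choices of
  the other exponent. Since \<open>N\<close> and \<open>D\<close> are coprime, the remainders of
  \<open>k - D * j\<close> modulo \<open>N\<close> run through \<open>0, ..., N - 1\<close>, which
  evaluates the sum of the quotients. The bound on \<open>k\<close> keeps the natural subtractions
  \<open>k - D * j\<close> from being truncated.\<close>

lemma card_poles:
  assumes k: "N * D \<le> k"
  shows "card (poles \<inter> {..k}) + (N - 1) * (D - 1) div 2 = k + 1"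
proof -
  have Dj: "D * j \<le> k" if "j < N" for j
    using that k order_trans[OF mult_le_mono2[of j N D], of k] by (simp add: mult.commute)
  let ?T = "SIGMA j:{..<N}. {i. N * i + D * j \<le> k}"
  have fib: "{i. N * i + D * j \<le> k} = {..(k - D * j) div N}" if "j < N" for j
    using Dj[OF that] N_pos by (auto simp: less_eq_div_iff_mult_less_eq mult.commute)
  have "poles \<inter> {..k} = weight ` (\<lambda>(j, i). (i, j)) ` ?T"
    by (auto simp: poles_def weight_def image_iff)
  moreover have "inj_on weight ((\<lambda>(j, i). (i, j)) ` ?T)"
    by (rule inj_on_subset[OF weight_inj]) auto
  moreover have "inj_on (\<lambda>(j, i). (i, j)) ?T" by (auto intro: inj_onI)
  ultimately have "card (poles \<inter> {..k}) = card ?T" by (simp add: card_image)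
  also have "\<dots> = (\<Sum>j<N. (k - D * j) div N + 1)"
    using fib by (simp add: card_SigmaI)
  finally have card: "int (card (poles \<inter> {..k})) = (\<Sum>j<N. int ((k - D * j) div N)) + int N"
    by (simp add: sum.distrib)
  define G where "G = (N - 1) * (D - 1)"
  define X where "X = (\<Sum>j<N. int ((k - D * j) div N))"
  have mods: "(\<Sum>j<N. (k - D * j) mod N) = (\<Sum>j<N. j)"
  proof (rule sum.reindex_bij_betw[where g = "\<lambda>x. x"])
    have inj: "inj_on (\<lambda>j. (k - D * j) mod N) {..<N}"
    proof (rule linorder_inj_onI)
      fix i j assume ij: "i < j" "i \<in> {..<N}" "j \<in> {..<N}"
      show "(k - D * i) mod N \<noteq> (k - D * j) mod N"
      proof
        assume "(k - D * i) mod N = (k - D * j) mod N"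
        then have "N dvd (k - D * i) - (k - D * j)"
          using ij by (metis mod_eq_dvd_iff_nat diff_le_mono2 less_imp_le mult_le_mono2)
        moreover have "(k - D * i) - (k - D * j) = D * (j - i)"
          using Dj[of j] ij by (simp add: diff_mult_distrib2)
        ultimately have "N dvd j - i" using coprime_ND coprime_dvd_mult_right_iff by metis
        then show False using ij by (auto dest: dvd_imp_le)
      qed
    qed auto
    have "(\<lambda>j. (k - D * j) mod N) ` {..<N} = {..<N}"
      by (rule card_subset_eq) (use inj N_pos in \<open>auto simp: card_image\<close>)
    with inj show "bij_betw (\<lambda>j. (k - D * j) mod N) {..<N} {..<N}" by (simp add: bij_betw_def)
  qed
  have gauss: "2 * (\<Sum>j<N. int j) = int N * (int N - 1)"
    by (induction N) (simp_all add: algebra_simps)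
  have "int N * X + (\<Sum>j<N. int ((k - D * j) mod N)) = (\<Sum>j<N. int (N * ((k - D * j) div N) + (k - D * j) mod N))"
    by (simp only: X_def sum_distrib_left sum.distrib of_nat_add of_nat_mult)
  also have "\<dots> = (\<Sum>j<N. int k - int D * int j)"
    using Dj by (intro sum.cong) (auto simp: of_nat_diff)
  also have "\<dots> = int N * int k - int D * (\<Sum>j<N. int j)"
    by (simp only: sum_subtractf sum_distrib_left sum_constant card_lessThan of_nat_id)
  finally have eq: "int N * X + (\<Sum>j<N. int ((k - D * j) mod N)) = int N * int k - int D * (\<Sum>j<N. int j)" .
  have "(\<Sum>j<N. int ((k - D * j) mod N)) = int (\<Sum>j<N. (k - D * j) mod N)" by (simp only: of_nat_sum)
  then have "(\<Sum>j<N. int ((k - D * j) mod N)) = (\<Sum>j<N. int j)" unfolding mods by (simp only: of_nat_sum)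
  with eq have "2 * (int N * X) + 2 * (\<Sum>j<N. int j) = 2 * (int N * int k) - int D * (2 * (\<Sum>j<N. int j))"
    by simp
  then have "int N * (2 * X + (int N - 1)) = int N * (2 * int k - int D * (int N - 1))"
    unfolding gauss by (simp add: algebra_simps)
  then have "2 * X + (int N - 1) = 2 * int k - int D * (int N - 1)" using N_pos by simp
  moreover have "int ((N - 1) * (D - 1)) = (int N - 1) * (int D - 1)"
    using N_pos D_pos by (simp only: of_nat_mult of_nat_diff Suc_leI One_nat_def of_nat_Suc of_nat_0 add_0_left add_0_right)
  ultimately have "2 * int (card (poles \<inter> {..k})) + int ((N - 1) * (D - 1)) = 2 * (int k + 1)"
    using card unfolding X_def[symmetric] by (simp add: algebra_simps)
  then have "2 * card (poles \<inter> {..k}) + (N - 1) * (D - 1) = 2 * (k + 1)"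
    unfolding G_def[symmetric]
    using of_nat_eq_iff[where 'a = int, of "2 * card (poles \<inter> {..k}) + G" "2 * (k + 1)"] by simp
  moreover have "even ((N - 1) * (D - 1))" using odd_N by simp
  ultimately show ?thesis unfolding G_def[symmetric] by presburger
qed

text \<open>The counts up to \<open>k\<close> and up to \<open>k - 1\<close> differ by one; the
  strict bound brings \<open>k - 1\<close> into the range of \<open>card_poles\<close> too.\<close>

lemma large_poles:
  assumes "N * D < k"
  shows "k \<in> poles"
proof (rule ccontr)
  assume "k \<notin> poles"
  obtain l where l: "k = Suc l" using assms not0_implies_Suc by fastforce
  have "poles \<inter> {..k} = poles \<inter> {..l}" using \<open>k \<notin> poles\<close> by (auto simp: l le_Suc_eq)
  then show False using card_poles[of k] card_poles[of l] assms l by simp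
qed

lemma poles_monomial:
  assumes "k \<in> poles"
  obtains e where "e \<in> R" "e \<noteq> 0" "inf.val e = - int k"
proof -
  obtain i j where "k = weight (i, j)" using assms by (auto simp: poles_def)
  then show thesis
    using that[of "z ^ i * w ^ j"] val_monomial R_mult R_power R_z R_w z_nonzero w_nonzero by simp
qed

text \<open>The Riemann-Roch space of \<open>m\<close> times the place at infinity, as
  \<open>L_infdiv\<close> confirms once \<open>R\<close> is known to consist of all functions
  regular elsewhere.\<close>

definition RR :: "int \<Rightarrow> 'a set" where
  "RR m = {x \<in> R. x * \<tau> powi m \<in> Vinf}"

lemma RR_iff: "x \<in> RR m \<longleftrightarrow> x \<in> R \<and> (x = 0 \<or> - m \<le> inf.val x)"
  using inf.val_ge_iff[of x "- m"] by (cases "x = 0") (auto simp: RR_def inf.zero_mem)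

lemma RR_diff: "x \<in> RR m \<Longrightarrow> y \<in> RR m \<Longrightarrow> x - y \<in> RR m"
  and RR_add: "x \<in> RR m \<Longrightarrow> y \<in> RR m \<Longrightarrow> x + y \<in> RR m"
  by (auto simp: RR_def R_diff R_add inf.diff_mem inf.add_mem left_diff_distrib distrib_right)

text \<open>The residue of \<open>x / y\<close> at infinity is a constant; subtracting that multiple
  of \<open>y\<close> cancels the leading term.\<close>

lemma val_reduce:
  assumes "x \<noteq> 0" "y \<noteq> 0" "inf.val x = inf.val y"
  obtains c where "c \<noteq> 0" "x - \<iota> c * y = 0 \<or> inf.val x < inf.val (x - \<iota> c * y)"
proof -
  have u: "x / y \<in> ring_units Vinf"
    using assms inf.val_mult[of x "inverse y"] inf.val_inverse[of y]
    by (simp add: inf.unit_iff_val divide_inverse)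
  then obtain c where c: "x / y - \<iota> c \<in> place_of Vinf" using residue_Vinf inf.unit_mem by blast
  have "c \<noteq> 0" using c u inf.unit_not_place by auto
  moreover have "inf.val x < inf.val (x - \<iota> c * y)" if "x - \<iota> c * y \<noteq> 0"
  proof -
    have eq: "x - \<iota> c * y = (x / y - \<iota> c) * y" using assms by (simp add: field_simps)
    then have "x / y - \<iota> c \<noteq> 0" using that by auto
    then have "0 < inf.val (x / y - \<iota> c)" using c inf.val_pos_iff by blast
    then show ?thesis using eq assms inf.val_mult \<open>x / y - \<iota> c \<noteq> 0\<close> by simp
  qed
  ultimately show thesis using that by blast
qed

text \<open>The shift by one lets the induction start at \<open>RR (- 1) = {0}\<close>. Allowing
  pole order \<open>k\<close> multiplies the cardinality by that of \<open>K\<close> if some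
  monomial \<open>e\<close> has this pole order, and changes nothing otherwise.\<close>

lemma card_RR_poles: "finite (RR (int k - 1)) \<and> card (RR (int k - 1)) = CARD('k) ^ card (poles \<inter> {..<k})"
proof (induction k)
  case 0
  have "RR (int 0 - 1) = {0}" using val_R by (fastforce simp: RR_iff R_0)
  then show ?case by simp
next
  case (Suc k)
  have R1: "RR (int (Suc k) - 1) = RR (int k)" by simp
  have sub: "x \<in> RR (int k)" if "x \<in> RR (int k - 1)" for x using that by (auto simp: RR_iff)
  show ?case
  proof (cases "k \<in> poles")
    case False
    have "RR (int k) \<subseteq> RR (int k - 1)"
    proof
      fix x assume x: "x \<in> RR (int k)"
      show "x \<in> RR (int k - 1)"
      proof (cases "x = 0")
        case x0: False
        then obtain l where "l \<in> poles" "inf.val x = - int l" using val_R x by (auto simp: RR_iff)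
        then show ?thesis using x False by (cases "l = k") (auto simp: RR_iff)
      qed (simp add: RR_iff R_0)
    qed
    then have "RR (int k) = RR (int k - 1)" using sub by blast
    moreover have "poles \<inter> {..<Suc k} = poles \<inter> {..<k}" using False less_Suc_eq by auto
    ultimately show ?thesis using Suc R1 by simp
  next
    case True
    then obtain e where e: "e \<in> R" "e \<noteq> 0" "inf.val e = - int k" by (rule poles_monomial)
    let ?f = "\<lambda>(c, x). \<iota> c * e + x"
    have "bij_betw ?f (UNIV \<times> RR (int k - 1)) (RR (int k))"
      unfolding bij_betw_def
    proof
      show "inj_on ?f (UNIV \<times> RR (int k - 1))"
      proof (rule inj_onI, clarsimp)
        fix c x d y assume x: "x \<in> RR (int k - 1)" and y: "y \<in> RR (int k - 1)"
          and eq: "\<iota> c * e + x = \<iota> d * e + y"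
        show "c = d \<and> x = y"
        proof (cases "c = d")
          case False
          have ce: "\<iota> (c - d) * e = y - x" using eq by (simp add: hom_distribs algebra_simps)
          have nz: "\<iota> (c - d) \<noteq> 0" using False by simp
          have "inf.val (\<iota> (c - d) * e) = - int k"
            using e nz False inf.const_unit[of "c - d"] inf.val_unit by (simp add: inf.val_mult)
          moreover have "y - x \<in> RR (int k - 1)" using x y RR_diff by blast
          moreover have "y - x \<noteq> 0" using ce nz e by (metis mult_eq_0_iff)
          ultimately show ?thesis unfolding ce by (simp add: RR_iff)
        qed (use eq in simp)
      qed
      show "?f ` (UNIV \<times> RR (int k - 1)) = RR (int k)"
      proof (intro equalityI subsetI)
        fix x assume "x \<in> ?f ` (UNIV \<times> RR (int k - 1))"
        then obtain c y where cy: "y \<in> RR (int k - 1)" "x = \<iota> c * e + y" by auto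
        have "inf.val (\<iota> c * e) = - int k" if "c \<noteq> 0"
          using e that inf.const_unit[of c] inf.val_unit by (simp add: inf.val_mult)
        then have "\<iota> c * e \<in> RR (int k)" using e R_mult R_const by (cases "c = 0") (auto simp: RR_iff R_0)
        then show "x \<in> RR (int k)" using cy RR_add sub by blast
      next
        fix x assume x: "x \<in> RR (int k)"
        show "x \<in> ?f ` (UNIV \<times> RR (int k - 1))"
        proof (cases "x \<in> RR (int k - 1)")
          case True
          then show ?thesis by (intro image_eqI[of _ _ "(0, x)"]) auto
        next
          case False
          then have xv: "x \<noteq> 0" "inf.val x = inf.val e" using x e by (auto simp: RR_iff)
          obtain c where c: "x - \<iota> c * e = 0 \<or> inf.val x < inf.val (x - \<iota> c * e)"
            using val_reduce[OF xv(1) e(2) xv(2)] by blast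
          have "x - \<iota> c * e \<in> RR (int k - 1)"
            using c x e xv by (auto simp: RR_iff intro!: R_diff R_mult R_const)
          then show ?thesis by (intro image_eqI[of _ _ "(c, x - \<iota> c * e)"]) auto
        qed
      qed
    qed
    from bij_betw_finite[OF this] bij_betw_same_card[OF this]
    have "finite (RR (int k))" "card (RR (int k)) = CARD('k) * card (RR (int k - 1))"
      using Suc finite_const by (auto simp: finite_cartesian_product card_cartesian_product)
    moreover have "poles \<inter> {..<Suc k} = insert k (poles \<inter> {..<k})" using True less_Suc_eq by auto
    ultimately show ?thesis using Suc R1 by simp
  qed
qed

lemma finite_RR: "finite (RR m)"
proof (cases "0 \<le> m")
  case True
  then have "RR m = RR (int (Suc (nat m)) - 1)" by simp
  then show ?thesis using card_RR_poles by metis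
next
  case False
  then have "RR m \<subseteq> RR (int 0 - 1)" by (auto simp: RR_iff)
  then show ?thesis using card_RR_poles finite_subset by blast
qed

lemma card_RR:
  assumes "int (N * D) \<le> m"
  shows "card (RR m) = CARD('k) ^ nat (m + 1 - int ((N - 1) * (D - 1) div 2))"
proof -
  have "0 \<le> m" using assms by (meson of_nat_0_le_iff order_trans)
  then have m: "m = int (Suc (nat m)) - 1" by simp
  have "N * D \<le> nat m" using assms by linarith
  then have "card (poles \<inter> {..<Suc (nat m)}) = nat (m + 1 - int ((N - 1) * (D - 1) div 2))"
    using card_poles[of "nat m"] \<open>0 \<le> m\<close> unfolding lessThan_Suc_atMost by linarith
  then show ?thesis using card_RR_poles[of "Suc (nat m)"] m by simp
qed

text \<open>While the pole order of \<open>x\<close> exceeds that of \<open>f\<close> by more than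
  \<open>N * D\<close>, \<open>large_poles\<close> supplies an \<open>e\<close> such that
  \<open>f * e\<close> has the pole order of \<open>x\<close> and can lower it. As the spaces
  \<open>RR\<close> are finite, so is \<open>R\<close> modulo \<open>f\<close>.\<close>

lemma R_division:
  assumes f: "f \<in> R" "f \<noteq> 0" and x: "x \<in> R"
  shows "\<exists>y\<in>R. x - f * y \<in> RR (int (N * D) - inf.val f)"
  using x
proof (induction "nat (- inf.val x)" arbitrary: x rule: less_induct)
  case less
  show ?case
  proof (cases "x \<in> RR (int (N * D) - inf.val f)")
    case True
    then show ?thesis using R_0 by (intro bexI[of _ 0]) auto
  next
    case False
    then have x0: "x \<noteq> 0" and v: "inf.val x < inf.val f - int (N * D)"
      using less.prems by (auto simp: RR_iff)
    define l where "l = nat (inf.val f - inf.val x)"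
    have "N * D < l" using v unfolding l_def by linarith
    then obtain e where e: "e \<in> R" "e \<noteq> 0" "inf.val e = - int l"
      using large_poles poles_monomial by metis
    have "inf.val (f * e) = inf.val x" using e f v by (simp add: inf.val_mult l_def)
    then obtain c where c: "x - \<iota> c * (f * e) = 0 \<or> inf.val x < inf.val (x - \<iota> c * (f * e))"
      using val_reduce[of x "f * e"] x0 e f by (metis mult_eq_0_iff)
    let ?x = "x - \<iota> c * (f * e)"
    have xR: "?x \<in> R" using less.prems e f by (intro R_diff R_mult R_const)
    have "\<exists>y\<in>R. ?x - f * y \<in> RR (int (N * D) - inf.val f)"
    proof (cases "?x = 0")
      case True
      then show ?thesis using R_0 by (intro bexI[of _ 0]) (auto simp: RR_iff)
    next
      case False
      have "inf.val f \<le> 0" using val_R[OF f] by auto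
      then have "inf.val x < 0" using v of_nat_0_le_iff[of "N * D"] by linarith
      then have "nat (- inf.val ?x) < nat (- inf.val x)" using c False by auto
      then show ?thesis using less.hyps xR by blast
    qed
    then obtain y where y: "y \<in> R" "?x - f * y \<in> RR (int (N * D) - inf.val f)" by blast
    have eq: "x - f * (\<iota> c * e + y) = ?x - f * y" by (simp add: algebra_simps)
    have "x - f * (\<iota> c * e + y) \<in> RR (int (N * D) - inf.val f)" unfolding eq by (rule y(2))
    then show ?thesis using y(1) e(1) R_add R_mult R_const by blast
  qed
qed

text \<open>Two sequences are treated together because the residues of \<open>z\<close> and
  \<open>w\<close> have to repeat at the same pair of indices.\<close>

lemma R_pigeonhole:
  fixes u v :: "nat \<Rightarrow> 'a"
  assumes f: "f \<in> R" "f \<noteq> 0" and uv: "\<And>i. u i \<in> R" "\<And>i. v i \<in> R"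
  obtains i j y y' where "i < j" "y \<in> R" "y' \<in> R" "u i - u j = f * y" "v i - v j = f * y'"
proof -
  let ?B = "RR (int (N * D) - inf.val f)"
  have "\<forall>x. \<exists>y. x \<in> R \<longrightarrow> y \<in> R \<and> x - f * y \<in> ?B" using R_division[OF f] by blast
  then obtain \<rho> where \<rho>: "\<And>x. x \<in> R \<Longrightarrow> \<rho> x \<in> R \<and> x - f * \<rho> x \<in> ?B" by metis
  define F where "F i = (u i - f * \<rho> (u i), v i - f * \<rho> (v i))" for i
  have "finite (range F)"
    by (rule finite_subset[of _ "?B \<times> ?B"]) (use \<rho> uv finite_RR in \<open>auto simp: F_def\<close>)
  then have "\<not> inj F" using finite_imageD infinite_UNIV_nat by blast
  then obtain i j where "F i = F j" "i \<noteq> j" by (auto simp: inj_def)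
  then obtain i j where ij: "i < j" "F i = F j" by (metis linorder_neqE_nat)
  then have "u i - u j = f * (\<rho> (u i) - \<rho> (u j))" "v i - v j = f * (\<rho> (v i) - \<rho> (v j))"
    by (auto simp: F_def algebra_simps)
  then show thesis using that[OF ij(1)] \<rho> uv R_diff by metis
qed

lemma R_induct [consumes 1, case_names const z w add mult]:
  assumes "x \<in> R" "\<And>c. P (\<iota> c)" "P z" "P w"
    "\<And>x y. x \<in> R \<Longrightarrow> y \<in> R \<Longrightarrow> P x \<Longrightarrow> P y \<Longrightarrow> P (x + y)"
    "\<And>x y. x \<in> R \<Longrightarrow> y \<in> R \<Longrightarrow> P x \<Longrightarrow> P y \<Longrightarrow> P (x * y)"
  shows "P x"
proof -
  have zz: "evz c \<in> R \<and> P (evz c)" for c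
  proof (induction c)
    case 0
    then show ?case using assms(2)[of 0] R_0 by simp
  next
    case (pCons a c)
    have "evz (pCons a c) = \<iota> a + z * evz c" by (simp add: evz_def hom_distribs)
    then show ?case using pCons assms R_const R_z R_add R_mult by simp
  qed
  have "ev f \<in> R \<and> P (ev f)" for f
  proof (induction f)
    case 0
    then show ?case using assms(2)[of 0] R_0 ev_0 by simp
  next
    case (pCons a f)
    have "ev (pCons a f) = evz a + w * ev f" by (simp add: ev_def hom_distribs)
    then show ?case using pCons zz assms R_w R_add R_mult by simp
  qed
  then show ?thesis using assms(1) by (auto simp: R_def)
qed

section \<open>Affine places\<close>

lemma const_power: "\<iota> c ^ CARD('k) ^ r = \<iota> c"
proof -
  have "c ^ CARD('k) ^ r = c"
  proof (induction r)
    case (Suc r)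
    then show ?case using power_card_field[OF finite_const] by (simp add: power_mult)
  qed simp
  then show ?thesis by (metis hom_power)
qed

lemma card_const_power: "CARD('k) ^ r = 2 ^ (s * r)"
  by (simp add: card_const power_mult)

lemma power_card_diff: "(x - y :: 'a) ^ CARD('k) ^ r = x ^ CARD('k) ^ r - y ^ CARD('k) ^ r"
  unfolding card_const_power by (rule power_two_power_diff[OF char_two])

lemma card_const_ge: "2 \<le> CARD('k)"
proof -
  have "card {0, 1 :: 'k} \<le> CARD('k)" using finite_const by (intro card_mono) auto
  then show ?thesis by simp
qed

lemma card_power_ge: "0 < r \<Longrightarrow> 2 \<le> CARD('k) ^ r"
  using card_const_ge by (metis One_nat_def Suc_leI order_trans power_increasing power_one_right order.trans one_le_numeral)

text \<open>The residues of \<open>z\<close> and \<open>w\<close> are fixed by the power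
  \<open>CARD('k) ^ r\<close>, so they lie in the field with that many elements.\<close>

definition period :: "'a set \<Rightarrow> nat \<Rightarrow> bool" where
  "period V r \<longleftrightarrow> 0 < r \<and> z ^ CARD('k) ^ r - z \<in> place_of V \<and> w ^ CARD('k) ^ r - w \<in> place_of V"

lemma period_mult:
  assumes V: "valuation_ring \<iota> V" and r: "period V r" and m: "0 < m"
  shows "period V (r * m)"
proof -
  interpret V: valued_extension \<iota> V by unfold_locales (rule V)
  have "x ^ CARD('k) ^ (r * m) - x \<in> place_of V" if x: "x ^ CARD('k) ^ r - x \<in> place_of V" for x
  proof (induction m)
    case (Suc m)
    have "(x ^ CARD('k) ^ (r * m) - x) ^ CARD('k) ^ r = x ^ CARD('k) ^ (r * Suc m) - x ^ CARD('k) ^ r"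
      unfolding power_card_diff by (simp add: power_add mult.commute flip: power_mult)
    moreover have "(x ^ CARD('k) ^ (r * m) - x) ^ CARD('k) ^ r \<in> place_of V"
      using Suc card_const_ge by (intro V.place_power) auto
    ultimately show ?case using x V.place_diff_trans by metis
  qed (simp add: V.zero_place)
  then show ?thesis using r m by (auto simp: period_def)
qed

text \<open>\<open>w\<close> is integral over \<open>K[z]\<close> through \<open>w ^ N\<close>, so a
  place where \<open>z\<close> is finite has all of \<open>R\<close> in its ring.\<close>

lemma affine_R:
  assumes V: "valuation_ring \<iota> V" "z \<in> V"
  shows "R \<subseteq> V"
proof -
  interpret V: valued_extension \<iota> V by unfold_locales (rule V)
  have "w \<in> V"
  proof (rule ccontr)
    assume "w \<notin> V"
    then have "inverse w ^ N \<in> place_of V" using V.inverse_place V.place_power N_pos by blast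
    moreover have "w ^ N \<in> V"
      unfolding equation additive_power_def
      using V by (intro V.sum_mem V.mult_mem V.power_mem) (auto simp: V.zero_mem V.one_mem)
    ultimately have "inverse w ^ N * w ^ N \<in> place_of V" by (rule V.place_mult)
    then show False using w_nonzero V.one_not_place by (simp flip: power_mult_distrib)
  qed
  have "x \<in> V" if "x \<in> R" for x
    using that by (induction rule: R_induct) (use V \<open>w \<in> V\<close> in \<open>auto intro: V.const_mem V.add_mem V.mult_mem\<close>)
  then show ?thesis by blast
qed

text \<open>If every nonzero element of \<open>R\<close> were a unit of \<open>V\<close>, all
  quotients, hence the whole field, would lie in \<open>V\<close>.\<close>

lemma affine_nonzero_element:
  assumes V: "valuation_ring \<iota> V" "z \<in> V"
  obtains f where "f \<in> R" "f \<noteq> 0" "f \<in> place_of V"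
proof -
  interpret V: valued_extension \<iota> V by unfold_locales (rule V)
  have "\<exists>f\<in>R. f \<noteq> 0 \<and> f \<in> place_of V"
  proof (rule ccontr)
    assume a: "\<not> ?thesis"
    have "x \<in> V" for x
    proof -
      obtain f g where fg: "f \<in> R" "g \<in> R" "g \<noteq> 0" "x = f / g" using fraction by blast
      have "g \<in> ring_units V" using a fg affine_R[OF V] V.not_place_unit by blast
      then show ?thesis using fg affine_R[OF V] V.mult_mem V.unit_iff by (auto simp: divide_inverse)
    qed
    then show False using V.not_UNIV by blast
  qed
  then show thesis using that by blast
qed

text \<open>Modulo a nonzero \<open>f\<close> in the place, the Frobenius iterates of the pair
  \<open>z\<close>, \<open>w\<close> repeat.\<close>

lemma period_exists:
  assumes V: "valuation_ring \<iota> V" "z \<in> V"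
  obtains r where "period V r"
proof -
  interpret V: valued_extension \<iota> V by unfold_locales (rule V)
  obtain f where f: "f \<in> R" "f \<noteq> 0" "f \<in> place_of V" using affine_nonzero_element[OF V] .
  obtain i j y y' where ij: "i < j" "y \<in> R" "y' \<in> R"
    "z ^ CARD('k) ^ i - z ^ CARD('k) ^ j = f * y" "w ^ CARD('k) ^ i - w ^ CARD('k) ^ j = f * y'"
    using R_pigeonhole[OF f(1,2), of "\<lambda>i. z ^ CARD('k) ^ i" "\<lambda>i. w ^ CARD('k) ^ i"] R_power R_z R_w by metis
  have *: "x ^ CARD('k) ^ (j - i) - x \<in> place_of V"
    if xy: "x ^ CARD('k) ^ i - x ^ CARD('k) ^ j = f * y" "y \<in> R" for x y
  proof -
    \<comment> \<open>The difference is a \<open>CARD('k) ^ i\<close>-th power, and the place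
      contains an element as soon as it contains a power of it; so the first \<open>i\<close>
      iterates can be cancelled.\<close>
    have "CARD('k) ^ j = CARD('k) ^ (j - i) * CARD('k) ^ i" using ij(1) by (simp flip: power_add)
    then have "(x - x ^ CARD('k) ^ (j - i)) ^ CARD('k) ^ i = x ^ CARD('k) ^ i - x ^ CARD('k) ^ j"
      unfolding power_card_diff by (simp only: power_mult)
    also have "\<dots> \<in> place_of V" unfolding xy(1) using f xy(2) affine_R[OF V] V.place_mult by blast
    finally show ?thesis using V.place_powerD V.place_diff_sym card_const_ge by fastforce
  qed
  have "period V (j - i)" unfolding period_def using *[OF ij(4,2)] *[OF ij(5,3)] ij(1) by simp
  then show thesis by (rule that)
qed

text \<open>Raising to the power \<open>CARD('k) ^ r\<close> is a ring endomorphism that fixes the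
  constants, so it is the identity modulo the ideal generated by its effect on \<open>w\<close> and
  \<open>z\<close>.\<close>

lemma power_card_congruent:
  assumes x: "x \<in> R"
  shows "\<exists>a\<in>R. \<exists>b\<in>R. x ^ CARD('k) ^ r - x = (w ^ CARD('k) ^ r - w) * a + (z ^ CARD('k) ^ r - z) * b"
  using x
proof (induction rule: R_induct)
  case (const c)
  show ?case using const_power R_0 by (intro bexI[of _ 0]) auto
next
  case z
  show ?case using R_0 R_1 by (intro bexI[of _ 0] bexI[of _ 1]) auto
next
  case w
  show ?case using R_0 R_1 by (intro bexI[of _ 1] bexI[of _ 0]) auto
next
  case (add x y)
  then obtain a b a' b' where ab: "a \<in> R" "b \<in> R" "a' \<in> R" "b' \<in> R"
    "x ^ CARD('k) ^ r - x = (w ^ CARD('k) ^ r - w) * a + (z ^ CARD('k) ^ r - z) * b"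
    "y ^ CARD('k) ^ r - y = (w ^ CARD('k) ^ r - w) * a' + (z ^ CARD('k) ^ r - z) * b'" by blast
  have "(x + y) ^ CARD('k) ^ r - (x + y) = (x ^ CARD('k) ^ r - x) + (y ^ CARD('k) ^ r - y)"
    unfolding card_const_power power_two_power_add[OF char_two] by simp
  also have "\<dots> = (w ^ CARD('k) ^ r - w) * (a + a') + (z ^ CARD('k) ^ r - z) * (b + b')"
    unfolding ab by (simp add: distrib_left)
  finally show ?case using ab R_add by blast
next
  case (mult x y)
  then obtain a b a' b' where ab: "a \<in> R" "b \<in> R" "a' \<in> R" "b' \<in> R"
    "x ^ CARD('k) ^ r - x = (w ^ CARD('k) ^ r - w) * a + (z ^ CARD('k) ^ r - z) * b"
    "y ^ CARD('k) ^ r - y = (w ^ CARD('k) ^ r - w) * a' + (z ^ CARD('k) ^ r - z) * b'" by blast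
  have "(x * y) ^ CARD('k) ^ r - x * y = x ^ CARD('k) ^ r * (y ^ CARD('k) ^ r - y) + y * (x ^ CARD('k) ^ r - x)"
    by (simp add: power_mult_distrib algebra_simps)
  also have "\<dots> = (w ^ CARD('k) ^ r - w) * (x ^ CARD('k) ^ r * a' + y * a) +
      (z ^ CARD('k) ^ r - z) * (x ^ CARD('k) ^ r * b' + y * b)"
    unfolding ab by (simp only: distrib_left mult_ac add_ac)
  finally have "(x * y) ^ CARD('k) ^ r - x * y = (w ^ CARD('k) ^ r - w) * (x ^ CARD('k) ^ r * a' + y * a) +
      (z ^ CARD('k) ^ r - z) * (x ^ CARD('k) ^ r * b' + y * b)" .
  moreover have "x ^ CARD('k) ^ r * a' + y * a \<in> R" "x ^ CARD('k) ^ r * b' + y * b \<in> R"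
    using ab mult by (auto intro: R_add R_mult R_power)
  ultimately show ?case by blast
qed

lemma power_card_place:
  assumes V: "valuation_ring \<iota> V" "z \<in> V" and r: "period V r" and x: "x \<in> R"
  shows "x ^ CARD('k) ^ r - x \<in> place_of V"
proof -
  interpret V: valued_extension \<iota> V by unfold_locales (rule V)
  obtain a b where ab: "a \<in> V" "b \<in> V"
    "x ^ CARD('k) ^ r - x = (w ^ CARD('k) ^ r - w) * a + (z ^ CARD('k) ^ r - z) * b"
    using power_card_congruent[OF x, of r] affine_R[OF V] by blast
  show ?thesis
    unfolding ab(3) using r ab by (intro V.place_add V.place_mult) (auto simp: period_def)
qed

text \<open>Since \<open>A(z\<^sup>Q - z) = (w\<^sup>Q)\<^sup>N - w\<^sup>N\<close> for the additive polynomial \<open>A\<close>, which has a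
  simple root at \<open>0\<close>, the element \<open>w\<^sup>Q - w\<close> divides \<open>z\<^sup>Q - z\<close> locally, and hence everything in
  the maximal ideal.\<close>

lemma affine_local_generator:
  assumes V: "valuation_ring \<iota> V" "z \<in> V" and r: "period V r" and f: "f \<in> R" "f \<in> place_of V"
  obtains a b where "a \<in> R" "b \<in> R" "b \<notin> place_of V" "f * b = (w ^ CARD('k) ^ r - w) * a"
proof -
  interpret V: valued_extension \<iota> V by unfold_locales (rule V)
  define Q t y where "Q = CARD('k) ^ r" and "t = w ^ Q - w" and "y = z ^ Q - z"
  have Q2: "2 \<le> Q" using r card_power_ge by (simp add: Q_def period_def)
  have yR: "y \<in> R" and yP: "y \<in> place_of V"
    using R_diff R_power R_z r by (auto simp: y_def Q_def period_def)
  \<comment> \<open>The additive polynomial in \<open>y\<close>, divided by \<open>y\<close>. It is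
    congruent to \<open>1\<close> because its constant term is \<open>coeff h 0\<close> and
    \<open>y\<close> lies in the place.\<close>
  define u where "u = 1 + (\<Sum>i\<in>{1..degree h}. of_bool (coeff h i = 1) * y ^ (2 ^ i - 1))"
  have uR: "u \<in> R"
    unfolding u_def using yR by (intro R_add R_1 R_sum R_mult R_power) (auto simp: R_0 R_1)
  have "of_bool (coeff h i = 1) * y ^ (2 ^ i - 1) \<in> place_of V" if "i \<in> {1..degree h}" for i
  proof -
    have "0 < (2::nat) ^ i - 1" using that one_less_power[of "2::nat" i] by auto
    then show ?thesis using V.place_power[OF yP] V.zero_place by auto
  qed
  then have "u - 1 \<in> place_of V"
    unfolding u_def add_diff_cancel_left' by (rule V.place_sum)
  then have uP: "u \<notin> place_of V" using V.one_unit_unit V.unit_not_place by blast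
  have "additive_power y h = y * u"
  proof -
    have "additive_power y h = y + (\<Sum>i\<in>{1..degree h}. of_bool (coeff h i = 1) * y ^ 2 ^ i)"
      unfolding additive_power_def atMost_atLeast0
      by (subst sum.atLeast_Suc_atMost) (auto simp: coeff_h_0)
    also have "\<dots> = y * u"
    proof -
      have "y ^ 2 ^ i = y * y ^ (2 ^ i - 1)" for i by (simp flip: power_Suc)
      then show ?thesis unfolding u_def distrib_left sum_distrib_left by (simp add: mult.left_commute)
    qed
    finally show ?thesis .
  qed
  moreover have "additive_power y h = (w ^ Q) ^ N - w ^ N"
    unfolding y_def Q_def card_const_power additive_power_diff_arg[OF char_two] additive_power_power[OF char_two]
    by (simp add: mult.commute flip: equation power_mult)
  moreover obtain c where "c \<in> R" "(w ^ Q) ^ N - w ^ N = t * c"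
  proof -
    obtain M where M: "N = Suc M" using N_pos gr0_implies_Suc by blast
    have "(w ^ Q) ^ N - w ^ N = t * (\<Sum>p<Suc M. (w ^ Q) ^ p * w ^ (M - p))"
      unfolding M t_def by (rule diff_power_eq_sum)
    moreover have "(\<Sum>p<Suc M. (w ^ Q) ^ p * w ^ (M - p)) \<in> R"
      by (intro R_sum R_mult R_power R_w)
    ultimately show thesis using that by blast
  qed
  ultimately have c: "y * u = t * c" "c \<in> R" by simp_all
  obtain a b where ab: "a \<in> R" "b \<in> R" "f ^ Q - f = t * a + y * b"
    using power_card_congruent[OF f(1), of r] by (auto simp: Q_def t_def y_def)
  \<comment> \<open>\<open>f ^ Q - f\<close> is \<open>f\<close> times
    \<open>f ^ (Q - 1) - 1\<close>, which is a unit since \<open>f\<close> lies in the place; so a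
    statement about \<open>f ^ Q - f\<close> becomes one about \<open>f\<close>.\<close>
  have "f ^ Q = f * f ^ (Q - 1)" using Q2 by (simp flip: power_Suc)
  then have "f * ((f ^ (Q - 1) - 1) * u) = (f ^ Q - f) * u" by (simp add: algebra_simps)
  also have "\<dots> = t * (a * u) + y * u * b" unfolding ab by (simp add: algebra_simps)
  also have "\<dots> = t * (a * u + c * b)" unfolding c by (simp add: algebra_simps)
  finally have "f * ((f ^ (Q - 1) - 1) * u) = t * (a * u + c * b)" .
  moreover have "(f ^ (Q - 1) - 1) * u \<notin> place_of V"
  proof -
    have "f ^ (Q - 1) \<in> place_of V" using f Q2 by (intro V.place_power) auto
    then have "f ^ (Q - 1) - 1 \<notin> place_of V"
      using V.place_diff[of "f ^ (Q - 1)" "f ^ (Q - 1) - 1"] V.one_not_place by auto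
    moreover have "f ^ (Q - 1) - 1 \<in> V" "u \<in> V"
      using affine_R[OF V] uR R_diff R_power f R_1 by blast+
    ultimately show ?thesis using uP V.place_prime by blast
  qed
  ultimately show thesis
    using that[of "a * u + c * b" "(f ^ (Q - 1) - 1) * u"] ab c uR f
    by (auto simp: t_def Q_def intro: R_add R_mult R_diff R_power R_1)
qed

text \<open>The two terms have different pole orders at infinity.\<close>

lemma t_nonzero:
  assumes "0 < r"
  shows "w ^ CARD('k) ^ r - w \<noteq> 0"
proof
  assume "w ^ CARD('k) ^ r - w = 0"
  then have "inf.val (w ^ CARD('k) ^ r) = inf.val w" by simp
  then have "int (CARD('k) ^ r) * - int D = - int D"
    by (simp only: inf.val_power[OF w_nonzero] val_w)
  then have "int (CARD('k) ^ r) = 1" using D_pos by simp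
  then show False using card_power_ge[OF assms] by linarith
qed

text \<open>Factors \<open>t\<close> are split off as long as the cofactor lies in the place. This
  stops: by pigeonhole \<open>f\<close> divides some \<open>t ^ i - t ^ j\<close> with
  \<open>i < j\<close>, which is \<open>t ^ i\<close> times a local unit, so \<open>f\<close> cannot
  contain \<open>i + 1\<close> factors.\<close>

lemma affine_factorization:
  assumes V: "valuation_ring \<iota> V" "z \<in> V" and r: "period V r" and f: "f \<in> R" "f \<noteq> 0"
  obtains n a b where "a \<in> R" "a \<notin> place_of V" "b \<in> R" "b \<notin> place_of V"
    "f * b = (w ^ CARD('k) ^ r - w) ^ n * a"
proof (rule ccontr)
  assume no: "\<not> thesis"
  interpret V: valued_extension \<iota> V by unfold_locales (rule V)
  define t where "t = w ^ CARD('k) ^ r - w"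
  have tR: "t \<in> R" "t \<in> place_of V" "t \<noteq> 0"
    using r R_diff R_power R_w t_nonzero by (auto simp: t_def period_def)
  have RV: "x \<in> V" if "x \<in> R" for x using that affine_R[OF V] by blast
  have div: "\<exists>a\<in>R. \<exists>b\<in>R. b \<notin> place_of V \<and> f * b = t ^ n * a" for n
  proof (induction n)
    case 0
    show ?case using f R_1 V.one_not_place by (intro bexI[of _ f] bexI[of _ 1]) auto
  next
    case (Suc n)
    then obtain a b where ab: "a \<in> R" "b \<in> R" "b \<notin> place_of V" "f * b = t ^ n * a" by blast
    then have "a \<in> place_of V" using no that by (auto simp: t_def)
    then obtain a' b' where ab': "a' \<in> R" "b' \<in> R" "b' \<notin> place_of V" "a * b' = t * a'"
      using affine_local_generator[OF V r ab(1)] unfolding t_def by blast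
    have "f * (b * b') = t ^ n * (a * b')" using ab by (simp add: mult.assoc[symmetric])
    also have "\<dots> = t ^ Suc n * a'" unfolding ab' by simp
    finally have "f * (b * b') = t ^ Suc n * a'" .
    moreover have "b * b' \<in> R" "b * b' \<notin> place_of V"
      using ab ab' R_mult V.place_prime RV by blast+
    ultimately show ?case using ab' by blast
  qed
  obtain i j y where ij: "i < j" "y \<in> R" "t ^ i - t ^ j = f * y"
    using R_pigeonhole[OF f, of "\<lambda>i. t ^ i" "\<lambda>i. t ^ i"] R_power tR by metis
  obtain a b where ab: "a \<in> R" "b \<in> R" "b \<notin> place_of V" "f * b = t ^ Suc i * a"
    using div[of "Suc i"] by blast
  have "t ^ j = t ^ i * t ^ (j - i)" using ij(1) by (simp flip: power_add)
  then have "t ^ i * ((1 - t ^ (j - i)) * b) = (t ^ i - t ^ j) * b" by (simp add: algebra_simps)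
  also have "\<dots> = (f * b) * y" unfolding ij(3) by (simp add: mult_ac)
  also have "\<dots> = t ^ i * (t * (a * y))" using ab by (simp add: mult_ac)
  finally have eq: "(1 - t ^ (j - i)) * b = t * (a * y)" using tR by simp
  have tj: "t ^ (j - i) \<in> place_of V" using tR ij by (intro V.place_power) auto
  have "(1 - t ^ (j - i)) * b \<in> place_of V"
    unfolding eq using tR RV ab ij R_mult by (intro V.place_mult) auto
  moreover have "1 - t ^ (j - i) \<in> V" using RV tR R_diff R_1 R_power by blast
  ultimately have "1 - t ^ (j - i) \<in> place_of V" using V.place_prime RV ab by blast
  then show False using V.place_add[OF _ tj] V.one_not_place by fastforce
qed

lemma affine_quotient:
  assumes V: "valuation_ring \<iota> V" "z \<in> V" and r: "period V r" and x: "x \<noteq> 0"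
  obtains k a b where "a \<in> R" "a \<notin> place_of V" "b \<in> R" "b \<notin> place_of V"
    "x = (w ^ CARD('k) ^ r - w) powi k * (a / b)"
proof -
  interpret V: valued_extension \<iota> V by unfold_locales (rule V)
  define t where "t = w ^ CARD('k) ^ r - w"
  have t0: "t \<noteq> 0" using r t_nonzero by (auto simp: t_def period_def)
  obtain f g where fg: "f \<in> R" "g \<in> R" "g \<noteq> 0" "x = f / g" using fraction by blast
  have f0: "f \<noteq> 0" using fg x by auto
  obtain n a b where ab: "a \<in> R" "a \<notin> place_of V" "b \<in> R" "b \<notin> place_of V" "f * b = t ^ n * a"
    using affine_factorization[OF V r fg(1) f0] unfolding t_def .
  obtain m a' b' where ab': "a' \<in> R" "a' \<notin> place_of V" "b' \<in> R" "b' \<notin> place_of V" "g * b' = t ^ m * a'"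
    using affine_factorization[OF V r fg(2,3)] unfolding t_def .
  have nz: "b \<noteq> 0" "b' \<noteq> 0" "a' \<noteq> 0" using ab ab' V.zero_place by auto
  have "f = t ^ n * a / b" "g = t ^ m * a' / b'" using ab ab' nz by (simp_all add: field_simps)
  then have "x = (t ^ n / t ^ m) * ((a * b') / (b * a'))"
    using fg(4) by (simp add: mult_ac)
  also have "t ^ n / t ^ m = t powi (int n - int m)" using t0 by (simp add: power_int_diff)
  finally have "x = t powi (int n - int m) * ((a * b') / (b * a'))" .
  moreover have "a * b' \<notin> place_of V" "b * a' \<notin> place_of V"
    using ab ab' affine_R[OF V] V.place_prime by blast+
  ultimately show thesis using that[of "a * b'" "b * a'"] ab ab' R_mult unfolding t_def by blast
qed

lemma uniformizer_affine:
  assumes V: "valuation_ring \<iota> V" "z \<in> V" and r: "period V r"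
  shows "uniformizer V (w ^ CARD('k) ^ r - w)"
proof -
  interpret V: valued_extension \<iota> V by unfold_locales (rule V)
  have "\<exists>k u. u \<in> ring_units V \<and> x = (w ^ CARD('k) ^ r - w) powi k * u" if x: "x \<noteq> 0" for x
  proof -
    obtain k a b where ab: "a \<in> R" "a \<notin> place_of V" "b \<in> R" "b \<notin> place_of V"
      "x = (w ^ CARD('k) ^ r - w) powi k * (a / b)" using affine_quotient[OF V r x] .
    then have "a * inverse b \<in> ring_units V"
      using affine_R[OF V] V.not_place_unit V.unit_mult V.unit_inverse by blast
    then show ?thesis using ab(5) by (auto simp: divide_inverse)
  qed
  then show ?thesis using r t_nonzero by (auto simp: uniformizer_def period_def)
qed

section \<open>Affine valuation rings as localizations of \<open>R\<close>\<close>

lemma affine_mem_fraction: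
  assumes V: "valuation_ring \<iota> V" "z \<in> V" and x: "x \<in> V"
  obtains a b where "a \<in> R" "b \<in> R" "b \<notin> place_of V" "x = a / b"
proof (cases "x = 0")
  case True
  interpret V: valued_extension \<iota> V by unfold_locales (rule V)
  show thesis using that[of 0 1] R_0 R_1 V.one_not_place True by simp
next
  case False
  obtain r where r: "period V r" using period_exists[OF V] .
  define t where "t = w ^ CARD('k) ^ r - w"
  interpret V: discretely_valued_extension \<iota> V t
    unfolding t_def by unfold_locales (use V uniformizer_affine[OF V r] in auto)
  obtain k a b where ab: "a \<in> R" "a \<notin> place_of V" "b \<in> R" "b \<notin> place_of V"
    "x = t powi k * (a / b)" using affine_quotient[OF V r False] unfolding t_def .
  then have "a / b \<in> ring_units V"
    using affine_R[OF V] V.not_place_unit V.unit_mult V.unit_inverse unfolding divide_inverse by blast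
  then have "0 \<le> k" using V.powi_mult_unit_mem_iff x ab by blast
  then have "x = (t ^ nat k * a) / b" using ab by (simp add: power_int_def)
  moreover have "t ^ nat k * a \<in> R" using ab R_mult R_power R_diff R_w by (auto simp: t_def)
  ultimately show thesis using that ab by blast
qed

text \<open>So \<open>V\<close> is the localization of \<open>R\<close> at the prime
  \<open>R \<inter> place_of V\<close> and is determined by it.\<close>

lemma affine_mem_iff:
  assumes V: "valuation_ring \<iota> V" "z \<in> V"
  shows "x \<in> V \<longleftrightarrow> (\<exists>a\<in>R. \<exists>b\<in>R. b \<notin> place_of V \<and> x = a / b)"
proof
  interpret V: valued_extension \<iota> V by unfold_locales (rule V)
  assume "\<exists>a\<in>R. \<exists>b\<in>R. b \<notin> place_of V \<and> x = a / b"
  then show "x \<in> V"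
    using affine_R[OF V] V.not_place_unit V.unit_iff V.mult_mem by (auto simp: divide_inverse subset_iff)
qed (use affine_mem_fraction[OF V] in metis)

text \<open>Modulo the place \<open>b ^ (Q - 1)\<close> is \<open>1\<close>, so a denominator can be
  traded for a power: \<open>a / b\<close> is congruent to \<open>a * b ^ (Q - 2)\<close>, where
  \<open>Q - 2\<close> is the \<open>M\<close> of the proof.\<close>

lemma affine_residue:
  assumes V: "valuation_ring \<iota> V" "z \<in> V" and x: "x \<in> V"
  shows "\<exists>y\<in>R. x - y \<in> place_of V"
proof -
  interpret V: valued_extension \<iota> V by unfold_locales (rule V)
  obtain a b where ab: "a \<in> R" "b \<in> R" "b \<notin> place_of V" "x = a / b" using affine_mem_fraction[OF V x] .
  obtain r where r: "period V r" using period_exists[OF V] .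
  define Q where "Q = CARD('k) ^ r"
  have "2 \<le> Q" using r card_power_ge by (simp add: Q_def period_def)
  then obtain M where M: "Q = Suc (Suc M)" by (metis One_nat_def Suc_1 Suc_le_D Suc_le_mono)
  have bV: "b \<in> V" "b \<noteq> 0" using ab affine_R[OF V] V.zero_place by auto
  have "b * (b ^ Suc M - 1) \<in> place_of V"
    using power_card_place[OF V r ab(2)] by (simp add: M algebra_simps flip: Q_def)
  then have "b ^ Suc M - 1 \<in> place_of V"
    using V.place_prime bV ab V.diff_mem V.power_mem V.one_mem by blast
  then have "x * (b ^ Suc M - 1) \<in> place_of V" using x V.place_mult' by blast
  moreover have "x * (b ^ Suc M - 1) = a * b ^ M - x" using ab bV by (simp add: field_simps)
  ultimately have "x - a * b ^ M \<in> place_of V" using V.place_diff_sym by simp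
  then show ?thesis using ab R_mult R_power by blast
qed

lemma affine_residues_finite:
  assumes V: "valuation_ring \<iota> V" "z \<in> V"
  shows "\<exists>T. finite T \<and> T \<subseteq> R \<and> (\<forall>x\<in>V. \<exists>y\<in>T. x - y \<in> place_of V)"
proof -
  interpret V: valued_extension \<iota> V by unfold_locales (rule V)
  obtain f where f: "f \<in> R" "f \<noteq> 0" "f \<in> place_of V" using affine_nonzero_element[OF V] .
  let ?T = "RR (int (N * D) - inf.val f)"
  have "\<exists>y\<in>?T. x - y \<in> place_of V" if x: "x \<in> V" for x
  proof -
    obtain x' where x': "x' \<in> R" "x - x' \<in> place_of V" using affine_residue[OF V x] by blast
    obtain y where y: "y \<in> R" "x' - f * y \<in> ?T" using R_division[OF f(1,2) x'(1)] by blast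
    have "f * y \<in> place_of V" using f y affine_R[OF V] V.place_mult by blast
    then have "x - (x' - f * y) \<in> place_of V" using V.place_add[OF x'(2) \<open>f * y \<in> place_of V\<close>] by (simp add: algebra_simps)
    then show ?thesis using y by blast
  qed
  then show ?thesis using finite_RR by (intro exI[of _ ?T]) (auto simp: RR_def)
qed

text \<open>The inclusion of primes gives \<open>V' \<subseteq> V\<close> by localization, and a
  discrete valuation ring is maximal among proper subrings of the field.\<close>

lemma affine_eqI:
  assumes V: "valuation_ring \<iota> V" "z \<in> V" and V': "valuation_ring \<iota> V'" "z \<in> V'"
    and sub: "R \<inter> place_of V \<subseteq> place_of V'"
  shows "V = V'"
proof -
  interpret V: valued_extension \<iota> V by unfold_locales (rule V)
  interpret V': valued_extension \<iota> V' by unfold_locales (rule V')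
  have V'V: "V' \<subseteq> V" using sub affine_mem_iff[OF V] affine_mem_iff[OF V'] by blast
  obtain r where r: "period V' r" using period_exists[OF V'] .
  define t where "t = w ^ CARD('k) ^ r - w"
  interpret V': discretely_valued_extension \<iota> V' t
    unfolding t_def by unfold_locales (use V' uniformizer_affine[OF V' r] in auto)
  show ?thesis
  proof (rule ccontr)
    assume "V \<noteq> V'"
    then obtain x where x: "x \<in> V" "x \<notin> V'" using V'V by blast
    then have x0: "x \<noteq> 0" using V'.zero_mem by auto
    have "y \<in> V" for y
    proof (cases "y = 0")
      case False
      have vx: "V'.val x < 0" using V'.val_nonneg_iff[OF x0] x by simp
      \<comment> \<open>An \<open>x\<close> outside \<open>V'\<close> has value at most
        \<open>- 1\<close>, so \<open>x ^ n\<close> has at \<open>V'\<close> a pole at least as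
        large as that of \<open>y\<close>.\<close>
      define n where "n = nat \<bar>V'.val y\<bar>"
      have "V'.val (y * inverse (x ^ n)) = V'.val y - int n * V'.val x"
        using False x0 V'.val_mult V'.val_inverse V'.val_power by simp
      moreover have "int n * V'.val x \<le> int n * (- 1)" using vx by (intro mult_left_mono) auto
      ultimately have "0 \<le> V'.val (y * inverse (x ^ n))" by (simp add: n_def)
      then have "y * inverse (x ^ n) \<in> V" using V'.val_nonneg_iff False x0 V'V by auto
      then have "y * inverse (x ^ n) * x ^ n \<in> V" using x V.mult_mem V.power_mem by blast
      then show ?thesis using x0 by (simp add: mult.assoc)
    qed (simp add: V.zero_mem)
    then show False using V.not_UNIV by blast
  qed
qed

text \<open>If \<open>x\<close> were outside \<open>R\<close>, its denominators would form a proper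
  ideal, contained in some place; but at that place \<open>x\<close> is a fraction whose denominator
  lies outside it.\<close>

lemma R_eq_Inter:
  assumes "\<And>V. valuation_ring \<iota> V \<Longrightarrow> z \<in> V \<Longrightarrow> x \<in> V"
  shows "x \<in> R"
proof (rule ccontr)
  assume x: "x \<notin> R"
  define J where "J = {y \<in> R. y * x \<in> R}"
  have "ideal_of R J"
    using R_0 R_add R_mult by (auto simp: ideal_of_def J_def distrib_right mult.assoc)
  moreover have "1 \<notin> J" using x by (simp add: J_def)
  moreover have "J \<noteq> {0}"
  proof -
    obtain f g where "f \<in> R" "g \<in> R" "g \<noteq> 0" "x = f / g" using fraction by blast
    then have "g \<in> J" "g \<noteq> 0" by (auto simp: J_def)
    then show ?thesis by blast
  qed
  ultimately obtain V where V: "valuation_ring \<iota> V" "R \<subseteq> V" "J \<subseteq> place_of V"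
    using valuation_ring_exists[OF field_hom_axioms subring_R] R_const by blast
  then have zV: "z \<in> V" using R_z by blast
  obtain a b where ab: "a \<in> R" "b \<in> R" "b \<notin> place_of V" "x = a / b"
    using affine_mem_fraction[OF V(1) zV assms[OF V(1) zV]] .
  interpret V: valued_extension \<iota> V by unfold_locales (rule V)
  have "b \<noteq> 0" using ab V.zero_place by auto
  then have "b \<in> J" using ab by (simp add: J_def)
  then show False using V ab by blast
qed

end

section \<open>Residue class fields\<close>

context valued_extension
begin

text \<open>Representatives of the residue field. As \<open>K\<close> is finite, their number
  determines the degree of the place.\<close>

definition residue_system :: "'a set \<Rightarrow> bool" where
  "residue_system T \<longleftrightarrow> finite T \<and> T \<subseteq> V \<and> (\<forall>x\<in>V. \<exists>y\<in>T. x - y \<in> place_of V) \<and>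
     (\<forall>x\<in>T. \<forall>y\<in>T. x - y \<in> place_of V \<longrightarrow> x = y)"

lemma residue_system_subset:
  assumes "finite T" "T \<subseteq> V" "\<And>x. x \<in> V \<Longrightarrow> \<exists>y\<in>T. x - y \<in> place_of V"
  obtains T' where "T' \<subseteq> T" "residue_system T'"
proof -
  \<comment> \<open>Congruent elements lead to the same predicate and hence to the same choice, so
    the image of \<open>\<rho>\<close> contains one element of each class.\<close>
  define \<rho> where "\<rho> x = (SOME y. y \<in> T \<and> x - y \<in> place_of V)" for x
  have \<rho>: "\<rho> x \<in> T \<and> x - \<rho> x \<in> place_of V" if "x \<in> V" for x
    using someI_ex[of "\<lambda>y. y \<in> T \<and> x - y \<in> place_of V"] assms(3)[OF that] by (auto simp: \<rho>_def)
  have eq: "\<rho> x = \<rho> y" if "x - y \<in> place_of V" for x y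
  proof -
    have "x - u \<in> place_of V \<longleftrightarrow> y - u \<in> place_of V" for u
      using that place_diff_trans place_diff_sym by blast
    then show ?thesis by (simp add: \<rho>_def)
  qed
  have sub: "\<rho> ` V \<subseteq> T" using \<rho> by blast
  moreover have "residue_system (\<rho> ` V)"
    unfolding residue_system_def
  proof (intro conjI ballI impI)
    show "finite (\<rho> ` V)" "\<rho> ` V \<subseteq> V" using sub assms finite_subset by auto
    show "\<exists>y\<in>\<rho> ` V. x - y \<in> place_of V" if "x \<in> V" for x using \<rho>[OF that] that by blast
    fix x y assume "x \<in> \<rho> ` V" "y \<in> \<rho> ` V" and xy: "x - y \<in> place_of V"
    then obtain a b where ab: "a \<in> V" "b \<in> V" "x = \<rho> a" "y = \<rho> b" by blast
    have "a - b \<in> place_of V"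
      using \<rho>[OF ab(1)] \<rho>[OF ab(2)] xy place_diff_trans place_diff_sym unfolding ab(3,4) by meson
    then show "x = y" using eq ab by simp
  qed
  ultimately show thesis using that by blast
qed

lemma residue_system_card_le:
  assumes "residue_system T" "residue_system T'"
  shows "card T \<le> card T'"
proof -
  have "\<forall>x. \<exists>y. x \<in> T \<longrightarrow> y \<in> T' \<and> x - y \<in> place_of V" using assms by (auto simp: residue_system_def)
  then obtain \<phi> where \<phi>: "\<And>x. x \<in> T \<Longrightarrow> \<phi> x \<in> T' \<and> x - \<phi> x \<in> place_of V" by metis
  have "inj_on \<phi> T"
  proof (rule inj_onI)
    fix x y assume "x \<in> T" "y \<in> T" "\<phi> x = \<phi> y"
    then have "x - y \<in> place_of V" using \<phi> place_diff_trans place_diff_sym by metis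
    then show "x = y" using assms \<open>x \<in> T\<close> \<open>y \<in> T\<close> by (auto simp: residue_system_def)
  qed
  then show ?thesis
    using \<phi> assms by (intro card_inj_on_le[of \<phi>]) (auto simp: residue_system_def)
qed

lemma residue_system_card_eq: "residue_system T \<Longrightarrow> residue_system T' \<Longrightarrow> card T = card T'"
  by (simp add: residue_system_card_le le_antisym)

lemma lincomb_mem: "B \<subseteq> V \<Longrightarrow> (\<Sum>b\<in>B. \<iota> (c b) * b) \<in> V"
  by (intro sum_mem mult_mem const_mem) auto

lemma residue_system_of_basis:
  assumes fin: "finite (UNIV :: 'k set)" and B: "residue_basis \<iota> (place_of V) B"
  shows "\<exists>T. residue_system T \<and> card T = CARD('k) ^ card B"
proof -
  have B': "finite B" "B \<subseteq> V"
    and ex: "\<And>x. x \<in> V \<Longrightarrow> \<exists>!c. (\<forall>b. b \<notin> B \<longrightarrow> c b = 0) \<and> x - (\<Sum>b\<in>B. \<iota> (c b) * b) \<in> place_of V"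
    using B unfolding residue_basis_def place_ring_place_of by auto
  let ?C = "B \<rightarrow>\<^sub>E (UNIV :: 'k set)"
  define F where "F c = (\<Sum>b\<in>B. \<iota> (c b) * b)" for c
  have FV: "F c \<in> V" for c using B' lincomb_mem by (simp add: F_def)
  have inj: "c = d" if cd: "c \<in> ?C" "d \<in> ?C" "F c - F d \<in> place_of V" for c d
  proof -
    \<comment> \<open>Functions in \<open>PiE\<close> are \<open>undefined\<close> outside
      \<open>B\<close>, whereas \<open>residue_basis\<close> wants coefficients that vanish there;
      \<open>ext\<close> translates.\<close>
    define ext where "ext c = (\<lambda>b. if b \<in> B then c b else 0 :: 'k)" for c
    have F: "F (ext c) = F c" for c unfolding F_def by (intro sum.cong) (auto simp: ext_def)
    have "F c - F (ext c) \<in> place_of V" "F c - F (ext d) \<in> place_of V"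
      using cd zero_place by (simp_all add: F)
    moreover have "\<forall>b. b \<notin> B \<longrightarrow> ext c b = 0" for c by (simp add: ext_def)
    ultimately have "ext c = ext d" using ex[OF FV[of c]] unfolding F_def by blast
    then have "c b = d b" if "b \<in> B" for b using that by (metis ext_def)
    then show "c = d" using cd by (intro PiE_ext) auto
  qed
  have "residue_system (F ` ?C)"
    unfolding residue_system_def
  proof (intro conjI ballI impI)
    show "finite (F ` ?C)" using B' fin by (intro finite_imageI finite_PiE) auto
    show "F ` ?C \<subseteq> V" using FV by blast
    fix x assume "x \<in> V"
    then obtain c where c: "x - F c \<in> place_of V" using ex[of x] unfolding F_def by blast
    have "F (restrict c B) = F c" unfolding F_def by (intro sum.cong) auto
    moreover have "restrict c B \<in> ?C" by auto
    ultimately have "F c \<in> F ` ?C" by (metis imageI)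
    then show "\<exists>y\<in>F ` ?C. x - y \<in> place_of V" using c by blast
  next
    fix x y assume "x \<in> F ` ?C" "y \<in> F ` ?C" "x - y \<in> place_of V"
    then show "x = y" using inj by blast
  qed
  moreover have "inj_on F ?C" using inj zero_place by (intro inj_onI) (metis diff_self)
  then have "card (F ` ?C) = CARD('k) ^ card B" using B' by (simp add: card_image card_PiE)
  ultimately show ?thesis by blast
qed

definition residue_independent :: "'a set \<Rightarrow> bool" where
  "residue_independent B \<longleftrightarrow> finite B \<and> B \<subseteq> V \<and>
     (\<forall>c. (\<forall>b. b \<notin> B \<longrightarrow> c b = 0) \<longrightarrow> (\<Sum>b\<in>B. \<iota> (c b) * b) \<in> place_of V \<longrightarrow> (\<forall>b. c b = 0))"

text \<open>Two congruent members \<open>x\<close>, \<open>y\<close> would give the nontrivial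
  relation \<open>x - y\<close>, so an independent set meets each class at most once.\<close>

lemma residue_independent_card_le:
  assumes "residue_independent B" "residue_system T"
  shows "card B \<le> card T"
proof -
  have "\<forall>x. \<exists>y. x \<in> B \<longrightarrow> y \<in> T \<and> x - y \<in> place_of V"
    using assms by (auto simp: residue_system_def residue_independent_def)
  then obtain \<phi> where \<phi>: "\<And>x. x \<in> B \<Longrightarrow> \<phi> x \<in> T \<and> x - \<phi> x \<in> place_of V" by metis
  have "inj_on \<phi> B"
  proof (rule inj_onI, rule ccontr)
    fix x y assume xy: "x \<in> B" "y \<in> B" "\<phi> x = \<phi> y" "x \<noteq> y"
    then have P: "x - y \<in> place_of V" using \<phi> place_diff_trans place_diff_sym by metis
    define c :: "'a \<Rightarrow> 'k" where "c b = of_bool (b = x) - of_bool (b = y)" for b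
    have fB: "finite B" using assms by (auto simp: residue_independent_def)
    have "(\<Sum>b\<in>B. \<iota> (c b) * b) = (\<Sum>b\<in>B. (if b = x then b else 0) - (if b = y then b else 0))"
      by (intro sum.cong) (auto simp: c_def hom_distribs)
    also have "\<dots> = x - y" using xy fB by (simp add: sum_subtractf)
    finally have "(\<Sum>b\<in>B. \<iota> (c b) * b) \<in> place_of V" using P by simp
    moreover have "\<forall>b. b \<notin> B \<longrightarrow> c b = 0" using xy by (auto simp: c_def)
    ultimately have "c x = 0" using assms(1) unfolding residue_independent_def by blast
    then show False using xy by (simp add: c_def)
  qed
  then show ?thesis
    using \<phi> assms by (intro card_inj_on_le[of \<phi>]) (auto simp: residue_system_def)
qed

text \<open>Independent sets are bounded in size by the number of classes, so a largest one exists.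
  It spans: a further element \<open>x\<close> satisfies a relation in which its own coefficient is
  nonzero.\<close>

lemma residue_basis_exists:
  assumes T: "residue_system T"
  shows "\<exists>B. residue_basis \<iota> (place_of V) B"
proof -
  have empty: "residue_independent {}" by (auto simp: residue_independent_def)
  have bound: "\<forall>B. residue_independent B \<longrightarrow> card B < Suc (card T)"
    using residue_independent_card_le T by (simp add: less_Suc_eq_le)
  obtain B where B: "residue_independent B"
    and max: "\<And>B'. residue_independent B' \<Longrightarrow> card B' \<le> card B"
    using ex_has_greatest_nat[where P = residue_independent and f = card, OF empty bound] by metis
  have fB: "finite B" "B \<subseteq> V"
    and ind: "\<And>c. (\<forall>b. b \<notin> B \<longrightarrow> c b = 0) \<Longrightarrow> (\<Sum>b\<in>B. \<iota> (c b) * b) \<in> place_of V \<Longrightarrow> (\<forall>b. c b = 0)"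
    using B unfolding residue_independent_def by blast+
  have span: "\<exists>c. (\<forall>b. b \<notin> B \<longrightarrow> c b = 0) \<and> x - (\<Sum>b\<in>B. \<iota> (c b) * b) \<in> place_of V" if x: "x \<in> V" for x
  proof (cases "x \<in> B")
    case True
    have "(\<Sum>b\<in>B. \<iota> (of_bool (b = x)) * b) = (\<Sum>b\<in>B. if b = x then b else 0)"
      by (intro sum.cong) auto
    then have "(\<Sum>b\<in>B. \<iota> (of_bool (b = x)) * b) = x" using True fB by simp
    then show ?thesis using True zero_place by (intro exI[of _ "\<lambda>b. of_bool (b = x)"]) auto
  next
    case False
    then have "card (insert x B) = Suc (card B)" using fB by simp
    then have "\<not> residue_independent (insert x B)" using max by fastforce
    then obtain c where c: "\<forall>b. b \<notin> insert x B \<longrightarrow> c b = 0"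
      "(\<Sum>b\<in>insert x B. \<iota> (c b) * b) \<in> place_of V" "\<not> (\<forall>b. c b = 0)"
      using fB x unfolding residue_independent_def by auto
    have s: "\<iota> (c x) * x + (\<Sum>b\<in>B. \<iota> (c b) * b) \<in> place_of V" using c(2) False fB by simp
    have cx: "c x \<noteq> 0"
    proof
      assume cx: "c x = 0"
      then have "\<forall>b. b \<notin> B \<longrightarrow> c b = 0" using c(1) by auto
      then show False using ind[of c] s cx c(3) by simp
    qed
    define d where "d b = (if b \<in> B then - (c b / c x) else 0)" for b
    have "x - (\<Sum>b\<in>B. \<iota> (d b) * b) = inverse (\<iota> (c x)) * (\<iota> (c x) * x + (\<Sum>b\<in>B. \<iota> (c b) * b))"
    proof -
      have "(\<Sum>b\<in>B. \<iota> (d b) * b) = (\<Sum>b\<in>B. - (inverse (\<iota> (c x)) * (\<iota> (c b) * b)))"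
        by (intro sum.cong) (auto simp: d_def hom_distribs divide_inverse)
      then show ?thesis using cx by (simp add: distrib_left sum_negf sum_distrib_left flip: mult.assoc)
    qed
    also have "\<dots> \<in> place_of V"
      using s place_mult' const_unit[OF cx] unit_iff by blast
    finally show ?thesis by (intro exI[of _ d]) (auto simp: d_def)
  qed
  have "residue_basis \<iota> (place_of V) B"
    unfolding residue_basis_def place_ring_place_of
  proof (intro conjI ballI)
    fix x assume "x \<in> V"
    show "\<exists>!c. (\<forall>b. b \<notin> B \<longrightarrow> c b = 0) \<and> x - (\<Sum>b\<in>B. \<iota> (c b) * b) \<in> place_of V"
    proof (rule ex_ex1I)
      show "\<exists>c. (\<forall>b. b \<notin> B \<longrightarrow> c b = 0) \<and> x - (\<Sum>b\<in>B. \<iota> (c b) * b) \<in> place_of V"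
        using span \<open>x \<in> V\<close> .
      fix c d :: "'a \<Rightarrow> 'k"
      assume c: "(\<forall>b. b \<notin> B \<longrightarrow> c b = 0) \<and> x - (\<Sum>b\<in>B. \<iota> (c b) * b) \<in> place_of V"
        and d: "(\<forall>b. b \<notin> B \<longrightarrow> d b = 0) \<and> x - (\<Sum>b\<in>B. \<iota> (d b) * b) \<in> place_of V"
      have "\<iota> (d b - c b) * b = \<iota> (d b) * b - \<iota> (c b) * b" for b
        by (simp add: hom_distribs left_diff_distrib)
      then have "(\<Sum>b\<in>B. \<iota> (d b - c b) * b) = (x - (\<Sum>b\<in>B. \<iota> (c b) * b)) - (x - (\<Sum>b\<in>B. \<iota> (d b) * b))"
        by (simp add: sum_subtractf)
      then have "(\<Sum>b\<in>B. \<iota> (d b - c b) * b) \<in> place_of V"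
        using place_diff[OF conjunct2[OF c] conjunct2[OF d]] by simp
      then have "\<forall>b. d b - c b = 0" using c d by (intro ind) auto
      then show "c = d" by (intro ext) (metis right_minus_eq)
    qed
  qed (use fB in auto)
  then show ?thesis by blast
qed

text \<open>Every basis with \<open>d\<close> elements yields \<open>CARD('k) ^ d\<close> classes,
  and \<open>CARD('k)\<close> is at least two; this also justifies the \<open>THE\<close> in
  \<open>place_degree\<close>.\<close>

lemma place_degree_residue_system:
  assumes fin: "finite (UNIV :: 'k set)" and T: "residue_system T"
  shows "card T = CARD('k) ^ place_degree \<iota> (place_of V)"
proof -
  have "card {0, 1 :: 'k} \<le> CARD('k)" using fin by (intro card_mono) auto
  then have two: "2 \<le> CARD('k)" by simp
  have cardB: "card T = CARD('k) ^ card B" if "residue_basis \<iota> (place_of V) B" for B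
    using residue_system_of_basis[OF fin that] T residue_system_card_eq by metis
  obtain B where B: "residue_basis \<iota> (place_of V) B" using residue_basis_exists[OF T] by blast
  have "place_degree \<iota> (place_of V) = card B"
    unfolding place_degree_def
  proof (rule the_equality)
    fix d assume "\<exists>B. residue_basis \<iota> (place_of V) B \<and> card B = d"
    then have "CARD('k) ^ d = CARD('k) ^ card B" using cardB B by metis
    then show "d = card B" using two by simp
  qed (use B in blast)
  then show ?thesis using cardB[OF B] by simp
qed

lemma place_degree_pos:
  assumes fin: "finite (UNIV :: 'k set)" and T: "residue_system T"
  shows "0 < place_degree \<iota> (place_of V)"
proof (rule ccontr)
  assume "\<not> ?thesis"
  then have "card T = 1" using place_degree_residue_system[OF assms] by simp
  then obtain y where "T = {y}" by (auto simp: card_1_singleton_iff)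
  then have "0 - y \<in> place_of V" "1 - y \<in> place_of V"
    using T zero_mem one_mem unfolding residue_system_def by blast+
  then show False using place_diff[of "1 - y" "0 - y"] one_not_place by simp
qed

text \<open>In degree one there are as many classes as constants, and distinct constants are
  incongruent, so they represent all classes.\<close>

lemma place_degree_one_iff:
  assumes fin: "finite (UNIV :: 'k set)" and T: "residue_system T"
  shows "place_degree \<iota> (place_of V) = 1 \<longleftrightarrow> (\<forall>x\<in>V. \<exists>c. x - \<iota> c \<in> place_of V)"
proof -
  have "card {0, 1 :: 'k} \<le> CARD('k)" using fin by (intro card_mono) auto
  then have two: "2 \<le> CARD('k)" by simp
  have inj: "inj \<iota>" using eq_iff by (auto intro: injI)
  have const: "c = d" if "\<iota> c - \<iota> d \<in> place_of V" for c d
    using that const_place_iff[of "c - d"] by (simp add: hom_distribs)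
  show ?thesis
  proof
    assume "\<forall>x\<in>V. \<exists>c. x - \<iota> c \<in> place_of V"
    then have "residue_system (range \<iota>)"
      using fin const_mem const by (auto simp: residue_system_def)
    then have "CARD('k) ^ place_degree \<iota> (place_of V) = CARD('k) ^ 1"
      using place_degree_residue_system[OF fin] card_image[OF inj] by simp
    then show "place_degree \<iota> (place_of V) = 1" using two by (simp only: power_inject_exp)
  next
    assume "place_degree \<iota> (place_of V) = 1"
    then have card: "card T = CARD('k)" using place_degree_residue_system[OF assms] by simp
    have "\<forall>c. \<exists>y. y \<in> T \<and> \<iota> c - y \<in> place_of V" using T const_mem by (auto simp: residue_system_def)
    then obtain \<phi> where \<phi>: "\<And>c. \<phi> c \<in> T \<and> \<iota> c - \<phi> c \<in> place_of V" by metis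
    have "inj \<phi>"
    proof (rule injI)
      fix c d assume "\<phi> c = \<phi> d"
      then have "\<iota> c - \<phi> d \<in> place_of V" using \<phi>[of c] by simp
      then show "c = d" using const place_diff_trans place_diff_sym[of "\<iota> d" "\<phi> d"] \<phi>[of d] by blast
    qed
    then have "card (range \<phi>) = card T" using card card_image by metis
    then have "range \<phi> = T" using \<phi> T by (intro card_subset_eq) (auto simp: residue_system_def)
    show "\<forall>x\<in>V. \<exists>c. x - \<iota> c \<in> place_of V"
    proof
      fix x assume "x \<in> V"
      then obtain c where "x - \<phi> c \<in> place_of V"
        using T \<open>range \<phi> = T\<close> unfolding residue_system_def by blast
      then show "\<exists>c. x - \<iota> c \<in> place_of V"
        using place_diff_trans place_diff_sym[of "\<iota> c" "\<phi> c"] \<phi>[of c] by blast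
    qed
  qed
qed

end

text \<open>The bridge from \<open>divisor_dim\<close> to counting: coordinates with respect to a
  basis enumerate the subspace.\<close>

lemma card_finite_subspace:
  fixes scale :: "'k::field \<Rightarrow> 'a::ab_group_add \<Rightarrow> 'a"
  assumes vs: "vector_space scale" and sub: "module.subspace scale W" and fin: "finite W" "finite (UNIV :: 'k set)"
  shows "card W = CARD('k) ^ vector_space.dim scale W"
proof -
  interpret vector_space scale by fact
  obtain B where B: "B \<subseteq> W" "independent B" "W \<subseteq> span B" "card B = dim W" using basis_exists .
  have finB: "finite B" using B fin finite_subset by blast
  have W: "W = span B" using B sub by (simp add: span_subspace)
  define F where "F c = (\<Sum>b\<in>B. scale (c b) b)" for c
  have "inj_on F (B \<rightarrow>\<^sub>E UNIV)"
  proof (rule inj_onI)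
    fix c d assume cd: "c \<in> B \<rightarrow>\<^sub>E UNIV" "d \<in> B \<rightarrow>\<^sub>E UNIV" "F c = F d"
    then have "(\<Sum>b\<in>B. scale (c b - d b) b) = 0"
      by (simp add: F_def scale_left_diff_distrib sum_subtractf)
    then have "c b - d b = 0" if "b \<in> B" for b
      using independentD[OF B(2) finB order_refl, of "\<lambda>b. c b - d b"] that by blast
    then show "c = d" using cd by (intro PiE_ext) auto
  qed
  moreover have "F ` (B \<rightarrow>\<^sub>E UNIV) = W"
  proof -
    have "F c \<in> F ` (B \<rightarrow>\<^sub>E UNIV)" for c
    proof -
      have "F (restrict c B) = F c" unfolding F_def by (intro sum.cong) auto
      moreover have "restrict c B \<in> B \<rightarrow>\<^sub>E UNIV" by auto
      ultimately show ?thesis by (metis imageI)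
    qed
    then show ?thesis unfolding W span_finite[OF finB] F_def[symmetric] by blast
  qed
  ultimately have "card W = card (B \<rightarrow>\<^sub>E (UNIV :: 'k set))" by (metis card_image)
  then show ?thesis using finB B by (simp add: card_PiE)
qed

lemma is_subfield_generated: "is_subfield (generated_subfield X)"
  unfolding is_subfield_def generated_subfield_def by auto

lemma generated_subfield_superset: "X \<subseteq> generated_subfield X"
  unfolding generated_subfield_def by auto

context additive_kummer
begin

section \<open>Places, degrees and divisors\<close>

definition Pinf :: "'a set" where "Pinf = place_of Vinf"

lemma place_ring_valuation:
  assumes "P \<in> places \<iota>"
  shows "valuation_ring \<iota> (place_ring P)" and "place_of (place_ring P) = P"
proof -
  obtain V where V: "valuation_ring \<iota> V" "P = place_of V" using assms by (auto simp: places_eq)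
  interpret V: valued_extension \<iota> V by unfold_locales (rule V)
  show "valuation_ring \<iota> (place_ring P)" "place_of (place_ring P) = P"
    using V V.place_ring_place_of by auto
qed

lemma place_of_places: "valuation_ring \<iota> V \<Longrightarrow> place_of V \<in> places \<iota>"
  by (auto simp: places_eq)

lemma Pinf_places: "Pinf \<in> places \<iota>"
  unfolding Pinf_def by (rule place_of_places[OF valuation_ring_Vinf])

lemma place_ring_Pinf: "place_ring Pinf = Vinf"
  unfolding Pinf_def by (rule inf.place_ring_place_of)

lemma affine_place_iff: "P \<in> places \<iota> \<Longrightarrow> z \<in> place_ring P \<longleftrightarrow> P \<noteq> Pinf"
  using place_ring_valuation Vinf_eq z_not_Vinf place_ring_Pinf Pinf_def by metis

lemma uniformizer_exists:
  assumes "P \<in> places \<iota>"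
  shows "\<exists>t. uniformizer (place_ring P) t"
proof (cases "P = Pinf")
  case True
  then show ?thesis using uniformizer_tau place_ring_Pinf by auto
next
  case False
  then have "z \<in> place_ring P" using affine_place_iff assms by blast
  then show ?thesis
    using place_ring_valuation[OF assms] period_exists uniformizer_affine by metis
qed

definition unif :: "'a set \<Rightarrow> 'a" where
  "unif P = (SOME t. uniformizer (place_ring P) t)"

lemma discrete_place:
  assumes "P \<in> places \<iota>"
  shows "discretely_valued_extension \<iota> (place_ring P) (unif P)"
proof -
  have "uniformizer (place_ring P) (unif P)"
    unfolding unif_def using uniformizer_exists[OF assms] by (rule someI_ex)
  then show ?thesis
    using place_ring_valuation[OF assms] by unfold_locales auto
qed

text \<open>Representatives are taken from \<open>R\<close> so that the combinations formed in
  \<open>sum_deg_zeros_tq\<close> stay regular at all affine places. At infinity the constants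
  serve.\<close>

lemma residue_system_R_exists:
  assumes "P \<in> places \<iota>"
  obtains T where "T \<subseteq> R" "valued_extension.residue_system (place_ring P) T"
proof -
  interpret V: discretely_valued_extension \<iota> "place_ring P" "unif P" using discrete_place[OF assms] .
  have "\<exists>T0. finite T0 \<and> T0 \<subseteq> R \<and> T0 \<subseteq> place_ring P \<and>
    (\<forall>x\<in>place_ring P. \<exists>y\<in>T0. x - y \<in> place_of (place_ring P))"
  proof (cases "P = Pinf")
    case True
    show ?thesis
      using residue_Vinf finite_const R_const V.const_mem unfolding True place_ring_Pinf
      by (intro exI[of _ "range \<iota>"]) (auto simp: inf.const_mem)
  next
    case False
    then have z: "z \<in> place_ring P" using affine_place_iff assms by blast
    show ?thesis
      using affine_residues_finite[OF V.valuation_ring z] affine_R[OF V.valuation_ring z] by blast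
  qed
  then show thesis using V.residue_system_subset that by (metis subset_trans)
qed

abbreviation pdeg :: "'a set \<Rightarrow> nat" where "pdeg \<equiv> place_degree \<iota>"

lemma residue_system_card:
  assumes "P \<in> places \<iota>" "valued_extension.residue_system (place_ring P) T"
  shows "card T = CARD('k) ^ pdeg P"
proof -
  interpret V: discretely_valued_extension \<iota> "place_ring P" "unif P" using discrete_place[OF assms(1)] .
  show ?thesis
    using V.place_degree_residue_system[OF finite_const assms(2)] place_ring_valuation[OF assms(1)] by simp
qed

lemma deg_pos:
  assumes "P \<in> places \<iota>"
  shows "0 < pdeg P"
proof -
  interpret V: discretely_valued_extension \<iota> "place_ring P" "unif P" using discrete_place[OF assms] .
  obtain T where "V.residue_system T" using residue_system_R_exists[OF assms] .
  then show ?thesis using V.place_degree_pos[OF finite_const] place_ring_valuation[OF assms] by simp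
qed

lemma deg_one_iff:
  assumes "P \<in> places \<iota>"
  shows "pdeg P = 1 \<longleftrightarrow> (\<forall>x\<in>place_ring P. \<exists>c. x - \<iota> c \<in> P)"
proof -
  interpret V: discretely_valued_extension \<iota> "place_ring P" "unif P" using discrete_place[OF assms] .
  obtain T where "V.residue_system T" using residue_system_R_exists[OF assms] .
  then show ?thesis using V.place_degree_one_iff[OF finite_const] place_ring_valuation[OF assms] by simp
qed

lemma deg_Pinf: "pdeg Pinf = 1"
  using deg_one_iff[OF Pinf_places] residue_Vinf by (simp add: place_ring_Pinf flip: Pinf_def)

abbreviation L :: "('a set \<Rightarrow> int) \<Rightarrow> 'a set" where "L \<equiv> riemann_roch_space \<iota>"

text \<open>The membership form covers \<open>x = 0\<close>, where \<open>place_val\<close> has no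
  meaning, and so reduces closure properties of \<open>L A\<close> to those of rings.\<close>

lemma place_val_ge_iff:
  assumes "P \<in> places \<iota>"
  shows "x = 0 \<or> k \<le> place_val P x \<longleftrightarrow> x * unif P powi (- k) \<in> place_ring P"
proof -
  interpret V: discretely_valued_extension \<iota> "place_ring P" "unif P" using discrete_place[OF assms] .
  show ?thesis
    using V.val_ge_iff[of x k] V.zero_mem place_ring_valuation[OF assms] by (cases "x = 0") auto
qed

lemma L_iff: "x \<in> L A \<longleftrightarrow> (\<forall>P\<in>places \<iota>. x * unif P powi A P \<in> place_ring P)"
proof -
  have "x \<in> L A \<longleftrightarrow> (\<forall>P\<in>places \<iota>. x = 0 \<or> - A P \<le> place_val P x)"
    using Pinf_places by (auto simp: riemann_roch_space_def)
  also have "\<dots> \<longleftrightarrow> (\<forall>P\<in>places \<iota>. x * unif P powi A P \<in> place_ring P)"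
  proof (rule ball_cong[OF refl])
    fix P assume "P \<in> places \<iota>"
    then show "(x = 0 \<or> - A P \<le> place_val P x) = (x * unif P powi A P \<in> place_ring P)"
      using place_val_ge_iff[of P x "- A P"] by simp
  qed
  finally show ?thesis .
qed

lemma L_diff: "x \<in> L A \<Longrightarrow> y \<in> L A \<Longrightarrow> x - y \<in> L A"
  and L_add: "x \<in> L A \<Longrightarrow> y \<in> L A \<Longrightarrow> x + y \<in> L A"
  and L_scale: "x \<in> L A \<Longrightarrow> \<iota> c * x \<in> L A"
proof -
  have D: "valued_extension \<iota> (place_ring P)" if "P \<in> places \<iota>" for P
    using discrete_place[OF that] by (simp add: discretely_valued_extension_def)
  show "x - y \<in> L A" if "x \<in> L A" "y \<in> L A"
    using that valued_extension.diff_mem[OF D] by (auto simp: L_iff left_diff_distrib)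
  show "x + y \<in> L A" if "x \<in> L A" "y \<in> L A"
    using that valued_extension.add_mem[OF D] by (auto simp: L_iff distrib_right)
  show "\<iota> c * x \<in> L A" if "x \<in> L A"
    using that valued_extension.mult_mem[OF D] valued_extension.const_mem[OF D]
    by (auto simp: L_iff mult.assoc)
qed

lemma L_subspace: "module.subspace (\<lambda>c x. \<iota> c * x) (L A)"
proof -
  interpret vs: vector_space "\<lambda>c x. \<iota> c * x" by (rule vector_space_field_hom[OF field_hom_axioms])
  show ?thesis
    by (rule vs.subspaceI) (auto simp: L_add L_scale, simp add: riemann_roch_space_def)
qed

lemma card_L: "finite (L A) \<Longrightarrow> card (L A) = CARD('k) ^ divisor_dim \<iota> A"
  unfolding divisor_dim_def
  by (rule card_finite_subspace[OF vector_space_field_hom[OF field_hom_axioms] L_subspace _ finite_const])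

lemma L_mono: "(\<And>P. P \<in> places \<iota> \<Longrightarrow> A P \<le> B P) \<Longrightarrow> L A \<subseteq> L B"
  unfolding riemann_roch_space_def by fastforce

text \<open>Scaled by \<open>unif P powi (A P + 1)\<close>, the functions of the larger space have
  residues at \<open>P\<close>, and two with the same residue differ by an element of
  \<open>L A\<close>. The number of residues is the extra factor.\<close>

lemma L_step:
  assumes P: "P \<in> places \<iota>" and fin: "finite (L A)"
  shows "finite (L (A(P := A P + 1)))" and "card (L (A(P := A P + 1))) \<le> card (L A) * CARD('k) ^ pdeg P"
proof -
  let ?A = "A(P := A P + 1)"
  interpret V: discretely_valued_extension \<iota> "place_ring P" "unif P" using discrete_place[OF P] .
  have PV: "place_of (place_ring P) = P" using place_ring_valuation[OF P] by simp
  obtain T where T: "V.residue_system T" using residue_system_R_exists[OF P] .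
  then have finT: "finite T" by (simp add: V.residue_system_def)
  define F where "F y = {x \<in> L ?A. x * unif P powi (A P + 1) - y \<in> P}" for y
  have cover: "L ?A = (\<Union>y\<in>T. F y)"
  proof
    show "L ?A \<subseteq> (\<Union>y\<in>T. F y)"
    proof
      fix x assume x: "x \<in> L ?A"
      then have "x * unif P powi (A P + 1) \<in> place_ring P" using P by (auto simp: L_iff dest!: bspec[of _ _ P])
      then obtain y where "y \<in> T" "x * unif P powi (A P + 1) - y \<in> P"
        using T unfolding V.residue_system_def PV by blast
      then show "x \<in> (\<Union>y\<in>T. F y)" using x by (auto simp: F_def)
    qed
  qed (auto simp: F_def)
  have diff: "x - x' \<in> L A" if "x \<in> F y" "x' \<in> F y" for x x' y
    unfolding L_iff
  proof
    fix P' assume P': "P' \<in> places \<iota>"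
    have d: "x - x' \<in> L ?A" using that L_diff by (auto simp: F_def)
    show "(x - x') * unif P' powi A P' \<in> place_ring P'"
    proof (cases "P' = P")
      case True
      have "(x - x') * unif P powi (A P + 1) =
          (x * unif P powi (A P + 1) - y) - (x' * unif P powi (A P + 1) - y)"
        by (simp add: left_diff_distrib)
      also have "\<dots> \<in> P" using that V.place_diff unfolding F_def PV by blast
      finally obtain u where u: "u \<in> place_ring P" "(x - x') * unif P powi (A P + 1) = unif P * u"
        using V.prime_element_uniformizer unfolding prime_element_def PV V.place_ring_place_of by blast
      then have "(x - x') * unif P powi A P = u"
        using V.t_nonzero by (simp add: power_int_add mult.left_commute)
      then show ?thesis using u True by simp
    next
      case False
      then show ?thesis using d P' unfolding L_iff by (metis fun_upd_apply)
    qed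
  qed
  have fib: "finite (F y) \<and> card (F y) \<le> card (L A)" for y
  proof (cases "F y = {}")
    case False
    then obtain x0 where x0: "x0 \<in> F y" by blast
    have inj: "inj_on (\<lambda>x. x - x0) (F y)" by (auto intro: inj_onI)
    have sub: "(\<lambda>x. x - x0) ` F y \<subseteq> L A" using diff x0 by blast
    show ?thesis
      using inj_on_finite[OF inj sub fin] card_inj_on_le[OF inj sub fin] by simp
  qed simp
  show "finite (L ?A)" unfolding cover using finT fib by blast
  have "card (L ?A) \<le> (\<Sum>y\<in>T. card (F y))" unfolding cover by (rule card_UN_le[OF finT])
  also have "\<dots> \<le> card T * card (L A)" using fib by (intro sum_bounded_above[THEN order_trans]) auto
  finally show "card (L ?A) \<le> card (L A) * CARD('k) ^ pdeg P"
    using residue_system_card[OF P T] by (simp add: mult.commute)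
qed

lemma L_growth:
  assumes S: "finite S" "S \<subseteq> places \<iota>" and AB: "\<And>P. A P \<le> B P" "\<And>P. P \<notin> S \<Longrightarrow> A P = B P"
    and fin: "finite (L A)"
  shows "finite (L B) \<and> card (L B) \<le> card (L A) * CARD('k) ^ (\<Sum>P\<in>S. nat (B P - A P) * pdeg P)"
  using AB
proof (induction "\<Sum>P\<in>S. nat (B P - A P)" arbitrary: B)
  case 0
  then have "nat (B P - A P) = 0" if "P \<in> S" for P using S that by simp
  then have "A = B" using 0(2,3) by (intro ext) (metis diff_gt_0_iff_gt nle_le order_le_less zero_less_nat_eq less_irrefl)
  then show ?case using fin by simp
next
  case (Suc n)
  have "(\<Sum>P\<in>S. nat (B P - A P)) \<noteq> 0" using Suc(2) by simp
  then obtain P0 where P0: "P0 \<in> S" "nat (B P0 - A P0) \<noteq> 0" by (meson sum.neutral)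
  define B' where "B' = B(P0 := B P0 - 1)"
  have B: "B = B'(P0 := B' P0 + 1)" by (auto simp: B'_def)
  have le: "A P \<le> B' P" for P using Suc(3)[of P] P0 by (auto simp: B'_def)
  have step: "nat (B P - A P) = nat (B' P - A P) + of_bool (P = P0)" for P
    using le[of P] by (cases "P = P0") (simp_all add: B'_def)
  have "(\<Sum>P\<in>S. of_bool (P = P0)) = (1::nat)" using S P0 by simp
  then have n: "n = (\<Sum>P\<in>S. nat (B' P - A P))"
    using Suc(2) by (simp add: step sum.distrib)
  have IH: "finite (L B') \<and> card (L B') \<le> card (L A) * CARD('k) ^ (\<Sum>P\<in>S. nat (B' P - A P) * pdeg P)"
    using le Suc(4) P0 by (intro Suc(1)[OF n]) (auto simp: B'_def)
  have "(\<Sum>P\<in>S. nat (B P - A P) * pdeg P) = (\<Sum>P\<in>S. nat (B' P - A P) * pdeg P) + (\<Sum>P\<in>S. of_bool (P = P0) * pdeg P)"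
    by (simp only: step distrib_right sum.distrib)
  also have "(\<Sum>P\<in>S. of_bool (P = P0) * pdeg P) = (\<Sum>P\<in>S. if P = P0 then pdeg P else 0)"
    by (intro sum.cong) auto
  also have "\<dots> = pdeg P0" using S P0 by simp
  finally have sum: "(\<Sum>P\<in>S. nat (B P - A P) * pdeg P) = (\<Sum>P\<in>S. nat (B' P - A P) * pdeg P) + pdeg P0" .
  have P0': "P0 \<in> places \<iota>" using P0 S by blast
  have "finite (L B)" "card (L B) \<le> card (L B') * CARD('k) ^ pdeg P0"
    using L_step[OF P0', of B'] IH B by simp_all
  moreover have "card (L B') * CARD('k) ^ pdeg P0 \<le>
      card (L A) * CARD('k) ^ (\<Sum>P\<in>S. nat (B' P - A P) * pdeg P) * CARD('k) ^ pdeg P0"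
    using IH by (intro mult_right_mono) auto
  ultimately show ?case unfolding sum power_add mult.assoc[symmetric] using order_trans by blast
qed

section \<open>Zeros of \<open>w\<^sup>Q - w\<close>\<close>

lemma tq_R: "(w ^ CARD('k) ^ r - w) \<in> R"
  by (intro R_diff R_power R_w)

text \<open>With \<open>Q = CARD('k) ^ r\<close> and \<open>t_k = w ^ CARD('k) ^ k - w\<close>,
  additivity of Frobenius gives \<open>t_(rm+r) = (t_(rm))^Q + t_r\<close>, so divisibility by
  \<open>t_r\<close> propagates.\<close>

lemma tq_dvd: "\<exists>a\<in>R. (w ^ CARD('k) ^ (r * m) - w) = (w ^ CARD('k) ^ r - w) * a"
proof (induction m)
  case 0
  show ?case using R_0 by (intro bexI[of _ 0]) auto
next
  case (Suc m)
  then obtain a where a: "a \<in> R" "(w ^ CARD('k) ^ (r * m) - w) = (w ^ CARD('k) ^ r - w) * a" by blast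
  let ?Q = "CARD('k) ^ r"
  have "(w ^ CARD('k) ^ (r * Suc m) - w) = (w ^ CARD('k) ^ (r * m) - w) ^ ?Q + (w ^ CARD('k) ^ r - w)"
    unfolding power_card_diff by (simp add: power_add mult.commute flip: power_mult)
  also have "\<dots> = (w ^ CARD('k) ^ r - w) * ((w ^ CARD('k) ^ r - w) ^ (?Q - 1) * a ^ ?Q + 1)"
  proof -
    have "0 < ?Q" using card_const_ge by simp
    then have "b ^ ?Q = b * b ^ (?Q - 1)" for b :: 'a
      using power_minus_mult[of ?Q b] by (simp only: mult.commute)
    from this[of "(w ^ CARD('k) ^ r - w)"] show ?thesis unfolding a power_mult_distrib by (simp add: distrib_left mult.assoc)
  qed
  finally have "(w ^ CARD('k) ^ (r * Suc m) - w) = (w ^ CARD('k) ^ r - w) * ((w ^ CARD('k) ^ r - w) ^ (?Q - 1) * a ^ ?Q + 1)" .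
  moreover have "(w ^ CARD('k) ^ r - w) ^ (?Q - 1) * a ^ ?Q + 1 \<in> R"
    using a by (intro R_add R_mult R_power tq_R R_1)
  ultimately show ?case by blast
qed

text \<open>A multiple of \<open>r\<close> that is also a period of the place gives a uniformizer,
  and the element in question divides it in \<open>R\<close>. Its value is positive, the cofactor's
  is nonnegative, and they add up to \<open>1\<close>.\<close>

lemma val_tq:
  assumes P: "P \<in> places \<iota>" "P \<noteq> Pinf" and r: "0 < r" "(w ^ CARD('k) ^ r - w) \<in> P"
  shows "place_val P ((w ^ CARD('k) ^ r - w)) = 1"
proof -
  interpret V: discretely_valued_extension \<iota> "place_ring P" "unif P" using discrete_place[OF P(1)] .
  have PV: "place_of (place_ring P) = P" using place_ring_valuation[OF P(1)] by simp
  have z: "z \<in> place_ring P" using affine_place_iff P by blast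
  obtain r' where "period (place_ring P) r'" using period_exists[OF V.valuation_ring z] .
  then have per: "period (place_ring P) (r' * r)" using period_mult V.valuation_ring r by blast
  interpret V': discretely_valued_extension \<iota> "place_ring P" "(w ^ CARD('k) ^ (r' * r) - w)"
    using uniformizer_affine[OF V.valuation_ring z per] by unfold_locales
  obtain a where a: "a \<in> R" "(w ^ CARD('k) ^ (r' * r) - w) = (w ^ CARD('k) ^ r - w) * a" using tq_dvd[of r r'] by (metis mult.commute)
  have nz: "(w ^ CARD('k) ^ r - w) \<noteq> 0" "a \<noteq> 0" using a V'.t_nonzero by auto
  have "a \<in> place_ring P" using a affine_R[OF V.valuation_ring z] by blast
  then have "0 \<le> place_val P a" using V.val_nonneg_iff[of a] nz PV by simp
  moreover have "0 < place_val P ((w ^ CARD('k) ^ r - w))" using V.val_pos_iff[of "(w ^ CARD('k) ^ r - w)"] nz r PV by simp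
  moreover have "place_val P ((w ^ CARD('k) ^ r - w)) + place_val P a = 1"
    using V'.val_t V.val_mult nz unfolding a PV by simp
  ultimately show ?thesis by linarith
qed

text \<open>By \<open>affine_eqI\<close> the primes of distinct affine places in \<open>R\<close>
  are incomparable; multiply elements that lie in one other place each but not in
  \<open>P\<close>.\<close>

lemma separating_element:
  assumes S: "finite S" "S \<subseteq> places \<iota> - {Pinf}" and P: "P \<in> S"
  shows "\<exists>x\<in>R. x \<notin> P \<and> (\<forall>P'\<in>S - {P}. x \<in> P')"
proof -
  have "\<exists>y. y \<in> R \<and> y \<in> P' \<and> y \<notin> P" if "P' \<in> S - {P}" for P'
  proof (rule ccontr)
    assume "\<not> ?thesis"
    then have sub: "R \<inter> place_of (place_ring P') \<subseteq> place_of (place_ring P)"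
      using place_ring_valuation(2) S P that by auto
    have "P \<in> places \<iota>" "P' \<in> places \<iota>" "z \<in> place_ring P" "z \<in> place_ring P'"
      using S P that affine_place_iff by auto
    then have "place_ring P' = place_ring P"
      using affine_eqI[OF _ _ _ _ sub] place_ring_valuation(1) by blast
    then have "P' = P" using place_ring_valuation(2) \<open>P \<in> places \<iota>\<close> \<open>P' \<in> places \<iota>\<close> by metis
    then show False using that by blast
  qed
  then obtain y where y: "\<And>P'. P' \<in> S - {P} \<Longrightarrow> y P' \<in> R \<and> y P' \<in> P' \<and> y P' \<notin> P" by metis
  define x where "x = (\<Prod>P'\<in>S - {P}. y P')"
  have R_prod: "(\<Prod>P'\<in>X. y P') \<in> R" if "X \<subseteq> S - {P}" for X
    using that by (induction X rule: infinite_finite_induct) (use y in \<open>auto simp: R_1 intro!: R_mult\<close>)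
  have Pp: "P \<in> places \<iota>" using S P by blast
  interpret V: discretely_valued_extension \<iota> "place_ring P" "unif P" using discrete_place[OF Pp] .
  have RV: "R \<subseteq> place_ring P" using affine_R[OF V.valuation_ring] affine_place_iff[OF Pp] S P by blast
  have PV: "place_of (place_ring P) = P" using place_ring_valuation[OF Pp] by simp
  have "(\<Prod>P'\<in>X. y P') \<notin> P" if "finite X" "X \<subseteq> S - {P}" for X
    using that
  proof (induction X rule: finite_induct)
    case empty
    then show ?case using V.one_not_place PV by simp
  next
    case (insert P' X)
    then show ?case using V.place_prime[of "y P'" "\<Prod>P'\<in>X. y P'"] R_prod[of X] y[of P'] RV unfolding PV by auto
  qed
  then have "x \<notin> P" using S by (simp add: x_def)
  moreover have "x \<in> P'" if P': "P' \<in> S - {P}" for P'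
  proof -
    have Pp': "P' \<in> places \<iota>" using S P' by blast
    interpret V': discretely_valued_extension \<iota> "place_ring P'" "unif P'" using discrete_place[OF Pp'] .
    have RV': "R \<subseteq> place_ring P'" using affine_R[OF V'.valuation_ring] affine_place_iff[OF Pp'] S P' by blast
    have "x = y P' * (\<Prod>Q\<in>S - {P} - {P'}. y Q)" unfolding x_def using S P' by (simp add: prod.remove)
    moreover have "(\<Prod>Q\<in>S - {P} - {P'}. y Q) \<in> place_ring P'" using R_prod[of "S - {P} - {P'}"] RV' by (metis Diff_subset subsetD)
    ultimately show ?thesis
      using V'.place_mult[of "y P'"] y[OF P'] place_ring_valuation(2)[OF Pp'] by simp
  qed
  moreover have "x \<in> R" using R_prod by (simp add: x_def)
  ultimately show ?thesis by blast
qed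

lemma R_finite_subset_RR:
  assumes "finite X" "X \<subseteq> R"
  shows "\<exists>m0. \<forall>m\<ge>m0. X \<subseteq> RR m"
  using assms
proof (induction X rule: finite_induct)
  case (insert x X)
  then obtain m0 where "\<forall>m\<ge>m0. X \<subseteq> RR m" by auto
  then show ?case
    using insert by (intro exI[of _ "max m0 (- inf.val x)"]) (auto simp: RR_iff)
qed simp

lemma val_inf_tq:
  assumes "0 < r"
  shows "inf.val ((w ^ CARD('k) ^ r - w)) = - int (D * CARD('k) ^ r)"
proof -
  let ?Q = "CARD('k) ^ r"
  have Q: "2 \<le> ?Q" using card_power_ge assms by blast
  have nz: "w ^ ?Q \<noteq> 0" using w_nonzero by simp
  have vQ: "inf.val (w ^ ?Q) = - int (D * ?Q)" using w_nonzero by (simp add: inf.val_power val_w)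
  have "D < D * ?Q" using Q D_pos by simp
  then have "inf.val (- w) > - int (D * ?Q)" using inf.val_minus[OF w_nonzero] val_w by linarith
  moreover have "inf.val (- w * inverse (w ^ ?Q)) = inf.val (- w) - inf.val (w ^ ?Q)"
    using inf.val_mult[of "- w" "inverse (w ^ ?Q)"] inf.val_inverse[OF nz] nz w_nonzero
    by (simp del: mult_minus_left)
  ultimately have "0 < inf.val (- w * inverse (w ^ ?Q))" using vQ by linarith
  then have "- w * inverse (w ^ ?Q) \<in> place_of Vinf" using inf.val_pos_iff nz w_nonzero by simp
  then have u: "1 + - w * inverse (w ^ ?Q) \<in> ring_units Vinf"
    by (intro inf.one_unit_unit) simp
  have "(w ^ CARD('k) ^ r - w) = w ^ ?Q * (1 + - w * inverse (w ^ ?Q))" using nz by (simp add: field_simps)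
  also have "inf.val \<dots> = inf.val (w ^ ?Q) + 0"
    using inf.val_mult[OF nz, of "1 + - w * inverse (w ^ ?Q)"] inf.val_unit[OF u] u
    unfolding inf.unit_iff by presburger
  finally show ?thesis using vQ by simp
qed

text \<open>Guarantees that the exponents \<open>m + 1 - g\<close> in \<open>card_RR\<close> are not
  truncated by \<open>nat\<close>.\<close>

lemma genus_le: "(N - 1) * (D - 1) div 2 \<le> N * D"
proof -
  have "(N - 1) * (D - 1) \<le> N * D" by (intro mult_le_mono) auto
  then show ?thesis by (meson div_le_dividend order_trans)
qed

text \<open>The Chinese remainder theorem as an injection: prescribed residues at the places of
  \<open>S\<close>, together with multiples of \<open>w ^ CARD('k) ^ r - w\<close>, embed into
  \<open>RR m\<close>. That element has pole order \<open>v\<close>, so the multiples come from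
  \<open>RR (m - v)\<close>, and comparing cardinalities bounds the degree sum by
  \<open>v\<close>.\<close>

lemma sum_deg_zeros_tq:
  assumes S: "finite S" "S \<subseteq> places \<iota> - {Pinf}" and r: "0 < r" and t: "\<And>P. P \<in> S \<Longrightarrow> (w ^ CARD('k) ^ r - w) \<in> P"
  shows "(\<Sum>P\<in>S. pdeg P) \<le> D * CARD('k) ^ r"
proof -
  define v where "v = D * CARD('k) ^ r"
  have tn: "(w ^ CARD('k) ^ r - w) \<noteq> 0" using t_nonzero[OF r] .
  obtain x where x: "\<And>P. P \<in> S \<Longrightarrow> x P \<in> R \<and> x P \<notin> P \<and> (\<forall>P'\<in>S - {P}. x P \<in> P')"
    using separating_element[OF S] by metis
  have "\<forall>P\<in>S. \<exists>T. T \<subseteq> R \<and> valued_extension.residue_system (place_ring P) T"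
    using residue_system_R_exists S by (metis DiffE subsetD)
  then obtain T where T: "\<And>P. P \<in> S \<Longrightarrow> T P \<subseteq> R \<and> valued_extension.residue_system (place_ring P) (T P)"
    by metis
  define F where "F c = (\<Sum>P\<in>S. x P * c P)" for c
  let ?C = "PiE S T"
  have finC: "finite ?C"
  proof (rule finite_PiE[OF S(1)])
    fix P assume "P \<in> S"
    then interpret V: discretely_valued_extension \<iota> "place_ring P" "unif P" using discrete_place S by blast
    show "finite (T P)" using T[OF \<open>P \<in> S\<close>] by (simp add: V.residue_system_def)
  qed
  have cardC: "card ?C = CARD('k) ^ (\<Sum>P\<in>S. pdeg P)"
  proof -
    have "card ?C = (\<Prod>P\<in>S. card (T P))" by (rule card_PiE[OF S(1)])
    also have "\<dots> = (\<Prod>P\<in>S. CARD('k) ^ pdeg P)"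
      using residue_system_card T S by (intro prod.cong) auto
    finally show ?thesis by (simp add: power_sum)
  qed
  have FR: "F c \<in> R" if "c \<in> ?C" for c
    unfolding F_def using that x T by (intro R_sum R_mult) auto
  obtain m0 where m0: "\<And>m. m0 \<le> m \<Longrightarrow> F ` ?C \<subseteq> RR m"
    using R_finite_subset_RR[of "F ` ?C"] finC FR by blast
  \<comment> \<open>Large enough that \<open>RR m\<close> contains the finitely many
    \<open>F c\<close> and that \<open>card_RR\<close> applies to \<open>m\<close> and to
    \<open>m - v\<close>.\<close>
  define m where "m = max m0 (int (N * D) + int v)"
  let ?f = "\<lambda>(c, y). F c + (w ^ CARD('k) ^ r - w) * y"
  have inj: "inj_on ?f (?C \<times> RR (m - int v))"
  proof (rule inj_onI, clarify)
    fix c y d u assume c: "c \<in> ?C" and d: "d \<in> ?C" and y: "y \<in> RR (m - int v)" and u: "u \<in> RR (m - int v)"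
      and eq: "F c + (w ^ CARD('k) ^ r - w) * y = F d + (w ^ CARD('k) ^ r - w) * u"
    \<comment> \<open>Modulo \<open>P\<close> the multiples of \<open>w ^ CARD('k) ^ r - w\<close>
      and all summands with index other than \<open>P\<close> vanish, while \<open>x P\<close> is a
      unit.\<close>
    have "c P = d P" if P: "P \<in> S" for P
    proof -
      have Pp: "P \<in> places \<iota>" using S P by blast
      interpret V: discretely_valued_extension \<iota> "place_ring P" "unif P" using discrete_place[OF Pp] .
      have PV: "place_of (place_ring P) = P" using place_ring_valuation[OF Pp] by simp
      have RV: "R \<subseteq> place_ring P" using affine_R[OF V.valuation_ring] affine_place_iff[OF Pp] S P by blast
      have cR: "c P' - d P' \<in> place_ring P" if "P' \<in> S" for P'
        using that c d T RV V.diff_mem by (metis PiE_mem subsetD)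
      have "(w ^ CARD('k) ^ r - w) * (u - y) \<in> P"
      proof -
        have "u - y \<in> place_ring P" using y u RV by (auto simp: RR_def intro!: V.diff_mem)
        then show ?thesis using V.place_mult[of "(w ^ CARD('k) ^ r - w)" "u - y"] t[OF P] PV by simp
      qed
      moreover have "F c - F d = (w ^ CARD('k) ^ r - w) * (u - y)" using eq by (simp add: algebra_simps)
      moreover have "F c - F d = x P * (c P - d P) + (\<Sum>P'\<in>S - {P}. x P' * (c P' - d P'))"
        unfolding F_def right_diff_distrib sum_subtractf sum.remove[OF S(1) P] by simp
      moreover have "(\<Sum>P'\<in>S - {P}. x P' * (c P' - d P')) \<in> P"
        using V.place_sum[of "S - {P}" "\<lambda>P'. x P' * (c P' - d P')"] V.place_mult x P cR unfolding PV by auto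
      ultimately have "x P * (c P - d P) \<in> P" using V.place_diff PV by (metis add_diff_cancel_right')
      then have "c P - d P \<in> P" using V.place_prime[of "x P" "c P - d P"] x[OF P] RV cR[OF P] PV by auto
      then show ?thesis using T[OF P] c d P PV unfolding V.residue_system_def by (metis PiE_mem)
    qed
    then have "c = d" using c d by (intro PiE_ext) auto
    then show "c = d \<and> y = u" using eq tn by simp
  qed
  have sub: "?f ` (?C \<times> RR (m - int v)) \<subseteq> RR m"
  proof clarify
    fix c y assume c: "c \<in> ?C" and y: "y \<in> RR (m - int v)"
    have "F c \<in> RR m" using m0[of m] c by (auto simp: m_def)
    moreover have "(w ^ CARD('k) ^ r - w) * y \<in> RR m"
    proof (cases "y = 0")
      case False
      have "inf.val ((w ^ CARD('k) ^ r - w) * y) = - int v + inf.val y"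
        using inf.val_mult[OF tn False] val_inf_tq[OF r] by (simp add: v_def)
      then show ?thesis using y False tq_R R_mult by (auto simp: RR_iff)
    qed (simp add: RR_iff R_0)
    ultimately show "F c + (w ^ CARD('k) ^ r - w) * y \<in> RR m" by (rule RR_add)
  qed
  define g where "g = (N - 1) * (D - 1) div 2"
  have g: "int g \<le> int (N * D)" using genus_le unfolding g_def by (simp only: of_nat_le_iff)
  have m: "int (N * D) + int v \<le> m" by (simp add: m_def)
  have "CARD('k) ^ ((\<Sum>P\<in>S. pdeg P) + nat (m - int v + 1 - int g)) = card (?C \<times> RR (m - int v))"
    using cardC card_RR[of "m - int v"] m by (simp add: card_cartesian_product power_add g_def)
  also have "\<dots> \<le> card (RR m)" using card_inj_on_le[OF inj sub finite_RR] .
  also have "\<dots> = CARD('k) ^ nat (m + 1 - int g)" using card_RR[of m] m by (simp add: g_def)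
  finally have "(\<Sum>P\<in>S. pdeg P) + nat (m - int v + 1 - int g) \<le> nat (m + 1 - int g)"
    using card_const_ge by (simp add: power_increasing_iff)
  then have "int (\<Sum>P\<in>S. pdeg P) + (m - int v + 1 - int g) \<le> m + 1 - int g"
    using m g by linarith
  then have "int (\<Sum>P\<in>S. pdeg P) \<le> int v" by linarith
  then show ?thesis unfolding v_def[symmetric] by (simp only: of_nat_le_iff)
qed

text \<open>Every zero contributes at least \<open>1\<close> to the degree sum, so a finite set with
  more than \<open>D * CARD('k) ^ r\<close> zeros is impossible.\<close>

lemma finite_zeros_tq:
  assumes r: "0 < r"
  shows "finite {P \<in> places \<iota> - {Pinf}. (w ^ CARD('k) ^ r - w) \<in> P}" (is "finite ?S")
proof (rule ccontr)
  assume "infinite ?S"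
  then obtain X where X: "X \<subseteq> ?S" "finite X" "card X = Suc (D * CARD('k) ^ r)"
    using infinite_arbitrarily_large[of ?S "Suc (D * CARD('k) ^ r)"] by metis
  have "card X = (\<Sum>P\<in>X. 1)" by simp
  also have "\<dots> \<le> (\<Sum>P\<in>X. pdeg P)"
    using X deg_pos by (intro sum_mono) (auto simp: Suc_le_eq)
  also have "\<dots> \<le> D * CARD('k) ^ r" using X r by (intro sum_deg_zeros_tq) auto
  finally show False using X by simp
qed

section \<open>The genus\<close>

lemma divisor_degree_eq:
  assumes "finite S" "{P. A P \<noteq> 0} \<subseteq> S"
  shows "divisor_degree \<iota> A = (\<Sum>P\<in>S. A P * int (pdeg P))"
  unfolding divisor_degree_def using assms by (intro sum.mono_neutral_left) auto

definition infdiv :: "int \<Rightarrow> 'a set \<Rightarrow> int" where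
  "infdiv k = (\<lambda>P. if P = Pinf then k else 0)"

text \<open>Regularity at all affine places means membership in \<open>R\<close>, by
  \<open>R_eq_Inter\<close>.\<close>

lemma L_infdiv: "L (infdiv k) = RR k"
proof (intro equalityI subsetI)
  fix x assume x: "x \<in> L (infdiv k)"
  have "x \<in> V" if V: "valuation_ring \<iota> V" "z \<in> V" for V
  proof -
    interpret V: valued_extension \<iota> V by unfold_locales (rule V)
    have "place_of V \<noteq> Pinf" using V z_not_Vinf V.place_ring_place_of place_ring_Pinf by auto
    moreover have "x * unif (place_of V) powi infdiv k (place_of V) \<in> place_ring (place_of V)"
      using x place_of_places[OF V(1)] unfolding L_iff by blast
    ultimately show ?thesis by (simp add: infdiv_def V.place_ring_place_of)
  qed
  then have "x \<in> R" by (rule R_eq_Inter)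
  moreover have "x = 0 \<or> - k \<le> inf.val x"
    using x Pinf_places unfolding riemann_roch_space_def infdiv_def by (fastforce simp: Pinf_def)
  ultimately show "x \<in> RR k" by (simp add: RR_iff)
next
  fix x assume x: "x \<in> RR k"
  show "x \<in> L (infdiv k)"
    unfolding L_iff
  proof
    fix P assume P: "P \<in> places \<iota>"
    show "x * unif P powi infdiv k P \<in> place_ring P"
    proof (cases "P = Pinf")
      case True
      then show ?thesis
        using place_val_ge_iff[OF P, of x "- k"] x by (simp add: infdiv_def RR_iff Pinf_def)
    next
      case False
      then have "z \<in> place_ring P" using affine_place_iff[OF P] by blast
      then show ?thesis
        using False x affine_R[OF place_ring_valuation(1)[OF P]] by (auto simp: infdiv_def RR_def)
    qed
  qed
qed

lemma infdiv_divisor: "infdiv k \<in> divisors \<iota>"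
  unfolding divisors_def infdiv_def using Pinf_places by (auto intro: finite_subset[of _ "{Pinf}"])

lemma degree_infdiv: "divisor_degree \<iota> (infdiv k) = k"
proof -
  have "{P. infdiv k P \<noteq> 0} \<subseteq> {Pinf}" by (clarsimp simp: infdiv_def)
  then show ?thesis using divisor_degree_eq[of "{Pinf}" "infdiv k"] deg_Pinf by (simp add: infdiv_def)
qed

lemma dim_infdiv:
  assumes "int (N * D) \<le> k"
  shows "int (divisor_dim \<iota> (infdiv k)) = k + 1 - int ((N - 1) * (D - 1) div 2)"
proof -
  have "CARD('k) ^ divisor_dim \<iota> (infdiv k) = CARD('k) ^ nat (k + 1 - int ((N - 1) * (D - 1) div 2))"
    using card_L[of "infdiv k"] finite_RR card_RR[OF assms] by (simp add: L_infdiv)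
  then have "divisor_dim \<iota> (infdiv k) = nat (k + 1 - int ((N - 1) * (D - 1) div 2))"
    using card_const_ge by (simp add: power_inject_exp)
  moreover have "int ((N - 1) * (D - 1) div 2) \<le> int (N * D)"
    using genus_le by (simp only: of_nat_le_iff)
  ultimately show ?thesis using assms by linarith
qed

lemma common_period:
  assumes "finite S" "S \<subseteq> places \<iota> - {Pinf}"
  shows "\<exists>r>0. \<forall>P\<in>S. (w ^ CARD('k) ^ r - w) \<in> P"
proof -
  have "\<exists>r>0. \<forall>P\<in>S. period (place_ring P) r"
    using assms
  proof (induction S rule: finite_induct)
    case empty
    show ?case by (intro exI[of _ 1]) auto
  next
    case (insert P S)
    then obtain r where r: "0 < r" "\<forall>P\<in>S. period (place_ring P) r" by auto
    have P: "valuation_ring \<iota> (place_ring P)" "z \<in> place_ring P"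
      using insert place_ring_valuation affine_place_iff by auto
    obtain r' where r': "period (place_ring P) r'" using period_exists[OF P] .
    have "0 < r'" using r' by (simp add: period_def)
    have "period (place_ring P') (r * r')" if P': "P' \<in> insert P S" for P'
    proof -
      have v: "valuation_ring \<iota> (place_ring P')" using P' insert.prems place_ring_valuation by blast
      show ?thesis
      proof (cases "P' = P")
        case True
        then show ?thesis using period_mult[OF v _ r(1), of r'] r' by (simp add: mult.commute)
      next
        case False
        then have "P' \<in> S" using P' by blast
        then show ?thesis using period_mult[OF v _ \<open>0 < r'\<close>, of r] r by blast
      qed
    qed
    then show ?case using r \<open>0 < r'\<close> by (intro exI[of _ "r * r'"]) auto
  qed
  then show ?thesis using assms place_ring_valuation(2) unfolding period_def by (metis DiffE subsetD)
qed

text \<open>Enlarging a divisor raises the dimension by at most the gain in degree, so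
  \<open>A\<close> may be replaced by a \<open>B\<close> with coefficient \<open>k\<close> at
  infinity and \<open>e\<close> at the zeros of \<open>w ^ CARD('k) ^ r - w\<close>. Dividing by the
  \<open>e\<close>-th power of this element embeds \<open>RR (k + e * v)\<close> into
  \<open>L B\<close>, the degree of \<open>B\<close> is at most \<open>k + e * v\<close>, and
  \<open>card_RR\<close> supplies the constant.\<close>

lemma riemann_inequality:
  assumes A: "A \<in> divisors \<iota>"
  shows "divisor_degree \<iota> A - int (divisor_dim \<iota> A) + 1 \<le> int ((N - 1) * (D - 1) div 2)"
proof -
  define g where "g = (N - 1) * (D - 1) div 2"
  have finA: "finite {P. A P \<noteq> 0}" and subA: "{P. A P \<noteq> 0} \<subseteq> places \<iota>" using A by (auto simp: divisors_def)
  obtain r where r: "0 < r" "\<And>P. P \<in> {P. A P \<noteq> 0} - {Pinf} \<Longrightarrow> (w ^ CARD('k) ^ r - w) \<in> P"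
    using common_period[OF finite_Diff[OF finA] Diff_mono[OF subA order_refl]] by metis
  define S where "S = {P \<in> places \<iota> - {Pinf}. (w ^ CARD('k) ^ r - w) \<in> P}"
  have finS: "finite S" unfolding S_def by (rule finite_zeros_tq[OF r(1)])
  \<comment> \<open>The inserted \<open>0\<close> covers the zero divisor and makes the maximum
    nonnegative, so \<open>nat\<close> does not change it.\<close>
  define e where "e = nat (Max (insert 0 (A ` {P. A P \<noteq> 0})))"
  have e: "A P \<le> int e" for P
  proof (cases "A P = 0")
    case False
    then have "A P \<le> Max (insert 0 (A ` {P. A P \<noteq> 0}))" using finA by (intro Max_ge) auto
    then show ?thesis by (simp add: e_def)
  qed simp
  define v where "v = D * CARD('k) ^ r"
  \<comment> \<open>Dominates \<open>A\<close> at infinity and lies in the range of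
    \<open>card_RR\<close>.\<close>
  define k where "k = max (A Pinf) (int (N * D))"
  define B where "B P = (if P = Pinf then k else if P \<in> S then int e else 0)" for P
  let ?S = "insert Pinf S"
  have SP: "?S \<subseteq> places \<iota>" "Pinf \<notin> S" using Pinf_places by (auto simp: S_def)
  have AS: "{P. A P \<noteq> 0} \<subseteq> ?S" using r(2) subA by (auto simp: S_def)
  have BS: "{P. B P \<noteq> 0} \<subseteq> ?S" by (clarsimp simp: B_def)
  have A0: "A P = 0" if "P \<notin> ?S" for P using that AS by blast
  have AB: "A P \<le> B P" for P
    using e[of P] A0[of P] by (cases "P = Pinf"; cases "P \<in> S") (simp_all add: B_def k_def)
  have AB': "A P = B P" if "P \<notin> ?S" for P using that A0[OF that] by (simp add: B_def)
  have k0: "int (N * D) \<le> k" by (simp add: k_def)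
  \<comment> \<open>\<open>card_L\<close> speaks about finite spaces only; finiteness is carried
    from \<open>RR k\<close> up to \<open>L B\<close> and then down to \<open>L A\<close>.\<close>
  have finB: "finite (L B)"
  proof -
    have "infdiv k P \<le> B P" "P \<notin> ?S \<Longrightarrow> infdiv k P = B P" for P by (auto simp: infdiv_def B_def)
    then show ?thesis
      using L_growth[of ?S "infdiv k" B] finS SP finite_RR by (simp add: L_infdiv)
  qed
  have finA': "finite (L A)" using L_mono[of A B] AB finB finite_subset by blast
  have "CARD('k) ^ divisor_dim \<iota> B \<le> CARD('k) ^ divisor_dim \<iota> A * CARD('k) ^ (\<Sum>P\<in>?S. nat (B P - A P) * pdeg P)"
    using L_growth[of ?S A B] finS SP AB AB' finA' card_L[OF finA'] card_L[OF finB] by simp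
  then have "divisor_dim \<iota> B \<le> divisor_dim \<iota> A + (\<Sum>P\<in>?S. nat (B P - A P) * pdeg P)"
    using card_const_ge by (simp add: power_increasing_iff flip: power_add)
  moreover have "int (\<Sum>P\<in>?S. nat (B P - A P) * pdeg P) = divisor_degree \<iota> B - divisor_degree \<iota> A"
    using divisor_degree_eq[of ?S A] divisor_degree_eq[of ?S B] finS AS BS AB
    by (simp only: of_nat_sum of_nat_mult finite_insert int_nat_eq diff_ge_0_iff_ge if_True
        left_diff_distrib sum_subtractf)
  ultimately have mono: "divisor_degree \<iota> A - int (divisor_dim \<iota> A) \<le> divisor_degree \<iota> B - int (divisor_dim \<iota> B)"
    by linarith
  have "(\<Sum>P\<in>S. B P * int (pdeg P)) = (\<Sum>P\<in>S. int e * int (pdeg P))"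
    using SP by (intro sum.cong) (auto simp: B_def)
  then have "divisor_degree \<iota> B = k + (\<Sum>P\<in>S. int e * int (pdeg P))"
    using divisor_degree_eq[of ?S B] finS BS SP deg_Pinf by (simp add: B_def[of Pinf])
  also have "(\<Sum>P\<in>S. int e * int (pdeg P)) = int e * int (\<Sum>P\<in>S. pdeg P)"
    by (simp add: sum_distrib_left)
  also have "\<dots> \<le> int e * int v"
  proof -
    have "(\<Sum>P\<in>S. pdeg P) \<le> v" unfolding v_def using finS r(1) by (intro sum_deg_zeros_tq) (auto simp: S_def)
    then show ?thesis by (intro mult_left_mono of_nat_mono) simp_all
  qed
  finally have degB: "divisor_degree \<iota> B \<le> k + int e * int v" by simp
  have tn: "(w ^ CARD('k) ^ r - w) \<noteq> 0" using t_nonzero[OF r(1)] .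
  have "(\<lambda>y. y * inverse ((w ^ CARD('k) ^ r - w) ^ e)) ` RR (k + int e * int v) \<subseteq> L B"
  proof
    fix x assume "x \<in> (\<lambda>y. y * inverse ((w ^ CARD('k) ^ r - w) ^ e)) ` RR (k + int e * int v)"
    then obtain y where y: "y \<in> RR (k + int e * int v)" and x: "x = y * inverse ((w ^ CARD('k) ^ r - w) ^ e)" by blast
    have "x = 0 \<or> (\<forall>P\<in>places \<iota>. place_val P x \<ge> - B P)"
    proof (cases "y = 0")
      case False
      have "place_val P x \<ge> - B P" if P: "P \<in> places \<iota>" for P
      proof -
        interpret V: discretely_valued_extension \<iota> "place_ring P" "unif P" using discrete_place[OF P] .
        have PV: "place_of (place_ring P) = P" using place_ring_valuation[OF P] by simp
        have vx: "place_val P x = place_val P y - int e * place_val P ((w ^ CARD('k) ^ r - w))"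
          using False tn V.val_mult V.val_inverse V.val_power unfolding x PV by simp
        show ?thesis
        proof (cases "P = Pinf")
          case True
          have "place_val P ((w ^ CARD('k) ^ r - w)) = - int v" "- (k + int e * int v) \<le> place_val P y"
            using val_inf_tq[OF r(1)] y False unfolding True Pinf_def v_def RR_iff by auto
          then show ?thesis using vx True by (simp add: B_def)
        next
          case nP: False
          then have "R \<subseteq> place_ring P" using affine_R[OF V.valuation_ring] affine_place_iff[OF P] by blast
          then have y0: "0 \<le> place_val P y" using V.val_nonneg_iff[OF False] y PV by (auto simp: RR_def)
          show ?thesis
          proof (cases "(w ^ CARD('k) ^ r - w) \<in> P")
            \<comment> \<open>The zeros are simple, so division by the \<open>e\<close>-th power
              costs exactly \<open>e\<close> in the value.\<close>
            case True
            then show ?thesis using val_tq[OF P nP r(1)] vx y0 P nP by (simp add: B_def S_def)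
          next
            case tP: False
            have "(w ^ CARD('k) ^ r - w) \<in> place_ring P" using \<open>R \<subseteq> place_ring P\<close> tq_R by blast
            then have "place_val P ((w ^ CARD('k) ^ r - w)) = 0" using V.not_place_unit V.val_unit tP PV by metis
            then show ?thesis using vx y0 nP tP by (simp add: B_def S_def)
          qed
        qed
      qed
      then show ?thesis by blast
    qed (simp add: x)
    then show "x \<in> L B" by (simp add: riemann_roch_space_def)
  qed
  then have "card (RR (k + int e * int v)) \<le> card (L B)"
    using tn finB by (intro card_inj_on_le[of "\<lambda>y. y * inverse ((w ^ CARD('k) ^ r - w) ^ e)"]) (auto intro!: inj_onI)
  moreover have kv: "int (N * D) \<le> k + int e * int v" using k0 by (simp add: add_increasing2)
  ultimately have "nat (k + int e * int v + 1 - int g) \<le> divisor_dim \<iota> B"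
    using card_RR[OF kv] card_L[OF finB] card_const_ge by (simp add: g_def power_increasing_iff)
  then have "k + int e * int v + 1 - int g \<le> int (divisor_dim \<iota> B)" by linarith
  then show ?thesis using mono degB unfolding g_def[symmetric] by linarith
qed

text \<open>The bound of \<open>riemann_inequality\<close> is attained at \<open>N * D\<close> times
  the place at infinity.\<close>

theorem genus_eq: "genus \<iota> = int ((N - 1) * (D - 1) div 2)"
  unfolding genus_def
proof (rule cSup_eq_maximum)
  have "int ((N - 1) * (D - 1) div 2) =
      divisor_degree \<iota> (infdiv (int (N * D))) - int (divisor_dim \<iota> (infdiv (int (N * D)))) + 1"
    unfolding degree_infdiv using dim_infdiv[of "int (N * D)"] by linarith
  then show "int ((N - 1) * (D - 1) div 2) \<in>
      {divisor_degree \<iota> A - int (divisor_dim \<iota> A) + 1 |A. A \<in> divisors \<iota>}"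
    using infdiv_divisor by blast
qed (use riemann_inequality in auto)

text \<open>An algebraic element lies in every valuation ring, hence in \<open>RR 0\<close>, which
  is no larger than \<open>K\<close>. Over \<open>K(z)\<close> the field is spanned by the powers
  \<open>w ^ j\<close> with \<open>j < N\<close>.\<close>

theorem function_field: "function_field \<iota>"
proof -
  have const: "{x. algebraic_over \<iota> x} = range \<iota>"
  proof (intro equalityI subsetI)
    fix x assume "x \<in> {x. algebraic_over \<iota> x}"
    then have x: "x \<in> V" if "valuation_ring \<iota> V" for V
      using that valued_extension.algebraic_mem[of \<iota> V x] field_hom_axioms
      by (simp add: valued_extension_def valued_extension_axioms_def)
    then have xR: "x \<in> RR 0" using R_eq_Inter valuation_ring_Vinf by (auto simp: RR_def)
    \<comment> \<open>Index \<open>1\<close> in \<open>card_RR_poles\<close> means pole order at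
      most \<open>0\<close>, and \<open>0\<close> is the only such order.\<close>
    have 0: "RR 0 = RR (int 1 - 1)" by simp
    have "0 \<in> poles" using N_pos by (auto simp: poles_def weight_def image_iff)
    then have "poles \<inter> {..<1} = {0}" by auto
    then have "card (RR 0) = CARD('k)" unfolding 0 using card_RR_poles[of 1] by simp
    moreover have "inj \<iota>" using eq_iff by (auto intro: injI)
    then have "card (range \<iota>) = CARD('k)" by (rule card_image)
    moreover have "range \<iota> \<subseteq> RR 0" using R_const inf.const_mem by (auto simp: RR_def)
    ultimately have "range \<iota> = RR 0" using finite_RR by (intro card_subset_eq) auto
    then show "x \<in> range \<iota>" using xR by simp
  next
    fix x assume "x \<in> range \<iota>"
    then obtain c where "x = \<iota> c" by blast
    then have "poly (map_poly \<iota> [:- c, 1:]) x = 0" by (simp add: hom_distribs)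
    moreover have "[:- c, 1:] \<noteq> 0" by simp
    ultimately show "x \<in> {x. algebraic_over \<iota> x}" unfolding algebraic_over_def by blast
  qed
  let ?L = "generated_subfield (insert z (range \<iota>))"
  have L: "is_subfield ?L" by (rule is_subfield_generated)
  have zL: "z \<in> ?L" and cL: "\<iota> c \<in> ?L" for c
    using generated_subfield_superset[of "insert z (range \<iota>)"] by auto
  have L_add: "x + y \<in> ?L" and L_mult: "x * y \<in> ?L" if "x \<in> ?L" "y \<in> ?L" for x y
    using L that by (auto simp: is_subfield_def)
  have L_inv: "- x \<in> ?L" "inverse x \<in> ?L" if "x \<in> ?L" for x using L that by (auto simp: is_subfield_def)
  have evL: "evz c \<in> ?L" for c
  proof (induction c)
    case 0
    show ?case using cL[of 0] by simp
  next
    case (pCons a c)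
    have "evz (pCons a c) = \<iota> a + z * evz c" by (simp add: evz_def hom_distribs)
    then show ?case using pCons L_add L_mult cL zL by simp
  qed
  have inj: "inj_on (\<lambda>j. w ^ j) {..<N}"
  proof (rule inj_onI)
    fix i j assume "w ^ i = w ^ j"
    then have "inf.val (w ^ i) = inf.val (w ^ j)" by simp
    then show "i = j" using w_nonzero D_pos by (simp add: inf.val_power val_w)
  qed
  have "finite_extension_of ?L"
    unfolding finite_extension_of_def
  proof (intro exI[of _ "(\<lambda>j. w ^ j) ` {..<N}"] conjI allI)
    fix x
    obtain f g where fg: "f \<in> R" "g \<in> R" "g \<noteq> 0" "x = f / g" using fraction by blast
    \<comment> \<open>The denominator is moved into \<open>K[z]\<close>: by pigeonhole some
      \<open>z ^ i - z ^ j\<close> is a multiple of \<open>g\<close>.\<close>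
    obtain i j y where ij: "i < j" "y \<in> R" "z ^ i - z ^ j = g * y"
      using R_pigeonhole[OF fg(2,3), of "\<lambda>i. z ^ i" "\<lambda>i. z ^ i"] R_power R_z by metis
    have "evz (monom 1 i - monom 1 j) \<noteq> 0"
    proof
      assume "evz (monom 1 i - monom 1 j) = 0"
      then have "coeff (monom 1 i - monom (1::'k) j) i = 0" by (simp add: evz_eq_0_iff)
      then show False using ij(1) by simp
    qed
    moreover have zij: "evz (monom 1 i - monom 1 j) = z ^ i - z ^ j"
      unfolding evz.hom_minus by (simp add: evz_def poly_monom)
    ultimately have nz: "z ^ i - z ^ j \<noteq> 0" by simp
    then have y0: "y \<noteq> 0" using ij by auto
    obtain \<rho> where \<rho>: "degree \<rho> < N" "f * y = ev \<rho>" using R_reduced R_mult fg ij by metis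
    define u where "u = inverse (z ^ i - z ^ j)"
    have u: "u \<in> ?L" unfolding u_def using L_inv evL zij by metis
    have "x = f * y * u" unfolding u_def ij(3) using fg y0 by (simp add: field_simps)
    also have "f * y = (\<Sum>k<N. evz (coeff \<rho> k) * w ^ k)"
    proof -
      have "ev \<rho> = (\<Sum>k\<le>degree \<rho>. evz (coeff \<rho> k) * w ^ k)"
        unfolding ev_def poly_altdef using degree_map_poly_le[of evz \<rho>]
        by (intro sum.mono_neutral_cong_left) (auto intro: coeff_eq_0 simp flip: evz.coeff_map_poly_hom)
      also have "\<dots> = (\<Sum>k<N. evz (coeff \<rho> k) * w ^ k)"
        using \<rho>(1) by (intro sum.mono_neutral_left) (auto simp: coeff_eq_0)
      finally show ?thesis using \<rho>(2) by simp
    qed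
    finally have x: "x = (\<Sum>k<N. evz (coeff \<rho> k) * u * w ^ k)"
      by (simp add: sum_distrib_left mult_ac)
    \<comment> \<open>\<open>finite_extension_of\<close> indexes coefficients by the spanning
      elements, so the exponent has to be recovered from \<open>b\<close>; distinct powers of
      \<open>w\<close> differ by their pole orders.\<close>
    define c where "c b = evz (coeff \<rho> (the_inv_into {..<N} (\<lambda>j. w ^ j) b)) * u" for b
    have "x = (\<Sum>b\<in>(\<lambda>j. w ^ j) ` {..<N}. c b * b)"
      unfolding x sum.reindex[OF inj] o_def c_def
      using the_inv_into_f_f[OF inj] by (intro sum.cong) auto
    moreover have "c b \<in> ?L" for b unfolding c_def using L_mult evL u by blast
    ultimately show "\<exists>c. (\<forall>b\<in>(\<lambda>j. w ^ j) ` {..<N}. c b \<in> ?L) \<and> x = (\<Sum>b\<in>(\<lambda>j. w ^ j) ` {..<N}. c b * b)"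
      by (intro exI[of _ c] conjI ballI)
  qed simp
  then show ?thesis
    unfolding function_field_def using field_hom_axioms z_transcendental const by blast
qed

end

section \<open>Rational places\<close>

lemma (in valued_extension) place_diff_power:
  assumes "x - y \<in> place_of V" "x \<in> V" "y \<in> V"
  shows "x ^ n - y ^ n \<in> place_of V"
  using assms by (induction n) (auto intro: place_diff_mult power_mem simp: zero_place)

context additive_kummer
begin

definition points :: "('k \<times> 'k) set" where
  "points = {(a, b). b ^ N = additive_power a h}"

definition centre :: "'a set \<Rightarrow> 'k \<times> 'k \<Rightarrow> bool" where
  "centre P ab \<longleftrightarrow> z - \<iota> (fst ab) \<in> P \<and> w - \<iota> (snd ab) \<in> P"

lemma additive_power_hom: "\<iota> (additive_power a f) = additive_power (\<iota> a) f"
proof -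
  have "\<iota> (of_bool b * a ^ k) = of_bool b * \<iota> a ^ k" for b k by (cases b) (simp_all add: hom_power)
  then show ?thesis by (simp only: additive_power_def hom_sum)
qed

text \<open>The constant is chosen before the place: the value of \<open>x\<close> is the same at
  all places with the given centre.\<close>

lemma centre_residue:
  assumes "x \<in> R"
  shows "\<exists>c. \<forall>P\<in>places \<iota> - {Pinf}. centre P ab \<longrightarrow> x - \<iota> c \<in> P"
  using assms
proof (induction rule: R_induct)
  case (const c)
  have "\<iota> c - \<iota> c \<in> P" if "P \<in> places \<iota>" for P
  proof -
    interpret V: discretely_valued_extension \<iota> "place_ring P" "unif P" using discrete_place[OF that] .
    show ?thesis using V.zero_place place_ring_valuation[OF that] by simp
  qed
  then show ?case by blast
next
  case (add x y)
  then obtain c d where cd: "\<And>P. P \<in> places \<iota> - {Pinf} \<Longrightarrow> centre P ab \<Longrightarrow> x - \<iota> c \<in> P \<and> y - \<iota> d \<in> P" by metis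
  have "(x + y) - \<iota> (c + d) \<in> P" if P: "P \<in> places \<iota> - {Pinf}" and ab: "centre P ab" for P
  proof -
    have Pp: "P \<in> places \<iota>" using P by blast
    interpret V: discretely_valued_extension \<iota> "place_ring P" "unif P" using discrete_place[OF Pp] .
    have eq: "(x + y) - \<iota> (c + d) = (x - \<iota> c) + (y - \<iota> d)" by (simp add: hom_distribs)
    show ?thesis
      unfolding eq using V.place_add[of "x - \<iota> c" "y - \<iota> d"] cd[OF P ab] place_ring_valuation[OF Pp] by simp
  qed
  then show ?case by blast
next
  case (mult x y)
  then obtain c d where cd: "\<And>P. P \<in> places \<iota> - {Pinf} \<Longrightarrow> centre P ab \<Longrightarrow> x - \<iota> c \<in> P \<and> y - \<iota> d \<in> P" by metis
  have "x * y - \<iota> (c * d) \<in> P" if P: "P \<in> places \<iota> - {Pinf}" and ab: "centre P ab" for P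
  proof -
    have Pp: "P \<in> places \<iota>" using P by blast
    interpret V: discretely_valued_extension \<iota> "place_ring P" "unif P" using discrete_place[OF Pp] .
    have "y \<in> place_ring P" using affine_R[OF V.valuation_ring] affine_place_iff[OF Pp] P mult by blast
    then show ?thesis
      using V.place_diff_mult[of x "\<iota> c" y "\<iota> d"] V.const_mem cd[OF P ab] place_ring_valuation[OF Pp]
      by (simp add: hom_mult)
  qed
  then show ?case by blast
qed (auto simp: centre_def)

text \<open>Equal values on \<open>R\<close> give equal primes in \<open>R\<close>, and these
  determine affine places.\<close>

lemma centre_unique_place:
  assumes "P \<in> places \<iota> - {Pinf}" "P' \<in> places \<iota> - {Pinf}" "centre P ab" "centre P' ab"
  shows "P = P'"
proof -
  have PP: "P \<in> places \<iota>" "P' \<in> places \<iota>" using assms by auto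
  interpret V: discretely_valued_extension \<iota> "place_ring P" "unif P" using discrete_place[OF PP(1)] .
  interpret V': discretely_valued_extension \<iota> "place_ring P'" "unif P'" using discrete_place[OF PP(2)] .
  have pv: "place_of (place_ring P) = P" "place_of (place_ring P') = P'"
    using place_ring_valuation PP by auto
  have "x \<in> P'" if x: "x \<in> R" "x \<in> P" for x
  proof -
    obtain c where c: "x - \<iota> c \<in> P" "x - \<iota> c \<in> P'" using centre_residue[OF x(1)] assms by metis
    have "\<iota> c \<in> P" using V.place_diff[of x "x - \<iota> c"] x c pv by simp
    then have "c = 0" using V.const_place_iff pv by simp
    then show ?thesis using c by simp
  qed
  then have "place_ring P = place_ring P'"
    using assms PP affine_place_iff pv
    by (intro affine_eqI[OF V.valuation_ring _ V'.valuation_ring]) auto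
  then have "place_of (place_ring P) = place_of (place_ring P')" by (rule arg_cong)
  then show ?thesis unfolding pv .
qed

text \<open>By additivity \<open>w ^ N - \<iota> (additive_power a h)\<close> is the additive
  polynomial at \<open>z - \<iota> a\<close>, which lies in the place. Comparison with
  \<open>w ^ N - \<iota> b ^ N\<close> leaves a constant in the place, hence
  \<open>0\<close>.\<close>

lemma rational_place_centre:
  assumes P: "P \<in> rational_places \<iota> - {Pinf}"
  shows "\<exists>ab\<in>points. centre P ab"
proof -
  have Pp: "P \<in> places \<iota>" "pdeg P = 1" using P by (auto simp: rational_places_def)
  interpret V: discretely_valued_extension \<iota> "place_ring P" "unif P" using discrete_place[OF Pp(1)] .
  have pv: "place_of (place_ring P) = P" using place_ring_valuation Pp by auto
  have RV: "R \<subseteq> place_ring P" using affine_R[OF V.valuation_ring] affine_place_iff[OF Pp(1)] P by blast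
  then have zw: "z \<in> place_ring P" "w \<in> place_ring P" using R_z R_w by auto
  obtain a b where ab: "z - \<iota> a \<in> P" "w - \<iota> b \<in> P" using deg_one_iff[OF Pp(1)] Pp(2) zw by metis
  have "additive_power (z - \<iota> a) h \<in> P"
  proof -
    have "of_bool (coeff h i = 1) * (z - \<iota> a) ^ 2 ^ i \<in> place_of (place_ring P)" for i
      using ab V.zero_place V.place_power[of "z - \<iota> a" "2 ^ i"] pv by simp
    then have "additive_power (z - \<iota> a) h \<in> place_of (place_ring P)"
      unfolding additive_power_def by (rule V.place_sum)
    then show ?thesis unfolding pv .
  qed
  moreover have "additive_power (z - \<iota> a) h = w ^ N - \<iota> (additive_power a h)"
    unfolding additive_power_diff_arg[OF char_two] equation additive_power_hom ..
  moreover have "w ^ N - \<iota> b ^ N \<in> P"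
    using V.place_diff_power[of w "\<iota> b" N] ab zw V.const_mem pv by simp
  ultimately have "(w ^ N - \<iota> (additive_power a h)) - (w ^ N - \<iota> b ^ N) \<in> P"
    using V.place_diff[unfolded pv] by metis
  then have "\<iota> (b ^ N - additive_power a h) \<in> P" by (simp add: hom_distribs)
  then have "b ^ N = additive_power a h" using V.const_place_iff pv by simp
  then show ?thesis using ab by (intro bexI[of _ "(a, b)"]) (auto simp: points_def centre_def)
qed

text \<open>A place is constructed over the ideal of functions vanishing at the point. It is
  rational because its residues come from \<open>R\<close>, where every element is congruent to a
  constant.\<close>

lemma point_rational_place:
  assumes ab: "(a, b) \<in> points"
  shows "\<exists>P\<in>rational_places \<iota> - {Pinf}. centre P (a, b)"
proof -
  define e2 where "e2 f = poly (poly f [:b:]) a" for f :: "'k poly poly"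
  have e2: "e2 (f + g) = e2 f + e2 g" "e2 (f - g) = e2 f - e2 g" "e2 (f * g) = e2 f * e2 g" "e2 0 = 0" "e2 1 = 1"
    for f g by (simp_all add: e2_def)
  have "e2 curve_poly = 0"
    using ab by (simp add: e2_def curve_poly_def poly_monom poly_additive_poly points_def)
  \<comment> \<open>Evaluation at the point is well defined on \<open>R\<close>, since the relations
    between \<open>z\<close> and \<open>w\<close> are the multiples of
    \<open>curve_poly\<close>.\<close>
  then have ker: "e2 f = 0" if "ev f = 0" for f
    using that by (auto simp: ev_eq_0_iff e2 elim!: dvdE)
  define I where "I = {ev f | f. e2 f = 0}"
  have "ideal_of R I"
    unfolding ideal_of_def
  proof (intro conjI ballI)
    show "0 \<in> I" using ev_0 e2 unfolding I_def by force
    show "I \<subseteq> R" by (auto simp: I_def R_def)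
    fix x y assume "x \<in> I" "y \<in> I"
    then obtain f g where "x = ev f" "y = ev g" "e2 f = 0" "e2 g = 0" by (auto simp: I_def)
    then have "x + y = ev (f + g) \<and> e2 (f + g) = 0" by (simp add: e2 ev_add)
    then show "x + y \<in> I" unfolding I_def by blast
  next
    fix x y assume "x \<in> R" "y \<in> I"
    then obtain f g where "x = ev f" "y = ev g" "e2 g = 0" by (auto simp: I_def R_def)
    then have "x * y = ev (f * g) \<and> e2 (f * g) = 0" by (simp add: e2 ev_mult)
    then show "x * y \<in> I" unfolding I_def by blast
  qed
  moreover have "1 \<notin> I"
  proof
    assume "1 \<in> I"
    then obtain f where f: "ev f = 1" "e2 f = 0" by (auto simp: I_def)
    then have "ev (f - 1) = 0" by (simp add: ev_diff ev_1)
    then have "e2 (f - 1) = 0" by (rule ker)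
    then show False using f by (simp add: e2)
  qed
  moreover have zI: "z - \<iota> a \<in> I" and wI: "w - \<iota> b \<in> I"
  proof -
    have "ev ([:[:0, 1:]:] - [:[:a:]:]) = z - \<iota> a" "ev ([:0, 1:] - [:[:b:]:]) = w - \<iota> b"
      unfolding ev_diff ev_z ev_w ev_const by simp_all
    moreover have "e2 ([:[:0, 1:]:] - [:[:a:]:]) = 0" "e2 ([:0, 1:] - [:[:b:]:]) = 0"
      by (simp_all add: e2_def)
    ultimately show "z - \<iota> a \<in> I" "w - \<iota> b \<in> I" unfolding I_def by force+
  qed
  moreover have "I \<noteq> {0}"
  proof
    assume "I = {0}"
    moreover have "evz [:- a, 1:] = z - \<iota> a" by (simp add: evz_def hom_distribs)
    ultimately have "evz [:- a, 1:] = 0" using zI by simp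
    then show False unfolding evz_eq_0_iff by simp
  qed
  ultimately obtain V where V: "valuation_ring \<iota> V" "R \<subseteq> V" "I \<subseteq> place_of V"
    using valuation_ring_exists[OF field_hom_axioms subring_R] R_const by blast
  interpret V: valued_extension \<iota> V by unfold_locales (rule V)
  let ?P = "place_of V"
  have zV: "z \<in> V" using V R_z by blast
  have Pp: "?P \<in> places \<iota>" using place_of_places V by blast
  have "?P \<noteq> Pinf" using affine_place_iff[OF Pp] V.place_ring_place_of zV by simp
  then have Pa: "?P \<in> places \<iota> - {Pinf}" using Pp by blast
  have c: "centre ?P (a, b)" using V zI wI by (auto simp: centre_def)
  have "\<exists>c. x - \<iota> c \<in> ?P" if x: "x \<in> V" for x
  proof -
    obtain y where y: "y \<in> R" "x - y \<in> ?P" using affine_residue[OF V(1) zV x] by blast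
    obtain d where "y - \<iota> d \<in> ?P" using centre_residue[OF y(1), of "(a, b)"] Pa c by blast
    then show ?thesis using y V.place_diff_trans by blast
  qed
  then have "pdeg ?P = 1" using deg_one_iff[OF Pp] V.place_ring_place_of by simp
  then show ?thesis using Pa c Pp by (auto simp: rational_places_def)
qed

theorem card_rational_places:
  "finite (rational_places \<iota>) \<and> card (rational_places \<iota>) = card points + 1"
proof -
  have fin: "finite points" using finite_const finite_prod by (metis finite_subset subset_UNIV)
  have "\<exists>P. ab \<in> points \<longrightarrow> P \<in> rational_places \<iota> - {Pinf} \<and> centre P ab" for ab
    using point_rational_place[of "fst ab" "snd ab"] by (simp only: prod.collapse) blast
  then obtain F where F: "\<And>ab. ab \<in> points \<Longrightarrow> F ab \<in> rational_places \<iota> - {Pinf} \<and> centre (F ab) ab"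
    by metis
  have sub: "rational_places \<iota> - {Pinf} \<subseteq> places \<iota> - {Pinf}" by (auto simp: rational_places_def)
  have surj: "F ` points = rational_places \<iota> - {Pinf}"
  proof (intro equalityI subsetI)
    fix P assume P: "P \<in> rational_places \<iota> - {Pinf}"
    then obtain ab where ab: "ab \<in> points" "centre P ab" using rational_place_centre by blast
    then have "F ab = P" using centre_unique_place[of "F ab" P ab] F[of ab] P sub by blast
    then show "P \<in> F ` points" using ab by blast
  qed (use F in blast)
  have inj: "inj_on F points"
  proof (rule inj_onI)
    fix x y assume xy: "x \<in> points" "y \<in> points" "F x = F y"
    let ?P = "F x"
    have Pp: "?P \<in> places \<iota>" using F[OF xy(1)] sub by blast
    interpret V: discretely_valued_extension \<iota> "place_ring ?P" "unif ?P" using discrete_place[OF Pp] .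
    have pv: "place_of (place_ring ?P) = ?P" using place_ring_valuation[OF Pp] by simp
    have eq: "c = d" if "u - \<iota> c \<in> ?P" "u - \<iota> d \<in> ?P" for u c d
    proof -
      have "\<iota> (c - d) = (u - \<iota> d) - (u - \<iota> c)" by (simp add: hom_distribs)
      then have "\<iota> (c - d) \<in> ?P" using V.place_diff[unfolded pv] that by metis
      then show ?thesis using V.const_place_iff pv by simp
    qed
    have "centre ?P x" "centre ?P y" using F[OF xy(1)] F[OF xy(2)] xy(3) by auto
    then show "x = y" using eq unfolding centre_def by (metis prod_eq_iff)
  qed
  have "Pinf \<in> rational_places \<iota>" using Pinf_places deg_Pinf by (simp add: rational_places_def)
  then have ins: "rational_places \<iota> = insert Pinf (F ` points)" using surj by blast
  have "Pinf \<notin> F ` points" using surj by blast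
  then show ?thesis unfolding ins using fin inj by (simp add: card_image)
qed

end

section \<open>Counting points\<close>

text \<open>Multiplication by \<open>T\<close> acts as squaring; this is Horner's scheme for the
  action.\<close>

lemma additive_power_pCons:
  fixes x :: "'a::field"
  assumes "(1::'a) + 1 = 0"
  shows "additive_power x (pCons c f) = of_bool (c = 1) * x + (additive_power x f)\<^sup>2"
proof -
  have "additive_power x (pCons c f) =
      (\<Sum>i\<le>Suc (degree f). of_bool (coeff (pCons c f) i = 1) * x ^ 2 ^ i)"
    by (rule additive_power_altdef) (simp add: degree_pCons_le)
  also have "\<dots> = of_bool (c = 1) * x + (\<Sum>i\<le>degree f. of_bool (coeff f i = 1) * x ^ 2 ^ Suc i)"
    by (subst sum.atMost_Suc_shift) simp
  also have "(\<Sum>i\<le>degree f. of_bool (coeff f i = 1) * x ^ 2 ^ Suc i) =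
      (\<Sum>i\<le>degree f. (of_bool (coeff f i = 1) * x ^ 2 ^ i) ^ 2 ^ 1)"
    by (intro sum.cong) (auto simp: mult.commute simp flip: power_mult)
  also have "\<dots> = (additive_power x f) ^ 2 ^ 1"
    unfolding additive_power_def by (rule power_two_power_sum[OF assms, symmetric])
  finally show ?thesis by simp
qed

lemma additive_power_add:
  fixes x :: "'a::field"
  assumes "(1::'a) + 1 = 0"
  shows "additive_power x (f + g) = additive_power x f + additive_power x g"
proof -
  let ?n = "max (degree f) (degree g)"
  have "of_bool (c + d = 1) = (of_bool (c = 1) + of_bool (d = 1) :: 'a)" for c d :: bit
    using assms by (cases c; cases d) simp_all
  then show ?thesis
    using additive_power_altdef[of "f + g" ?n x] additive_power_altdef[of f ?n x]
      additive_power_altdef[of g ?n x] degree_add_le_max[of f g]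
    by (simp add: sum.distrib distrib_right)
qed

lemma additive_power_diff:
  fixes x :: "'a::field"
  assumes "(1::'a) + 1 = 0"
  shows "additive_power x (f - g) = additive_power x f - additive_power x g"
  using additive_power_add[OF assms, of x "f - g" g] by (simp add: eq_diff_eq)

lemma additive_power_0 [simp]: "additive_power x 0 = 0"
  by (simp add: additive_power_def)

lemma additive_power_zero_arg [simp]: "additive_power 0 f = 0"
  by (simp add: additive_power_def zero_power)

lemma additive_power_1 [simp]: "additive_power x 1 = x"
  by (simp add: additive_power_def)

lemma additive_power_monom [simp]: "additive_power x (monom 1 n) = x ^ 2 ^ n"
proof -
  have "additive_power x (monom 1 n) = (\<Sum>i\<le>n. if i = n then x ^ 2 ^ i else 0)"
    unfolding additive_power_def degree_monom_eq[OF one_neq_zero] coeff_monom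
    by (intro sum.cong) auto
  then show ?thesis by simp
qed

text \<open>Products of polynomials act as compositions, so identities in \<open>F_2[T]\<close>
  relate kernels and images of additive maps.\<close>

lemma additive_power_mult:
  fixes x :: "'a::field"
  assumes "(1::'a) + 1 = 0"
  shows "additive_power x (f * g) = additive_power (additive_power x g) f"
proof (induction f)
  case (pCons c f)
  have "additive_power x (smult c g) = of_bool (c = 1) * additive_power x g" by (cases c) simp_all
  then show ?case
    using pCons by (simp add: additive_power_add[OF assms] additive_power_pCons[OF assms])
qed simp

lemma additive_poly_nonzero:
  assumes "f \<noteq> 0"
  shows "(additive_poly f :: 'a::field poly) \<noteq> 0"
proof -
  have "lead_coeff f = 1" using assms leading_coeff_0_iff[of f] by (cases "lead_coeff f") simp_all
  have "coeff (additive_poly f :: 'a poly) (2 ^ degree f) = (\<Sum>i\<le>degree f. if i = degree f then of_bool (coeff f i = 1) else 0)"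
    unfolding additive_poly_def coeff_sum coeff_monom by (intro sum.cong) auto
  also have "\<dots> = 1" using \<open>lead_coeff f = 1\<close> by simp
  finally show ?thesis by auto
qed

lemma additive_kernel_card_le:
  assumes "f \<noteq> 0"
  shows "card {x :: 'a::field. additive_power x f = 0} \<le> 2 ^ degree f"
proof -
  have "card {x :: 'a. poly (additive_poly f) x = 0} \<le> degree (additive_poly f :: 'a poly)"
    using additive_poly_nonzero[OF assms] by (rule card_poly_roots_bound)
  also have "\<dots> \<le> 2 ^ degree f"
    unfolding additive_poly_def by (intro degree_sum_le) (auto intro: order_trans[OF degree_monom_le])
  finally show ?thesis by (simp add: poly_additive_poly)
qed

lemma card_eq_image_times_fibre:
  assumes "finite X" and "\<And>y. y \<in> F ` X \<Longrightarrow> card {x \<in> X. F x = y} = k"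
  shows "card X = card (F ` X) * k"
proof -
  have "card X = (\<Sum>y\<in>F ` X. card {x \<in> X. F x = y})"
    using assms(1) by (subst card_UN_disjoint[symmetric]) (auto intro!: arg_cong[of _ _ card])
  then show ?thesis using assms(2) by simp
qed

text \<open>Makes two upper bounds sharp once the product is known; applied to the sizes of image
  and kernel.\<close>

lemma mult_eq_squeeze:
  fixes a b c d :: nat
  assumes "a \<le> c" "b \<le> d" "a * b = c * d" "0 < c" "0 < d"
  shows "a = c \<and> b = d"
proof -
  have "a * b \<le> a * d" using assms(2) by (rule mult_le_mono2)
  moreover have "a * d \<le> c * d" using assms(1) by (rule mult_le_mono1)
  ultimately have "a * d = c * d" using assms(3) by linarith
  then have "a = c" using assms(5) by simp
  then show ?thesis using assms(3,4) by simp
qed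

section \<open>Additive maps and power maps on the field with \<open>q^2\<close> elements\<close>

context
  fixes n q :: nat and K :: "'k::field itself"
  assumes n_pos: "0 < n" and q_def: "q = 2 ^ n" and card_K: "CARD('k) = q\<^sup>2"
begin

lemma card_K_two: "CARD('k) = 2 ^ (2 * n)"
  by (simp add: card_K q_def mult.commute flip: power_mult)

lemma fin_K: "finite (UNIV :: 'k set)"
  using card_K_two by (metis card_ge_0_finite zero_less_numeral zero_less_power)

lemma finite_K: "finite (X :: 'k set)"
  by (rule finite_subset[OF subset_UNIV fin_K])

lemmas char_K = char_two_of_card[OF card_K_two]

lemma minus_K: "- x = (x :: 'k)"
proof -
  have "x + x = x * (1 + 1)" by (simp only: distrib_left mult_1_right)
  then have "x + x = 0" using char_K by simp
  then show ?thesis by (simp add: minus_unique)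
qed

lemma diff_K: "x - y = x + (y :: 'k)"
  using minus_K[of y] by (metis add_uminus_conv_diff)

lemma power_qq: "(x :: 'k) ^ q ^ 2 = x"
  using power_card_field[OF fin_K, of x] card_K by simp

lemma q_ge: "2 \<le> q"
  using n_pos unfolding q_def by (cases n) simp_all

text \<open>\<open>T^(2n) - 1\<close> acts as zero on the field, so the image of \<open>g\<close>
  lies in the kernel of \<open>f\<close>. Both kernels are bounded through the degrees, and image
  times kernel of \<open>g\<close> has \<open>2^(2n)\<close> elements, so both bounds are
  attained.\<close>

lemma additive_kernel_image:
  assumes fg: "f * g = monom 1 (2 * n) - (1 :: bit poly)"
  shows "card {x :: 'k. additive_power x g = 0} = 2 ^ degree g"
    and "range (\<lambda>x :: 'k. additive_power x g) = {x. additive_power x f = 0}"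
proof -
  let ?F = "\<lambda>x :: 'k. additive_power x g"
  let ?k = "card {x. ?F x = 0}"
  have deg: "degree (monom 1 (2 * n) - (1 :: bit poly)) = 2 * n"
    using degree_add_eq_left[of "- 1" "monom (1::bit) (2 * n)"] n_pos by (simp add: degree_monom_eq)
  then have nz: "f \<noteq> 0" "g \<noteq> 0" using fg n_pos by auto
  have dfg: "degree f + degree g = 2 * n" using degree_mult_eq[OF nz] fg deg by simp
  have prod: "CARD('k) = card (range ?F) * ?k"
  proof (rule card_eq_image_times_fibre[OF fin_K])
    fix y assume "y \<in> range ?F"
    then obtain x0 where x0: "y = ?F x0" by blast
    have "bij_betw (\<lambda>x. x - x0) {x \<in> UNIV. ?F x = y} {x. ?F x = 0}"
      by (rule bij_betw_byWitness[where f' = "\<lambda>x. x + x0"])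
        (auto simp: additive_power_diff_arg[OF char_K] x0, metis additive_power_diff_arg[OF char_K] add_diff_cancel_right' add_0 eq_iff_diff_eq_0)
    then show "card {x \<in> UNIV. ?F x = y} = ?k" by (rule bij_betw_same_card)
  qed
  have sub: "range ?F \<subseteq> {x. additive_power x f = 0}"
  proof clarify
    fix x :: 'k
    have "additive_power x (f * g) = x ^ 2 ^ (2 * n) - x"
      by (simp add: fg additive_power_diff[OF char_K])
    also have "\<dots> = 0" using power_card_field[OF fin_K, of x] card_K_two by simp
    finally show "additive_power (?F x) f = 0" by (simp add: additive_power_mult[OF char_K])
  qed
  have fin: "finite {x :: 'k. additive_power x f = 0}" by (rule finite_K)
  have "card (range ?F) \<le> card {x :: 'k. additive_power x f = 0}" using card_mono[OF fin sub] .
  then have le: "card (range ?F) \<le> 2 ^ degree f" using additive_kernel_card_le[OF nz(1)] order_trans by blast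
  have lek: "?k \<le> 2 ^ degree g" using additive_kernel_card_le[OF nz(2)] .
  have "card (range ?F) * ?k = 2 ^ degree f * 2 ^ degree g"
    unfolding power_add[symmetric] dfg using prod unfolding card_K_two by (rule sym)
  then have eq: "card (range ?F) = 2 ^ degree f \<and> ?k = 2 ^ degree g"
    by (rule mult_eq_squeeze[OF le lek]) simp_all
  then show "?k = 2 ^ degree g" by blast
  have "card {x :: 'k. additive_power x f = 0} \<le> card (range ?F)"
    unfolding conjunct1[OF eq] by (rule additive_kernel_card_le[OF nz(1)])
  then show "range ?F = {x. additive_power x f = 0}" by (rule card_seteq[OF fin sub])
qed

text \<open>The same squeeze for the \<open>e\<close>-th power map on the \<open>q^2 - 1\<close>
  nonzero elements, whose image consists of roots of unity of the complementary order
  \<open>e'\<close>.\<close>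

lemma card_roots_of_unity:
  assumes e: "e dvd q\<^sup>2 - 1"
  shows "card {x :: 'k. x ^ e = 1} = e"
proof -
  obtain e' where ee: "q\<^sup>2 - 1 = e * e'" using e by blast
  have "1 < q\<^sup>2" using q_ge by (intro one_less_power) simp_all
  then have pos: "0 < e" "0 < e'" using ee by (auto intro!: Nat.gr0I)
  have bound: "card {x :: 'k. x ^ k = 1} \<le> k" if "0 < k" for k
  proof -
    have "degree (monom 1 k - 1 :: 'k poly) \<le> k"
      by (rule degree_diff_le) (auto simp: degree_monom_le)
    moreover have "coeff (monom 1 k - 1 :: 'k poly) k = 1" using that by simp
    then have "(monom 1 k - 1 :: 'k poly) \<noteq> 0" by (metis coeff_0 zero_neq_one)
    then have "card {x. poly (monom 1 k - 1 :: 'k poly) x = 0} \<le> degree (monom 1 k - 1 :: 'k poly)"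
      by (rule card_poly_roots_bound)
    ultimately show ?thesis by (simp add: poly_monom)
  qed
  let ?X = "UNIV - {0 :: 'k}" and ?k = "card {x :: 'k. x ^ e = 1}"
  have "card ?X = card ((\<lambda>x. x ^ e) ` ?X) * ?k"
  proof (rule card_eq_image_times_fibre)
    fix y assume "y \<in> (\<lambda>x. x ^ e) ` ?X"
    then obtain x0 where x0: "y = x0 ^ e" "x0 \<noteq> 0" by blast
    have "bij_betw (\<lambda>x. x / x0) {x \<in> ?X. x ^ e = y} {x. x ^ e = 1}"
      by (rule bij_betw_byWitness[where f' = "\<lambda>x. x * x0"])
        (use x0 pos in \<open>auto simp: power_divide power_mult_distrib zero_power\<close>)
    then show "card {x \<in> ?X. x ^ e = y} = ?k" by (rule bij_betw_same_card)
  qed (use fin_K in auto)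
  moreover have "card ?X = e * e'" using ee fin_K card_K by simp
  moreover have "card ((\<lambda>x. x ^ e) ` ?X) \<le> e'"
  proof -
    have "(x ^ e) ^ e' = 1" if "x \<noteq> 0" for x :: 'k
    proof -
      have "0 < q\<^sup>2" using \<open>1 < q\<^sup>2\<close> by linarith
      then have "x ^ (q\<^sup>2 - 1) * x = x" by (rule trans[OF power_minus_mult power_qq])
      then have "x ^ (e * e') = 1" using that unfolding ee by simp
      then show ?thesis by (simp add: power_mult)
    qed
    then have "(\<lambda>x. x ^ e) ` ?X \<subseteq> {y. y ^ e' = 1}" by auto
    then have "card ((\<lambda>x. x ^ e) ` ?X) \<le> card {y :: 'k. y ^ e' = 1}"
      using finite_K by (intro card_mono) auto
    then show ?thesis using bound[OF pos(2)] by simp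
  qed
  ultimately show ?thesis
    using mult_eq_squeeze[of "card ((\<lambda>x. x ^ e) ` ?X)" e' ?k e] bound[OF pos(1)] pos by (simp add: mult.commute)
qed

text \<open>Every nonzero element is uniquely \<open>s\<zeta>\<close> with \<open>s\<close> in the field with \<open>q\<close> elements and
  \<open>\<zeta>\<^bsup>q+1\<^esup> = 1\<close>; then \<open>b\<^bsup>Nq\<^esup> - b\<^sup>N = s\<^sup>N (\<zeta>\<^bsup>-N\<^esup> - \<zeta>\<^sup>N)\<close>.\<close>

lemma card_power_trace_in:
  assumes N: "N dvd q + 1" and W0: "0 \<in> W" and Wq: "\<And>y :: 'k. y \<in> W \<Longrightarrow> y ^ q = y"
  shows "card {b :: 'k. (b ^ N) ^ q - b ^ N \<in> W} = 1 + (N * (q - 1) + (q + 1 - N) * (card W - 1))"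
proof -
  define S where "S = {s :: 'k. s ^ (q - 1) = 1}"
  define U where "U = {u :: 'k. u ^ (q + 1) = 1}"
  have qq: "q\<^sup>2 - 1 = (q - 1) * (q + 1)" using q_ge by (simp add: power2_eq_square algebra_simps)
  have cS: "card S = q - 1" unfolding S_def by (rule card_roots_of_unity) (simp only: qq dvd_triv_left)
  have cU: "card U = q + 1" unfolding U_def by (rule card_roots_of_unity) (simp only: qq dvd_triv_right)
  obtain j where j: "q + 1 = N * j" using N by blast
  have NU: "{u :: 'k. u ^ N = 1} \<subseteq> U" unfolding U_def j by (auto simp: power_mult)
  have cN: "card {u :: 'k. u ^ N = 1} = N" by (rule card_roots_of_unity) (simp only: qq dvd_mult[OF N])
  have N0: "0 < N" using N by (intro Nat.gr0I) auto
  have nz: "s \<noteq> 0" if "s \<in> S" for s using that q_ge by (auto simp: S_def zero_power)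
  have nzU: "u \<noteq> 0" if "u \<in> U" for u using that by (auto simp: U_def)
  have Sq: "s ^ q = s" if "s \<in> S" for s
    using that power_minus_mult[of q s] q_ge by (simp add: S_def)
  have Sq': "s \<in> S" if "s ^ q = s" "s \<noteq> 0" for s
    using that power_minus_mult[of q s] q_ge by (simp add: S_def)
  have Uq: "u ^ q = inverse u" if "u \<in> U" for u
    using that nzU[OF that] by (simp add: U_def field_simps)
  have sq1: "x = 1" if "x * x = 1" for x :: 'k
  proof -
    have "(x - 1) ^ 2 ^ 1 = x ^ 2 ^ 1 - 1 ^ 2 ^ 1" by (rule power_two_power_diff[OF char_K])
    then show ?thesis using that by (simp add: power2_eq_square)
  qed
  \<comment> \<open>The \<open>q\<close>-th power is the identity on \<open>S\<close> and inversion
    on \<open>U\<close>, so a common element has square \<open>1\<close>, which forces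
    \<open>1\<close> in characteristic two.\<close>
  have SU: "x = 1" if "x \<in> S" "x \<in> U" for x
    using Sq[OF that(1)] Uq[OF that(2)] nzU[OF that(2)] sq1[of x] by (simp add: field_simps)
  have S_mult: "x * y \<in> S" "inverse x \<in> S" if "x \<in> S" "y \<in> S" for x y
    using that by (simp_all add: S_def power_mult_distrib power_inverse)
  have U_mult: "x * y \<in> U" "inverse x \<in> U" if "x \<in> U" "y \<in> U" for x y
    using that unfolding U_def mem_Collect_eq power_mult_distrib power_inverse
    by (simp_all only: mult_1_left inverse_1)
  have S_power: "x ^ k \<in> S" if "x \<in> S" for x k
  proof -
    have "(x ^ k) ^ (q - 1) = (x ^ (q - 1)) ^ k" by (simp only: power_mult[symmetric] mult.commute)
    then show ?thesis using that by (simp add: S_def)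
  qed
  have finSU: "finite S" "finite U" "finite W" by (rule finite_K)+
  have injSU: "inj_on (\<lambda>(s, u). s * u) (S \<times> U)"
  proof (rule inj_onI, clarify)
    fix s u s' u' assume a: "s \<in> S" "u \<in> U" "s' \<in> S" "u' \<in> U" "s * u = s' * u'"
    have eq: "s * inverse s' = u' * inverse u" using a nz nzU by (simp add: field_simps)
    have "s * inverse s' \<in> S" "u' * inverse u \<in> U" using a S_mult U_mult by blast+
    then have "s * inverse s' = 1" using SU eq by metis
    then show "s = s' \<and> u = u'" using a nz nzU eq by (simp add: field_simps)
  qed
  have imgSU: "(\<lambda>(s, u). s * u) ` (S \<times> U) = UNIV - {0}"
  proof (rule card_subset_eq)
    show "card ((\<lambda>(s, u). s * u) ` (S \<times> U)) = card (UNIV - {0 :: 'k})"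
      using card_image[OF injSU] fin_K card_K cS cU qq by (simp add: card_cartesian_product)
  qed (use fin_K nz nzU in auto)
  define good where "good b \<longleftrightarrow> (b ^ N) ^ q - b ^ N \<in> W" for b
  define c where "c u = inverse (u ^ N) - u ^ N" for u :: 'k
  have su: "good (s * u) \<longleftrightarrow> s ^ N * c u \<in> W" if "s \<in> S" "u \<in> U" for s u
  proof -
    have "((s * u) ^ N) ^ q = (s ^ q) ^ N * (u ^ q) ^ N"
      by (simp add: power_mult_distrib mult.commute flip: power_mult)
    also have "\<dots> = s ^ N * inverse (u ^ N)" using Sq Uq that by (simp add: power_inverse)
    finally have "((s * u) ^ N) ^ q - (s * u) ^ N = s ^ N * c u"
      by (simp add: c_def power_mult_distrib right_diff_distrib)
    then show ?thesis by (simp add: good_def)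
  qed
  have "{b. good b} = insert 0 ((\<lambda>(s, u). s * u) ` {(s, u). s \<in> S \<and> u \<in> U \<and> s ^ N * c u \<in> W})"
  proof (intro equalityI subsetI)
    fix b assume b: "b \<in> {b. good b}"
    show "b \<in> insert 0 ((\<lambda>(s, u). s * u) ` {(s, u). s \<in> S \<and> u \<in> U \<and> s ^ N * c u \<in> W})"
    proof (cases "b = 0")
      case False
      then have "b \<in> (\<lambda>(s, u). s * u) ` (S \<times> U)" using imgSU by blast
      then obtain s u where "s \<in> S" "u \<in> U" "b = s * u" by auto
      then show ?thesis using b su by auto
    qed simp
  next
    fix b assume "b \<in> insert 0 ((\<lambda>(s, u). s * u) ` {(s, u). s \<in> S \<and> u \<in> U \<and> s ^ N * c u \<in> W})"
    then show "b \<in> {b. good b}"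
      using su W0 N0 q_ge by (auto simp: good_def[of 0] zero_power)
  qed
  moreover have "0 \<notin> (\<lambda>(s, u). s * u) ` {(s, u). s \<in> S \<and> u \<in> U \<and> s ^ N * c u \<in> W}"
    using nz nzU by auto
  moreover have "card ((\<lambda>(s, u). s * u) ` {(s, u). s \<in> S \<and> u \<in> U \<and> s ^ N * c u \<in> W}) =
      card {(s, u). s \<in> S \<and> u \<in> U \<and> s ^ N * c u \<in> W}"
    by (rule card_image, rule inj_on_subset[OF injSU]) auto
  moreover have "finite {(s, u). s \<in> S \<and> u \<in> U \<and> s ^ N * c u \<in> W}"
    by (rule finite_subset[of _ "S \<times> U"]) (use finSU in auto)
  ultimately have c1: "card {b. good b} = 1 + card {(s, u). s \<in> S \<and> u \<in> U \<and> s ^ N * c u \<in> W}"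
    by simp
  have "card {(s, u). s \<in> S \<and> u \<in> U \<and> s ^ N * c u \<in> W} = card (SIGMA u:U. {s \<in> S. s ^ N * c u \<in> W})"
    by (rule bij_betw_same_card[of "\<lambda>(s, u). (u, s)"]) (auto simp: bij_betw_def inj_on_def image_iff)
  also have "\<dots> = (\<Sum>u\<in>U. card {s \<in> S. s ^ N * c u \<in> W})"
    using finSU by (intro card_SigmaI) auto
  \<comment> \<open>If \<open>u ^ N = 1\<close>, then \<open>c u = 0\<close> and every
    \<open>s\<close> counts. Otherwise \<open>s ^ N * c u\<close> runs once through
    \<open>S\<close>, which contains all nonzero elements of \<open>W\<close>.\<close>
  also have "\<dots> = (\<Sum>u\<in>U. if u ^ N = 1 then q - 1 else card W - 1)"
  proof (rule sum.cong[OF refl])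
    fix u assume u: "u \<in> U"
    show "card {s \<in> S. s ^ N * c u \<in> W} = (if u ^ N = 1 then q - 1 else card W - 1)"
    proof (cases "u ^ N = 1")
      case True
      then show ?thesis using W0 cS by (simp add: c_def)
    next
      case False
      have "c u \<noteq> 0"
      proof
        assume "c u = 0"
        then have "u ^ N * u ^ N = 1" using nzU[OF u] by (simp add: c_def field_simps)
        then show False using sq1 False by blast
      qed
      \<comment> \<open>The \<open>q\<close>-th power exchanges \<open>u ^ N\<close> and its
        inverse, and signs do not matter in characteristic two.\<close>
      moreover have "c u ^ q = c u"
      proof -
        have uq: "(u ^ N) ^ q = inverse (u ^ N)"
        proof -
          have "(u ^ N) ^ q = (u ^ q) ^ N" by (simp only: power_mult[symmetric] mult.commute)
          then show ?thesis using Uq[OF u] by (simp add: power_inverse)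
        qed
        have "c u ^ q = inverse (u ^ N) ^ q - (u ^ N) ^ q"
          unfolding c_def q_def by (rule power_two_power_diff[OF char_K])
        also have "\<dots> = u ^ N - inverse (u ^ N)" unfolding power_inverse uq by simp
        finally show ?thesis unfolding c_def diff_K by (simp add: add.commute)
      qed
      ultimately have cS': "c u \<in> S" by (intro Sq')
      \<comment> \<open>As \<open>N\<close> divides \<open>q + 1\<close>, the kernel of the
        \<open>N\<close>-th power map lies in \<open>U\<close>, which meets \<open>S\<close> only in
        \<open>1\<close>.\<close>
      have inj: "inj_on (\<lambda>s. s ^ N * c u) S"
      proof (rule inj_onI)
        fix s s' assume a: "s \<in> S" "s' \<in> S" "s ^ N * c u = s' ^ N * c u"
        then have "(s * inverse s') ^ N = 1" using \<open>c u \<noteq> 0\<close> nz by (simp add: power_mult_distrib power_inverse)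
        then have "s * inverse s' \<in> U" using NU by blast
        then have "s * inverse s' = 1" using SU S_mult a by blast
        then show "s = s'" using a nz by (simp add: field_simps)
      qed
      have img: "(\<lambda>s. s ^ N * c u) ` S = S"
        by (rule card_subset_eq) (use finSU cS' S_mult S_power card_image[OF inj] in auto)
      have WS: "W - {0} \<subseteq> S" using Wq Sq' by blast
      have "(\<lambda>s. s ^ N * c u) ` {s \<in> S. s ^ N * c u \<in> W} = W - {0}"
      proof (intro equalityI subsetI)
        fix y assume y: "y \<in> W - {0}"
        then have "y \<in> (\<lambda>s. s ^ N * c u) ` S" using WS img by blast
        then show "y \<in> (\<lambda>s. s ^ N * c u) ` {s \<in> S. s ^ N * c u \<in> W}" using y by blast
      qed (use nz \<open>c u \<noteq> 0\<close> in auto)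
      then have "card {s \<in> S. s ^ N * c u \<in> W} = card (W - {0})"
        using card_image[OF inj_on_subset[OF inj]] by (metis (no_types, lifting) mem_Collect_eq subsetI)
      then show ?thesis using False W0 finSU by simp
    qed
  qed
  also have "\<dots> = card (U \<inter> {u. u ^ N = 1}) * (q - 1) + card (U \<inter> - {u. u ^ N = 1}) * (card W - 1)"
    using finSU by (simp add: sum.If_cases)
  also have "U \<inter> {u. u ^ N = 1} = {u. u ^ N = 1}" using NU by blast
  also have "U \<inter> - {u. u ^ N = 1} = U - {u. u ^ N = 1}" by blast
  also have "card (U - {u. u ^ N = 1}) = q + 1 - N"
    using card_Diff_subset[OF finite_subset[OF NU finSU(2)] NU] cU cN by simp
  finally show ?thesis using c1 cN unfolding good_def by simp
qed

text \<open>With \<open>W\<close> the kernel of \<open>(T - 1) p\<close>, the values of the additive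
  polynomial are the \<open>u\<close> with \<open>u ^ q - u\<close> in \<open>W\<close>, each taken
  \<open>D\<close> times. This leaves the count of \<open>b\<close> in
  \<open>card_power_trace_in\<close>.\<close>

lemma card_affine_points:
  assumes N: "N dvd q + 1" and ph: "p * h = H_poly n"
  shows "int (card {(a :: 'k, b). b ^ N = additive_power a h}) =
    int q ^ 2 + (int N - 1) * (2 ^ degree h - 1) * int q"
proof -
  define t :: "bit poly" where "t = monom 1 1 - 1"
  define T :: "bit poly" where "T = monom 1 n - 1"
  have tH: "t * H_poly n = T"
    using power_diff_1_eq[of "monom (1::bit) 1" n] by (simp add: t_def T_def H_poly_def monom_power)
  \<comment> \<open>Squaring is additive over the field with two elements, so
    \<open>T^(2n) - 1\<close> is a square and contains \<open>h\<close> as well as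
    \<open>(T - 1) p\<close> as factors.\<close>
  have TT: "T * T = monom 1 (2 * n) - 1"
  proof -
    have "c + c = 0" for c :: bit by (cases c) simp_all
    then have two: "f + f = 0" for f :: "bit poly"
      by (intro poly_eqI) (simp only: coeff_add coeff_0)
    have "T * T = monom 1 n * monom 1 n - (monom 1 n + monom 1 n) + (1 + 1) - 1"
      unfolding T_def left_diff_distrib right_diff_distrib by simp
    also have "\<dots> = monom 1 n * monom 1 n - 1" unfolding two by simp
    finally show ?thesis by (simp add: mult_monom mult_2)
  qed
  have f1: "(t * p * T) * h = monom 1 (2 * n) - 1" using TT tH ph by (metis mult.assoc mult.commute)
  have f2: "(h * T) * (t * p) = monom 1 (2 * n) - 1" using f1 by (simp add: mult_ac)
  have dT: "degree T = n"
    using degree_add_eq_left[of "- 1" "monom (1::bit) n"] n_pos by (simp add: T_def degree_monom_eq)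
  have tph: "t * p * h = T" using tH ph by (simp add: mult.assoc)
  then have "t * p \<noteq> 0" "h \<noteq> 0" using dT n_pos by auto
  then have dd: "degree (t * p) + degree h = n" using degree_mult_eq tph dT by metis
  define W where "W = {y :: 'k. additive_power y (t * p) = 0}"
  define D where "D = (2::nat) ^ degree h"
  have cW: "card W = 2 ^ degree (t * p)" unfolding W_def using additive_kernel_image(1)[OF f2] .
  have apT: "additive_power x T = x ^ q - x" for x :: 'k
    by (simp add: T_def q_def additive_power_diff[OF char_K])
  have Wq: "y ^ q = y" if "y \<in> W" for y
  proof -
    have "additive_power y (h * (t * p)) = 0"
      using that by (simp add: additive_power_mult[OF char_K] W_def)
    then show ?thesis using tph apT[of y] by (simp add: mult.commute)
  qed
  have W0: "0 \<in> W" by (simp add: W_def)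
  have im: "u \<in> range (\<lambda>a :: 'k. additive_power a h) \<longleftrightarrow> u ^ q - u \<in> W" for u
    unfolding additive_kernel_image(2)[OF f1] W_def mem_Collect_eq additive_power_mult[OF char_K, of _ "t * p" T] apT ..
  have fib: "card {a :: 'k. additive_power a h = u} = (if u ^ q - u \<in> W then D else 0)" for u
  proof (cases "u ^ q - u \<in> W")
    case True
    then obtain a0 where a0: "u = additive_power a0 h" using im by blast
    have "bij_betw (\<lambda>a. a - a0) {a. additive_power a h = u} {a. additive_power a h = 0}"
      by (rule bij_betw_byWitness[where f' = "\<lambda>x. x + a0"])
        (auto simp: additive_power_diff_arg[OF char_K] a0, metis additive_power_diff_arg[OF char_K] add_diff_cancel_right' add_0 eq_iff_diff_eq_0)
    then show ?thesis
      using bij_betw_same_card additive_kernel_image(1)[OF f1] True by (fastforce simp: D_def)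
  next
    case False
    then have "{a. additive_power a h = u} = {}" using im by blast
    then show ?thesis using False by simp
  qed
  have "card {(a :: 'k, b). b ^ N = additive_power a h} = card (SIGMA b:UNIV. {a :: 'k. additive_power a h = b ^ N})"
    by (rule bij_betw_same_card[of "\<lambda>(a, b). (b, a)"]) (auto simp: bij_betw_def inj_on_def image_iff)
  also have "\<dots> = (\<Sum>b\<in>UNIV. card {a :: 'k. additive_power a h = b ^ N})"
    using finite_K by (intro card_SigmaI) auto
  also have "\<dots> = card {b :: 'k. (b ^ N) ^ q - b ^ N \<in> W} * D"
    unfolding fib using fin_K by (simp add: sum.If_cases)
  also have "\<dots> = (1 + (N * (q - 1) + (q + 1 - N) * (card W - 1))) * D"
    using card_power_trace_in[OF N W0 Wq] by simp
  finally have c: "card {(a :: 'k, b). b ^ N = additive_power a h} =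
      (1 + (N * (q - 1) + (q + 1 - N) * (card W - 1))) * D" .
  \<comment> \<open>The degrees of \<open>t * p\<close> and \<open>h\<close> add up to
    \<open>n\<close>; this relation brings the count into its closed form.\<close>
  have WD: "int (card W) * int D = int q"
    using dd unfolding cW D_def q_def by (simp flip: power_add)
  have "N \<le> q + 1" using N by (auto dest: dvd_imp_le)
  moreover have "1 \<le> card W" unfolding cW by simp
  moreover have "1 \<le> q" using q_ge by simp
  ultimately have "int (card {(a :: 'k, b). b ^ N = additive_power a h}) =
      (1 + (int N * (int q - 1) + (int q + 1 - int N) * (int (card W) - 1))) * int D"
    unfolding c by (simp add: of_nat_diff) (simp add: algebra_simps)
  also have "\<dots> = int D + int N * int D * (int q - 1) + (int q + 1 - int N) * (int (card W) * int D - int D)"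
    by (simp add: algebra_simps)
  also have "\<dots> = int q ^ 2 + (int N - 1) * (int D - 1) * int q"
    unfolding WD by (simp add: algebra_simps power2_eq_square)
  finally show ?thesis by (simp add: D_def)
qed

end

theorem theorem4p6:
  fixes n q m d :: nat
    and p :: "bit poly"
    and \<iota> :: "'k::field \<Rightarrow> 'a::field"
    and w z :: 'a
  assumes "n \<ge> 2"
    and "q = 2 ^ n"
    and "m > 0"
    and "m dvd q + 1"
    and "p dvd H_poly n"
    and "degree p = d"
    and "CARD('k) = q\<^sup>2"
    and "field_hom \<iota>"
    and "generated_subfield (range \<iota> \<union> {w, z}) = UNIV"
    and "\<not> algebraic_over \<iota> z"
    and "w ^ ((q + 1) div m) = additive_power z (H_poly n div p)"
  shows "maximal_function_field q \<iota> \<and>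
    real_of_int (genus \<iota>) =
      (real q + 1 - real m) / (2 * real m) * (2 ^ (n - 1 - d) - 1)"
proof -
  define N where "N = (q + 1) div m"
  define h where "h = H_poly n div p"
  have mN: "m * N = q + 1" using assms(4) by (simp add: N_def)
  then have Ndvd: "N dvd q + 1" by (metis dvd_triv_right)
  have ph: "p * h = H_poly n" using assms(5) by (simp add: h_def)
  have H0: "coeff (H_poly n) 0 = 1"
    using assms(1) by (simp add: H_poly_def coeff_sum)
  have dH: "degree (H_poly n) = n - 1"
  proof (rule antisym)
    show "degree (H_poly n) \<le> n - 1"
      unfolding H_poly_def by (rule degree_sum_le) (auto intro: order_trans[OF degree_monom_le])
    have "coeff (H_poly n) (n - 1) = 1" using assms(1) by (simp add: H_poly_def coeff_sum)
    then show "n - 1 \<le> degree (H_poly n)" by (intro le_degree) simp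
  qed
  have "H_poly n \<noteq> 0" using H0 by auto
  then have nz: "p \<noteq> 0" "h \<noteq> 0" using ph by auto
  have dh: "degree h = n - 1 - d" using degree_mult_eq[OF nz] ph dH assms(6) by simp
  have "coeff p 0 * coeff h 0 = 1" using H0 ph by (metis coeff_mult_0)
  then have h0: "coeff h 0 = 1" by (cases "coeff h 0") simp_all
  have "odd N"
  proof
    assume "even N"
    then have "even (q + 1)" using mN by (metis dvd_mult)
    then show False using assms(1,2) by simp
  qed
  have card2: "CARD('k) = 2 ^ (2 * n)" using assms(2,7) by (simp add: mult.commute flip: power_mult)
  interpret additive_kummer \<iota> w z N "2 * n" h
    by (intro additive_kummer.intro additive_kummer_axioms.intro)
      (use assms card2 \<open>odd N\<close> h0 in \<open>auto simp: N_def h_def\<close>)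
  \<comment> \<open>The doubled form is the one that occurs in the point count; since
    \<open>N\<close> is odd, the integer division in \<open>genus_eq\<close> is exact.\<close>
  have g2: "2 * genus \<iota> = (int N - 1) * (int D - 1)"
  proof -
    have "even ((N - 1) * (D - 1))" using \<open>odd N\<close> by simp
    then have "2 * ((N - 1) * (D - 1) div 2) = (N - 1) * (D - 1)" by simp
    then have "2 * genus \<iota> = int ((N - 1) * (D - 1))" unfolding genus_eq by (metis of_nat_mult of_nat_numeral)
    then show ?thesis using N_pos D_pos by (simp add: of_nat_diff)
  qed
  have "int (card points) = int q ^ 2 + (int N - 1) * (2 ^ degree h - 1) * int q"
    using card_affine_points[of n q, OF _ assms(2,7) Ndvd ph] assms(1) by (simp add: points_def)
  also have "\<dots> = int q ^ 2 + 2 * genus \<iota> * int q" unfolding g2 by (simp add: D_def)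
  finally have "int (card (rational_places \<iota>)) = int q ^ 2 + 1 + 2 * genus \<iota> * int q"
    using card_rational_places by simp
  then have "maximal_function_field q \<iota>"
    unfolding maximal_function_field_def
    using function_field assms(7) card_rational_places by simp
  moreover have "real_of_int (genus \<iota>) = (real q + 1 - real m) / (2 * real m) * (2 ^ (n - 1 - d) - 1)"
  proof -
    have "2 * real_of_int (genus \<iota>) = (real N - 1) * (real D - 1)"
      using arg_cong[OF g2, of real_of_int] by simp
    moreover have "real D = 2 ^ (n - 1 - d)" by (simp add: D_def dh)
    moreover have "real m * real N = real q + 1" using mN by (metis of_nat_1 of_nat_add of_nat_mult)
    then have "real N - 1 = (real q + 1 - real m) / real m" using assms(3) by (simp add: field_simps)
    ultimately have "2 * real_of_int (genus \<iota>) = (real q + 1 - real m) / real m * (2 ^ (n - 1 - d) - 1)" by simp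
    moreover have "x = y / 2" if "2 * x = y" for x y :: real using that by simp
    ultimately have "real_of_int (genus \<iota>) = (real q + 1 - real m) / real m * (2 ^ (n - 1 - d) - 1) / 2" by blast
    also have "\<dots> = (real q + 1 - real m) / (2 * real m) * (2 ^ (n - 1 - d) - 1)" by simp
    finally show ?thesis .
  qed
  ultimately show ?thesis by blast
qed

end
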